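(* The following identities hold. (1) We have $$\overline{F}_{\mathrm{eu}}^{\mathrm{ou}}(q) = \frac{(-q^2;q^2)_\infty}{2(q^2;q^2)_\infty}\left(1+\Theta^2(\tau)\right).$$ (2) We have $$\overline{F}_{\mathrm{ou}}^{\mathrm{eu}}(q) = \frac{(-q^2;q^2)_\infty}{(q^2;q^2)_\infty} + \frac{2q}{1-q}\,\frac{(-q^2;q^2)_\infty}{(q^2;q^2)_\infty}\sum_{n\ge 0}\frac{(-q,q^2;q^2)_n}{(q^3,-q^2;q^2)_n}\,q^{2n}.$$ (3) We have $$\overline{F}_{\mathrm{ed}}^{\mathrm{od}}(q) = (-2q;q^2)_\infty - \frac{q}{1-q}(-2q^2;q^2)_\infty + \frac{q}{1-q}(-2q;q^2)_\infty.$$ (4) We have $$\overline{F}_{\mathrm{od}}^{\mathrm{ed}}(q) = (-2q^2;q^2)_\infty + \frac{q}{1-q}\left(3(-2q^2;q^2)_\infty - (-2q;q^2)_\infty\right).$$ (5) We have $$\overline{F}_{\mathrm{eu}}^{\mathrm{od}}(q) = \frac{(-q^2;q^2)_\infty}{(q^2;q^2)_\infty}\sum_{n\ge 0}\frac{2^n q^{n^2}}{(-q^2;q^2)_n}.$$ (6) We have $$\overline{F}_{\mathrm{od}}^{\mathrm{eu}}(q) = -\frac{(-2q,q^2;q^2)_\infty}{(-q^2;q^2)_\infty}\sum_{n\ge 0}\frac{(-1)^n q^{2n}}{(2q;q^2)_{n+1}} + 2\sum_{n\ge 0}\frac{(-1)^n 2^n q^{n^2+2n}}{(1+q^{2n+2})(2q;q^2)_{n+1}}.$$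 (7) We have $$\overline{F}_{\mathrm{ed}}^{\mathrm{ou}}(q) = \frac{(-q^2;q^2)_\infty}{(q^2;q^2)_\infty} + 2q\,(-2q^2;q^2)_\infty\sum_{n\ge 0}\frac{(-1)^n q^{2n}}{(2q;q^2)_{n+1}} + \frac{2q\,(-q;q^2)_\infty}{(q^3;q^2)_\infty}\sum_{n\ge 0}\frac{(-1)^n 2^n (-q;q^2)_n\, q^{n^2+3n}}{(2q,-q^2;q^2)_{n+1}}.$$ (8) We have $$\overline{F}_{\mathrm{ou}}^{\mathrm{ed}}(q) = (-2q^2;q^2)_\infty + \sum_{n\ge 0}\frac{(-q;q^2)_n\,(-2q^{2n+2};q^2)_\infty}{(q;q^2)_{n+1}}\,q^{2n+1}.$$
   Context: **$q$-Pochhammer symbols.** For $n\in\mathbb{N}_0\cup\{\infty\}$ and $m\in\mathbb{N}$, $(a;q)_n := \prod_{k=0}^{n-1}(1-aq^k)$ and $(a_1,\dots,a_m;q)_n := \prod_{k=1}^m (a_k;q)_n$; with $q$ replaced by $q^2$ this gives $(a;q^2)_n=\prod_{k=0}^{n-1}(1-aq^{2k})$, etc. **Theta function.** $\Theta(\tau) := \sum_{n\in\mathbb{Z}} q^{n^2}$, where $q:=e^{2\pi i\tau}$ (the Jacobi theta function). **Overpartitions.** A partition of $n$ is a non-increasing sequence of positive integers (its parts) with sum $n$. An overpartition of $n$ is a partition of $n$ in which the first instance of each part may possibly be overlined. An overpartition has parts separated by parity if each even part is larger than each odd part, or if each odd part is larger than each even part; overpartitions into only odd parts or only even parts are permitted.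 **The counting functions.** Let $\{\mathrm{x},\mathrm{z}\}=\{\mathrm{e},\mathrm{o}\}$ and $\mathrm{y},\mathrm{w}\in\{\mathrm{u},\mathrm{d}\}$, where $\mathrm{e}$ = even, $\mathrm{o}$ = odd, $\mathrm{u}$ = unrestricted, $\mathrm{d}$ = distinct. Then $\overline{p}_{\mathrm{xy}}^{\mathrm{zw}}(n)$ is the number of overpartitions of $n$ with parts separated by parity such that every part of parity $\mathrm{z}$ (upper index) is larger than every part of parity $\mathrm{x}$ (lower index), where the parts of parity $\mathrm{x}$ must be distinct if $\mathrm{y}=\mathrm{d}$ and are unrestricted if $\mathrm{y}=\mathrm{u}$, and the parts of parity $\mathrm{z}$ must be distinct if $\mathrm{w}=\mathrm{d}$ and are unrestricted if $\mathrm{w}=\mathrm{u}$. Parts required to be distinct may be overlined. For example, $\overline{p}_{\mathrm{od}}^{\mathrm{eu}}(3)=6$, counting $3,\ \overline{3},\ 2+1,\ \overline{2}+1,\ 2+\overline{1},\ \overline{2}+\overline{1}$. The generating functions are $\overline{F}_{\mathrm{xy}}^{\mathrm{zw}}(q) := \sum_{n\ge 0}\overline{p}_{\mathrm{xy}}^{\mathrm{zw}}(n)\,q^n$.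
   Formalization: (6)-(8) fail at q^1 as printed. With A=(-q^2;q^2)_∞/(q^2;q^2)_∞: (6) is A+2qA·[printed right side]; (7) has first term (-q;q^2)_∞/(q;q^2)_∞ and a minus before the second; (8) has a factor 2 before the sum. (6),(7) assume (2q;q^2)_n≠0. *)

theory Defs
  imports "HOL-Analysis.Analysis"
begin

definition qpoch :: "complex \<Rightarrow> complex \<Rightarrow> nat \<Rightarrow> complex" where
  "qpoch a q n = (\<Prod>k<n. 1 - a * q ^ k)"

definition qpoch_inf :: "complex \<Rightarrow> complex \<Rightarrow> complex" where
  "qpoch_inf a q = (\<Prod>k. 1 - a * q ^ k)"

definition jacobi_Theta :: "complex \<Rightarrow> complex" where
  "jacobi_Theta \<tau> = (\<Sum>\<^sub>\<infinity>n::int. exp (2 * of_real pi * \<i> * \<tau>) powi (n\<^sup>2))"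

definition is_partition :: "nat \<Rightarrow> nat list \<Rightarrow> bool" where
  "is_partition n ps \<longleftrightarrow> sorted_wrt (\<ge>) ps \<and> (\<forall>p \<in> set ps. p > 0) \<and> sum_list ps = n"

definition first_instances :: "nat list \<Rightarrow> nat set" where
  "first_instances ps = {i. i < length ps \<and> (\<forall>j<i. ps ! j \<noteq> ps ! i)}"

(* An overpartition is encoded as a pair (ps, I): the underlying partition ps together with
   the set I of (0-based) positions of its overlined parts. *)
definition is_overpartition :: "nat \<Rightarrow> nat list \<times> nat set \<Rightarrow> bool" where
  "is_overpartition n = (\<lambda>(ps, I). is_partition n ps \<and> I \<subseteq> first_instances ps)"

datatype part_parity = Even | Odd

datatype part_restriction = Unrestricted | Distinct

fun has_parity :: "part_parity \<Rightarrow> nat \<Rightarrow> bool" where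
  "has_parity Even k = even k"
| "has_parity Odd k = odd k"

definition parts_larger :: "part_parity \<Rightarrow> part_parity \<Rightarrow> nat list \<Rightarrow> bool" where
  "parts_larger z x ps \<longleftrightarrow>
     (\<forall>a \<in> set ps. \<forall>b \<in> set ps. has_parity z a \<longrightarrow> has_parity x b \<longrightarrow> a > b)"

definition separated_by_parity :: "nat list \<Rightarrow> bool" where
  "separated_by_parity ps \<longleftrightarrow> parts_larger Even Odd ps \<or> parts_larger Odd Even ps"

fun obeys :: "part_restriction \<Rightarrow> nat list \<Rightarrow> bool" where
  "obeys Unrestricted ps = True"
| "obeys Distinct ps = distinct ps"

(* The first two arguments x, y are the lower indices and the last two z, w the upper indices.
   Only x \<noteq> z is meaningful. Distinctness refers to the sizes of the parts, disregarding
   overlines, so a part and its overlined version are not distinct. *)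
definition pbar ::
  "part_parity \<Rightarrow> part_restriction \<Rightarrow> part_parity \<Rightarrow> part_restriction \<Rightarrow> nat \<Rightarrow> nat" where
  "pbar x y z w n = card {(ps, I). is_overpartition n (ps, I)
      \<and> separated_by_parity ps \<and> parts_larger z x ps
      \<and> obeys y (filter (has_parity x) ps) \<and> obeys w (filter (has_parity z) ps)}"

definition Fbar ::
  "part_parity \<Rightarrow> part_restriction \<Rightarrow> part_parity \<Rightarrow> part_restriction \<Rightarrow> complex \<Rightarrow> complex" where
  "Fbar x y z w q = (\<Sum>n. of_nat (pbar x y z w n) * q ^ n)"

end

theory Submission
  imports Defs "HOL-Library.Multiset"
begin

text \<open>Every generating function is obtained by sorting the overpartitions by their largest part of the
lower parity x (if there is one). An overpartition is a multiset of parts in which each part size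
that occurs may be overlined, so a multiset \<open>M\<close> counts with weight
\<open>2 ^ card (set_mset M)\<close>, and part sizes contribute independently: an unrestricted part size \<open>k\<close>
contributes \<open>(1 + q^k) / (1 - q^k)\<close>, a distinct one contributes \<open>1 + 2 q^k\<close>. Once the largest part
of parity x is fixed, the condition that the parts of parity z are larger only bounds them from
below. This gives (\<open>Fbar_by_largest_lower_part\<close>) a single series for all eight functions, whose
terms are a finite product over the lower parts times an infinite product over the upper parts.
The rest is the evaluation of this series; write \<open>(a)_n\<close> for \<open>qpoch a Q n\<close> with \<open>Q = q^2\<close>.

If both kinds of parts are distinct, the series telescopes (\<open>distinct_parts_telescope\<close>). If the
lower parts are odd and unrestricted, it already is the claimed right-hand side, up to pulling
common factors out of the products.

If the lower parts are even and unrestricted, the series is a Heine series: with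
\<open>(- Q)_\<infinity> / (Q)_\<infinity>\<close> taken out, it becomes \<open>\<Sum>n. q^n \<Prod>j<n. (b + a Q^j) / (1 + Q^(j+1))\<close>
(\<open>heine_transformation\<close>). For distinct odd parts the product is \<open>2^n Q^(n(n-1)/2) / (- Q)_n\<close>, as
claimed. For unrestricted odd parts it collapses to \<open>2 / (1 + Q^n)\<close>, and Jacobi's theorem
\<open>\<Theta>^2 = 1 + 4 \<Sum>n\<ge>1. q^n / (1 + q^(2n))\<close> (\<open>jacobi_two_squares\<close>) identifies the sum. Jacobi's theorem
follows from two finite identities, proved by telescoping, which in the limit write
\<open>\<Sum>n. (- 1)^n q^(n^2)\<close> as an infinite product and the square of this product as a series, and from
a bijection that turns this series into a Lambert series.

If the lower parts are distinct and the upper ones unrestricted, the series is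
\<open>S = \<Sum>n. (a)_n (b)_n / (c)_n Q^n\<close> with \<open>c = - b\<close>. It satisfies a first-order inhomogeneous recurrence
under \<open>c \<mapsto> c / Q\<close>. A multiple of the first of the two series in the claim satisfies the same recurrence
with only the infinite products in the inhomogeneous term. They cancel in the recurrence for the
difference, and iterating the latter generates the second series term by term (\<open>three_phi_two_partial_theta\<close>).\<close>

section \<open>Finite and infinite q-Pochhammer symbols\<close>

lemma qpoch_0 [simp]: "qpoch a q 0 = 1"
  by (simp add: qpoch_def)

lemma qpoch_Suc: "qpoch a q (Suc n) = qpoch a q n * (1 - a * q ^ n)"
  by (simp add: qpoch_def)

lemma qpoch_add: "qpoch a q (m + n) = qpoch a q m * qpoch (a * q ^ m) q n"
  by (induction n) (simp_all add: qpoch_Suc power_add mult_ac)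

lemma qpoch_Suc_left: "qpoch a q (Suc n) = (1 - a) * qpoch (a * q) q n"
  using qpoch_add[of a q 1 n] by (simp add: qpoch_def)

lemma qpoch_zero_left [simp]: "qpoch 0 q n = 1"
  by (simp add: qpoch_def)

lemma qpoch_nonzero:
  assumes "\<And>k. k < n \<Longrightarrow> a * q ^ k \<noteq> 1"
  shows "qpoch a q n \<noteq> 0"
  using assms by (auto simp: qpoch_def)

lemma qpoch_nonzero_small:
  assumes "norm q < 1" "norm a < 1"
  shows "a * q ^ k \<noteq> (1 :: complex)"
proof -
  have "norm a * norm q ^ k \<le> norm a * 1"
    using assms by (intro mult_left_mono power_le_one) auto
  then have "norm (a * q ^ k) \<le> norm a" by (simp add: norm_mult norm_power)
  then show ?thesis using assms(2) by force
qed

lemma convergent_prod_qpoch: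
  assumes "norm q < 1"
  shows "convergent_prod (\<lambda>k. 1 - a * q ^ k :: complex)"
proof (rule abs_convergent_prod_imp_convergent_prod, rule summable_imp_abs_convergent_prod)
  have "summable (\<lambda>k. norm a * norm q ^ k)"
    using assms by (intro summable_mult summable_geometric) auto
  then show "summable (\<lambda>k. norm (1 - a * q ^ k - 1))"
    by (simp add: norm_mult norm_power)
qed

lemma qpoch_LIMSEQ:
  assumes "norm q < 1"
  shows "qpoch a q \<longlonglongrightarrow> qpoch_inf a q"
  using has_prod_imp_tendsto'[OF convergent_prod_has_prod[OF convergent_prod_qpoch[OF assms]], of a]
  by (simp add: qpoch_def[abs_def] qpoch_inf_def)

lemma qpoch_inf_split:
  assumes "norm q < 1"
  shows "qpoch_inf a q = qpoch a q n * qpoch_inf (a * q ^ n) q"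
proof -
  have "(\<lambda>m. qpoch a q (n + m)) \<longlonglongrightarrow> qpoch_inf a q"
    using LIMSEQ_ignore_initial_segment[OF qpoch_LIMSEQ[OF assms], of a n] by (simp add: add.commute)
  moreover have "(\<lambda>m. qpoch a q (n + m)) \<longlonglongrightarrow> qpoch a q n * qpoch_inf (a * q ^ n) q"
    unfolding qpoch_add by (intro tendsto_mult_left qpoch_LIMSEQ assms)
  ultimately show ?thesis by (rule LIMSEQ_unique)
qed

lemma qpoch_inf_Suc:
  assumes "norm q < 1"
  shows "qpoch_inf a q = (1 - a) * qpoch_inf (a * q) q"
  using qpoch_inf_split[OF assms, of a 1] by (simp add: qpoch_def)

lemma qpoch_inf_zero_left [simp]: "norm q < 1 \<Longrightarrow> qpoch_inf 0 q = 1"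
  by (simp add: qpoch_inf_def)

lemma qpoch_inf_nonzero:
  assumes "norm q < 1" "\<And>k. a * q ^ k \<noteq> 1"
  shows "qpoch_inf a q \<noteq> 0"
  unfolding qpoch_inf_def using assms by (intro prodinf_nonzero convergent_prod_qpoch) auto

lemma qpoch_norm_le:
  assumes "norm q < 1"
  shows "norm (qpoch a q n) \<le> exp (norm a / (1 - norm q))"
proof -
  have "norm (qpoch a q n) = (\<Prod>k<n. norm (1 - a * q ^ k))"
    by (simp add: qpoch_def prod_norm)
  also have "\<dots> \<le> (\<Prod>k<n. 1 + norm a * norm q ^ k)"
  proof (intro prod_mono conjI)
    fix k
    show "norm (1 - a * q ^ k) \<le> 1 + norm a * norm q ^ k"
      using norm_triangle_ineq4[of 1 "a * q ^ k"] by (simp add: norm_mult norm_power)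
  qed auto
  also have "\<dots> \<le> exp (\<Sum>k<n. norm a * norm q ^ k)"
    by (intro prod_le_exp_sum) auto
  also have "(\<Sum>k<n. norm a * norm q ^ k) \<le> norm a * (1 / (1 - norm q))"
  proof -
    have "(\<Sum>k<n. norm q ^ k) \<le> (\<Sum>k. norm q ^ k)"
      using assms by (intro sum_le_suminf summable_geometric) auto
    then show ?thesis using assms
      by (auto simp: suminf_geometric simp del: times_divide_eq_right simp flip: sum_distrib_left
          intro!: mult_left_mono)
  qed
  finally show ?thesis by simp
qed

lemma qpoch_inf_norm_le:
  assumes "norm q < 1"
  shows "norm (qpoch_inf a q) \<le> exp (norm a / (1 - norm q))"
  by (rule LIMSEQ_le_const2[OF tendsto_norm[OF qpoch_LIMSEQ[OF assms, of a]]])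
     (use qpoch_norm_le[OF assms] in blast)

text \<open>A sequence of nonzero numbers with a nonzero limit stays away from zero. This is how
  Pochhammer symbols in denominators are dominated below.\<close>

lemma qpoch_bounded_below:
  assumes "norm q < 1" "\<And>k. a * q ^ k \<noteq> 1"
  obtains d where "d > 0" "\<And>n. d \<le> norm (qpoch a q n)"
proof -
  have "(\<lambda>n. inverse (qpoch a q n)) \<longlonglongrightarrow> inverse (qpoch_inf a q)"
    by (intro tendsto_inverse qpoch_LIMSEQ qpoch_inf_nonzero assms)
  then have "Bseq (\<lambda>n. inverse (qpoch a q n))"
    by (metis convergentI convergent_imp_Bseq)
  then obtain K where K: "K > 0" "\<And>n. norm (inverse (qpoch a q n)) \<le> K"
    by (auto simp: Bseq_def)
  show ?thesis
  proof
    show "inverse K > 0" using K by simp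
    fix n
    have "qpoch a q n \<noteq> 0" using assms by (intro qpoch_nonzero) auto
    then show "inverse K \<le> norm (qpoch a q n)"
      using K(2)[of n] K(1) by (simp add: norm_inverse norm_divide divide_simps mult.commute)
  qed
qed

text \<open>Removing a few leading factors makes the remaining product nonzero, so the tails can be
  written as quotients of a nonzero limit by a sequence that converges to it.\<close>

lemma qpoch_inf_tail_LIMSEQ:
  assumes "norm q < 1"
  shows "(\<lambda>n. qpoch_inf (a * q ^ n) q) \<longlonglongrightarrow> 1"
proof -
  have "(\<lambda>n. a * q ^ n) \<longlonglongrightarrow> a * 0"
    using assms by (intro tendsto_intros LIMSEQ_power_zero) auto
  then have "eventually (\<lambda>n. norm (a * q ^ n) < 1) sequentially"
    using order_tendstoD(2)[OF tendsto_norm, of "\<lambda>n. a * q ^ n" "a * 0" sequentially 1] by simp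
  then obtain m where m: "norm (a * q ^ m) < 1" by (auto simp: eventually_sequentially)
  define b where "b = a * q ^ m"
  have nz: "b * q ^ k \<noteq> 1" for k
    using qpoch_nonzero_small[OF assms m] by (simp add: b_def)
  have nzi: "qpoch_inf b q \<noteq> 0" by (intro qpoch_inf_nonzero assms nz)
  have "(\<lambda>n. qpoch_inf b q / qpoch b q n) \<longlonglongrightarrow> qpoch_inf b q / qpoch_inf b q"
    by (intro tendsto_intros qpoch_LIMSEQ assms nzi)
  also have "(\<lambda>n. qpoch_inf b q / qpoch b q n) = (\<lambda>n. qpoch_inf (b * q ^ n) q)"
  proof
    fix n
    have "qpoch b q n \<noteq> 0" by (intro qpoch_nonzero nz)
    then show "qpoch_inf b q / qpoch b q n = qpoch_inf (b * q ^ n) q"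
      using qpoch_inf_split[OF assms, of b n] by simp
  qed
  finally have "(\<lambda>n. qpoch_inf (b * q ^ n) q) \<longlonglongrightarrow> 1" using nzi by simp
  moreover have "(\<lambda>n. qpoch_inf (b * q ^ n) q) = (\<lambda>n. qpoch_inf (a * q ^ (n + m)) q)"
    by (simp add: b_def power_add mult_ac)
  ultimately show ?thesis
    using LIMSEQ_offset[of "\<lambda>n. qpoch_inf (a * q ^ n) q" m] by simp
qed

lemma tannery_sequence:
  fixes f :: "nat \<Rightarrow> nat \<Rightarrow> complex"
  assumes "\<And>k. f k \<longlonglongrightarrow> g k" "\<And>k n. norm (f k n) \<le> M k" "summable M"
  shows "(\<lambda>n. \<Sum>k. f k n) \<longlonglongrightarrow> (\<Sum>k. g k)"
  using tannerys_theorem[of f g sequentially M] assms by (simp add: case_prod_unfold)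

lemma summable_bounded_geometric:
  fixes c :: "nat \<Rightarrow> complex"
  assumes "Bseq c" "norm p < 1"
  shows "summable (\<lambda>n. norm (c n * p ^ n))"
proof -
  obtain K where K: "K > 0" "\<And>n. norm (c n) \<le> K" using assms(1) by (auto simp: Bseq_def)
  show ?thesis
  proof (rule summable_comparison_test')
    show "summable (\<lambda>n. K * norm p ^ n)"
      using assms by (intro summable_mult summable_geometric) auto
    show "norm (norm (c n * p ^ n)) \<le> K * norm p ^ n" if "n \<ge> 0" for n
      using K by (simp add: norm_mult norm_power mult_right_mono)
  qed
qed

lemma one_minus_power_nonzero:
  fixes p :: complex
  assumes "norm p < 1" "n > 0"
  shows "p ^ n \<noteq> 1" "p ^ n \<noteq> - 1" "1 + p ^ n \<noteq> 0"
proof -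
  have "norm (p ^ n) < 1" using assms by (simp add: norm_power power_less_one_iff)
  then show "p ^ n \<noteq> 1" "p ^ n \<noteq> - 1" by auto
  then show "1 + p ^ n \<noteq> 0" by (metis add_eq_0_iff)
qed

lemma qpoch_self_nonzero:
  assumes "norm p < 1"
  shows "qpoch p p n \<noteq> 0" "qpoch (- p) p n \<noteq> 0" "qpoch_inf p p \<noteq> 0" "qpoch_inf (- p) p \<noteq> 0"
proof -
  have 1: "p * p ^ k \<noteq> 1" "- p * p ^ k \<noteq> 1" for k
    using one_minus_power_nonzero[OF assms, of "Suc k"] by (auto simp: minus_equation_iff)
  then show "qpoch p p n \<noteq> 0" "qpoch (- p) p n \<noteq> 0" "qpoch_inf p p \<noteq> 0" "qpoch_inf (- p) p \<noteq> 0"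
    by (simp_all add: qpoch_nonzero qpoch_inf_nonzero assms)
qed

section \<open>Generating functions of multisets with prescribed multiplicities\<close>

text \<open>The contribution of all overpartitions with underlying multiset \<open>M\<close> to a generating
  function: each of the distinct part sizes is overlined or not.\<close>

definition overpartition_weight :: "complex \<Rightarrow> nat multiset \<Rightarrow> complex" where
  "overpartition_weight q M = 2 ^ card (set_mset M) * q ^ sum_mset M"

text \<open>The generating function of the copies of a single part size \<open>k\<close>, when \<open>C\<close> is the set of allowed
  multiplicities. The factor 2 is the choice of overlining.\<close>

definition part_gf :: "complex \<Rightarrow> nat \<Rightarrow> nat set \<Rightarrow> complex" where
  "part_gf q k C = (\<Sum>\<^sub>\<infinity>c\<in>C. (if c = 0 then 1 else 2) * q ^ (k * c))"

definition with_multiplicities :: "(nat \<Rightarrow> nat set) \<Rightarrow> nat multiset set" where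
  "with_multiplicities f = {M. \<forall>k. count M k \<in> f k}"

lemma has_sum_times_complex:
  fixes f :: "'a \<Rightarrow> complex" and g :: "'b \<Rightarrow> complex"
  assumes f: "(f has_sum a) A" and g: "(g has_sum b) B"
  shows "((\<lambda>(x, y). f x * g y) has_sum (a * b)) (A \<times> B)"
proof (rule has_sum_SigmaI)
  show "((\<lambda>y. case (x, y) of (x, y) \<Rightarrow> f x * g y) has_sum (f x * b)) B" for x
    using has_sum_cmult_right[OF g] by simp
  show "((\<lambda>x. f x * b) has_sum (a * b)) A" by (rule has_sum_cmult_left[OF f])
  have fs: "(\<lambda>x. norm (f x)) summable_on A"
    using has_sum_imp_summable[OF f] summable_on_iff_abs_summable_on_complex by blast
  have gs: "(\<lambda>x. norm (g x)) summable_on B"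
    using has_sum_imp_summable[OF g] summable_on_iff_abs_summable_on_complex by blast
  have "(\<lambda>z. norm (case z of (x, y) \<Rightarrow> f x * g y)) summable_on A \<times> B"
    unfolding Infinite_Sum.abs_summable_on_Sigma_iff
    using fs gs by (auto simp: norm_mult infsum_cmult_right' infsum_nonneg
        intro!: summable_on_cmult_right summable_on_cmult_left)
  then show "(\<lambda>(x, y). f x * g y) summable_on A \<times> B" by (rule abs_summable_summable)
qed

text \<open>A summable family may be summed along any sequence of subsets that eventually contains each
  finite set. What is left over is bounded by the tail of
  the series of norms.\<close>

lemma has_sum_exhaustion:
  fixes f :: "'a \<Rightarrow> complex"
  assumes f: "f summable_on A"
    and sub: "\<And>n. n \<ge> K \<Longrightarrow> B n \<subseteq> A"
    and ex: "\<And>F. finite F \<Longrightarrow> F \<subseteq> A \<Longrightarrow> \<exists>m. \<forall>n\<ge>m. F \<subseteq> B n"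
    and s: "\<And>n. (f has_sum s n) (B n)" and L: "s \<longlonglongrightarrow> L"
  shows "(f has_sum L) A"
proof -
  have g: "(\<lambda>x. norm (f x)) summable_on A"
    using f summable_on_iff_abs_summable_on_complex by blast
  have "s \<longlonglongrightarrow> infsum f A"
  proof (rule LIMSEQ_I)
    fix r :: real assume "r > 0"
    then obtain F where F: "finite F" "F \<subseteq> A"
      "dist (sum (\<lambda>x. norm (f x)) F) (infsum (\<lambda>x. norm (f x)) A) \<le> r / 2"
      using infsum_finite_approximation[OF g, of "r / 2"] by auto
    obtain m where m: "\<And>n. n \<ge> m \<Longrightarrow> F \<subseteq> B n" using ex[OF F(1,2)] by blast
    have "norm (s n - infsum f A) < r" if n: "n \<ge> max K m" for n
    proof -
      have BA: "B n \<subseteq> A" and FB: "F \<subseteq> B n" using sub m n by auto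
      have "infsum f (A - B n) = infsum f A - infsum f (B n)"
        by (rule infsum_Diff[OF f has_sum_imp_summable[OF s] BA])
      then have "norm (s n - infsum f A) = norm (infsum f (A - B n))"
        using infsumI[OF s] by (simp add: norm_minus_commute)
      also have "\<dots> \<le> infsum (\<lambda>x. norm (f x)) (A - B n)"
        by (intro norm_infsum_bound summable_on_subset_banach[OF g]) auto
      also have "\<dots> \<le> infsum (\<lambda>x. norm (f x)) (A - F)"
        using FB by (intro infsum_mono2 summable_on_subset_banach[OF g]) auto
      also have "\<dots> = infsum (\<lambda>x. norm (f x)) A - sum (\<lambda>x. norm (f x)) F"
        using infsum_Diff[OF g _ F(2)] F(1) by simp
      also have "\<dots> \<le> r / 2" using F(3) unfolding dist_real_def by linarith
      finally show ?thesis using \<open>r > 0\<close> by linarith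
    qed
    then show "\<exists>no. \<forall>n\<ge>no. norm (s n - infsum f A) < r" by blast
  qed
  then have "L = infsum f A" using L LIMSEQ_unique by blast
  then show ?thesis using has_sum_infsum[OF f] by simp
qed

lemma part_gf_summable:
  fixes q :: complex
  assumes "norm q < 1" "k > 0"
  shows "(\<lambda>c. (if c = 0 then 1 else 2) * q ^ (k * c)) summable_on C"
proof -
  have "norm (q ^ k) < 1" using assms by (simp add: norm_power power_less_one_iff)
  then have s: "summable (\<lambda>c. 2 * norm (q ^ k) ^ c)" by (intro summable_mult summable_geometric) auto
  have "summable (\<lambda>c. norm ((if c = 0 then 1 else 2) * q ^ (k * c)))"
    by (rule summable_comparison_test'[OF s]) (auto simp: norm_mult norm_power power_mult)
  then have "(\<lambda>c. (if c = 0 then 1 else 2) * q ^ (k * c)) summable_on UNIV"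
    by (rule norm_summable_imp_summable_on)
  then show ?thesis by (rule summable_on_subset_banach) simp
qed

lemma overpartition_weight_replicate:
  assumes "k \<notin># M"
  shows "overpartition_weight q (M + replicate_mset c k) = overpartition_weight q M * ((if c = 0 then 1 else 2) * q ^ (k * c))"
  using assms by (simp add: overpartition_weight_def power_add mult_ac)

text \<open>The weight is multiplicative over part sizes, so a multiset with parts at most \<open>N + 1\<close> splits into
  its parts at most \<open>N\<close> and a number of copies of \<open>N + 1\<close>.\<close>

lemma overpartition_weight_bounded_support:
  assumes q: "norm q < 1"
  shows "(overpartition_weight q has_sum (\<Prod>k=1..N. part_gf q k (f k)))
    {M. set_mset M \<subseteq> {1..N} \<and> (\<forall>k\<in>{1..N}. count M k \<in> f k)}"
proof (induction N)
  case 0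
  have e: "{M. set_mset M \<subseteq> {1..0::nat} \<and> (\<forall>k\<in>{1..0}. count M k \<in> f k)} = {{#}}" by auto
  show ?case unfolding e by (rule has_sum_finiteI) (simp_all add: overpartition_weight_def)
next
  case (Suc N)
  let ?S = "\<lambda>N. {M. set_mset M \<subseteq> {1..N} \<and> (\<forall>k\<in>{1..N}. count M k \<in> f k)}"
  have "((\<lambda>(M, c). overpartition_weight q M * ((if c = 0 then 1 else 2) * q ^ (Suc N * c)))
      has_sum ((\<Prod>k=1..N. part_gf q k (f k)) * part_gf q (Suc N) (f (Suc N)))) (?S N \<times> f (Suc N))"
    unfolding part_gf_def[of q "Suc N"]
    by (intro has_sum_times_complex Suc has_sum_infsum part_gf_summable q) simp
  also have "?this \<longleftrightarrow> (overpartition_weight q has_sum ((\<Prod>k=1..N. part_gf q k (f k)) * part_gf q (Suc N) (f (Suc N)))) (?S (Suc N))"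
  proof (rule has_sum_reindex_bij_witness[where j = "\<lambda>(M, c). M + replicate_mset c (Suc N)"
        and i = "\<lambda>M. (filter_mset (\<lambda>k. k \<noteq> Suc N) M, count M (Suc N))"])
    fix a assume "a \<in> ?S N \<times> f (Suc N)"
    then obtain M c where a: "a = (M, c)" and M: "set_mset M \<subseteq> {1..N}" "\<forall>k\<in>{1..N}. count M k \<in> f k"
      and c: "c \<in> f (Suc N)" by auto
    have notin: "Suc N \<notin># M" using M(1) by auto
    have cnt: "count M (Suc N) = 0" using notin by (simp add: not_in_iff)
    have fM: "filter_mset (\<lambda>k. k \<noteq> Suc N) M = M"
      using cnt by (auto simp: multiset_eq_iff)
    show "(\<lambda>M. (filter_mset (\<lambda>k. k \<noteq> Suc N) M, count M (Suc N))) ((\<lambda>(M, c). M + replicate_mset c (Suc N)) a) = a"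
      using cnt fM by (simp add: a)
    show "(\<lambda>(M, c). M + replicate_mset c (Suc N)) a \<in> ?S (Suc N)"
      using M c cnt by (auto simp: a split: if_splits simp: le_Suc_eq)
    show "overpartition_weight q ((\<lambda>(M, c). M + replicate_mset c (Suc N)) a)
      = (case a of (M, c) \<Rightarrow> overpartition_weight q M * ((if c = 0 then 1 else 2) * q ^ (Suc N * c)))"
      using overpartition_weight_replicate[OF notin] by (simp add: a)
  next
    fix b assume b: "b \<in> ?S (Suc N)"
    show "(\<lambda>(M, c). M + replicate_mset c (Suc N)) ((\<lambda>M. (filter_mset (\<lambda>k. k \<noteq> Suc N) M, count M (Suc N))) b) = b"
      by (auto simp: multiset_eq_iff)
    show "(\<lambda>M. (filter_mset (\<lambda>k. k \<noteq> Suc N) M, count M (Suc N))) b \<in> ?S N \<times> f (Suc N)"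
    proof -
      have "count b (Suc N) \<in> f (Suc N)" using b by simp
      then show ?thesis using b by (auto simp: le_Suc_eq subset_iff)
    qed
  qed simp
  finally show ?case by simp
qed

lemma part_gf_UNIV:
  assumes "norm q < 1" "k > 0"
  shows "part_gf q k UNIV = (1 + q ^ k) / (1 - q ^ k)"
proof -
  have n: "norm (q ^ k) < 1" using assms by (simp add: norm_power power_less_one_iff)
  then have ne: "1 - q ^ k \<noteq> 0" by auto
  have "(\<lambda>c. 2 * (q ^ k) ^ c - (if c = 0 then 1 else 0)) sums (2 * (1 / (1 - q ^ k)) - 1)"
    by (intro sums_diff sums_mult geometric_sums n sums_single[of 0 "\<lambda>_. 1", simplified])
  moreover have "2 * (q ^ k) ^ c - (if c = 0 then 1 else 0) = (if c = 0 then 1 else 2) * q ^ (k * c)" for c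
    by (simp add: power_mult)
  ultimately have "(\<lambda>c. (if c = 0 then 1 else 2) * q ^ (k * c)) sums (2 * (1 / (1 - q ^ k)) - 1)" by simp
  moreover have "(\<lambda>c. (if c = 0 then 1 else 2) * q ^ (k * c)) sums part_gf q k UNIV"
    unfolding part_gf_def by (intro has_sum_imp_sums has_sum_infsum part_gf_summable assms)
  ultimately have "part_gf q k UNIV = 2 * (1 / (1 - q ^ k)) - 1" using sums_unique2 by blast
  also have "\<dots> = (1 + q ^ k) / (1 - q ^ k)" using ne by (simp add: field_simps)
  finally show ?thesis .
qed

text \<open>The norm of the weight is again a weight, at \<open>norm q\<close>; so finite partial sums are bounded by
  the generating functions \<open>(- r)_N / (r)_N\<close> of overpartitions with parts at most \<open>N\<close>, which
  converge.\<close>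

lemma overpartition_weight_summable:
  assumes q: "norm q < 1"
  shows "overpartition_weight q summable_on {M. 0 \<notin># M}"
proof (rule abs_summable_summable, unfold abs_summable_iff_bdd_above, rule bdd_aboveI2)
  define r where "r = complex_of_real (norm q)"
  have r: "norm r < 1" using q by (simp add: r_def)
  fix F assume F: "F \<in> {F. F \<subseteq> {M :: nat multiset. 0 \<notin># M} \<and> finite F}"
  define N where "N = Max (insert 0 (\<Union>M\<in>F. set_mset M))"
  have N: "k \<le> N" if "M \<in> F" "k \<in># M" for M k
    unfolding N_def using that F by (intro Max_ge) auto
  have "((\<lambda>M. Re (overpartition_weight r M)) has_sum Re (\<Prod>k=1..N. part_gf r k UNIV)) {M. set_mset M \<subseteq> {1..N}}"
    using overpartition_weight_bounded_support[OF r, of N "\<lambda>_. UNIV"] by (intro has_sum_Re) simp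
  moreover have "Re (overpartition_weight r M) = norm (overpartition_weight q M)" for M
  proof -
    have "overpartition_weight r M = of_real (norm (overpartition_weight q M))"
      by (simp add: overpartition_weight_def r_def norm_mult norm_power)
    then show ?thesis by simp
  qed
  ultimately have hs: "((\<lambda>M. norm (overpartition_weight q M)) has_sum Re (\<Prod>k=1..N. part_gf r k UNIV)) {M. set_mset M \<subseteq> {1..N}}"
    by simp
  have "(\<Sum>M\<in>F. norm (overpartition_weight q M)) \<le> Re (\<Prod>k=1..N. part_gf r k UNIV)"
  proof (rule finite_sum_le_has_sum[OF hs])
    show "F \<subseteq> {M. set_mset M \<subseteq> {1..N}}"
    proof safe
      fix M k assume k: "M \<in> F" "k \<in># M"
      then have "0 \<notin># M" using F by auto
      then have "k \<noteq> 0" using k by metis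
      then show "k \<in> {1..N}" using N[OF k] by auto
    qed
  qed (use F in auto)
  also have "\<dots> \<le> norm (\<Prod>k=1..N. part_gf r k UNIV)" by (rule complex_Re_le_cmod)
  also have "(\<Prod>k=1..N. part_gf r k UNIV) = qpoch (- r) r N / qpoch r r N"
    unfolding qpoch_def prod_dividef[symmetric]
    by (rule prod.reindex_bij_witness[of _ Suc "\<lambda>k. k - 1"]) (auto simp: part_gf_UNIV r simp flip: power_Suc)
  also have "norm \<dots> \<le> (SUP N. norm (qpoch (- r) r N / qpoch r r N))"
  proof (rule cSUP_upper)
    have "(\<lambda>n. qpoch (- r) r n / qpoch r r n) \<longlonglongrightarrow> qpoch_inf (- r) r / qpoch_inf r r"
      using qpoch_self_nonzero[OF r] by (intro tendsto_divide qpoch_LIMSEQ r) auto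
    then have "Bseq (\<lambda>n. qpoch (- r) r n / qpoch r r n)" using convergentI convergent_imp_Bseq by blast
    then show "bdd_above (range (\<lambda>n. norm (qpoch (- r) r n / qpoch r r n)))"
      by (auto simp: Bseq_def intro: bdd_aboveI2)
  qed simp
  finally show "(\<Sum>M\<in>F. norm (overpartition_weight q M)) \<le> (SUP N. norm (qpoch (- complex_of_real (norm q)) (complex_of_real (norm q)) N / qpoch (complex_of_real (norm q)) (complex_of_real (norm q)) N))"
    by (simp add: r_def)
qed

text \<open>The Euler product for prescribed multiplicities. Cutting off at \<open>2 * N\<close> keeps the numbers of even
  and odd part sizes equal, which is how the limit is evaluated later. Part sizes beyond \<open>K\<close> may
  be absent, so that multisets with bounded parts exhaust the family.\<close>

lemma overpartition_weight_with_multiplicities: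
  assumes q: "norm q < 1" and f0: "f 0 = {0}" and fK: "\<And>k. k > K \<Longrightarrow> 0 \<in> f k"
    and L: "(\<lambda>N. \<Prod>k=1..2*N. part_gf q k (f k)) \<longlonglongrightarrow> L"
  shows "(overpartition_weight q has_sum L) (with_multiplicities f)"
proof -
  have zero_notin: "0 \<notin># M" if "M \<in> with_multiplicities f" for M
  proof -
    have "count M 0 \<in> f 0" using that by (simp add: with_multiplicities_def)
    then show ?thesis using f0 by (simp add: not_in_iff)
  qed
  show ?thesis
  proof (rule has_sum_exhaustion[OF _ _ _ overpartition_weight_bounded_support[OF q] L])
  show "overpartition_weight q summable_on with_multiplicities f"
  proof (rule summable_on_subset_banach[OF overpartition_weight_summable[OF q]])
    show "with_multiplicities f \<subseteq> {M. 0 \<notin># M}"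
      using zero_notin by blast
  qed
next
  fix n assume n: "n \<ge> K"
  show "{M. set_mset M \<subseteq> {1..2*n} \<and> (\<forall>k\<in>{1..2*n}. count M k \<in> f k)} \<subseteq> with_multiplicities f"
  proof (clarsimp simp: with_multiplicities_def)
    fix M k assume M: "set_mset M \<subseteq> {Suc 0..2*n}" "\<forall>k\<in>{Suc 0..2*n}. count M k \<in> f k"
    show "count M k \<in> f k"
    proof (cases "k \<in> {Suc 0..2*n}")
      case False
      then have "count M k = 0" using M(1) by (metis count_eq_zero_iff in_mono)
      moreover have "k = 0 \<or> k > K" using False n by auto
      ultimately show ?thesis using f0 fK by auto
    qed (use M(2) in blast)
  qed
next
  fix F assume F: "finite F" "F \<subseteq> with_multiplicities f"
  define m where "m = Max (insert 0 (\<Union>M\<in>F. set_mset M))"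
  have m: "k \<le> m" if "M \<in> F" "k \<in># M" for M k
    unfolding m_def using that F by (intro Max_ge) auto
  have "k \<noteq> 0" if "M \<in> F" "k \<in># M" for M k
    using that F(2) zero_notin by (metis in_mono)
  then have "F \<subseteq> {M. set_mset M \<subseteq> {1..2*n} \<and> (\<forall>k\<in>{1..2*n}. count M k \<in> f k)}" if "n \<ge> m" for n
    using F(2) m that by (fastforce simp: with_multiplicities_def Suc_le_eq)
  then show "\<exists>m. \<forall>n\<ge>m. F \<subseteq> {M. set_mset M \<subseteq> {1..2*n} \<and> (\<forall>k\<in>{1..2*n}. count M k \<in> f k)}" by blast
qed
qed

section \<open>Overpartitions as weighted multisets\<close>

fun allowed_multiplicities :: "part_restriction \<Rightarrow> nat set" where
  "allowed_multiplicities Unrestricted = UNIV"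
| "allowed_multiplicities Distinct = {0, 1}"

text \<open>The multisets underlying the overpartitions that \<open>pbar x y z w\<close> counts.\<close>

definition admissible ::
  "part_parity \<Rightarrow> part_restriction \<Rightarrow> part_parity \<Rightarrow> part_restriction \<Rightarrow> nat multiset set" where
  "admissible x y z w = {M. 0 \<notin># M
     \<and> (\<forall>a\<in>#M. \<forall>b\<in>#M. has_parity z a \<longrightarrow> has_parity x b \<longrightarrow> a > b)
     \<and> (\<forall>k. has_parity x k \<longrightarrow> count M k \<in> allowed_multiplicities y)
     \<and> (\<forall>k. has_parity z k \<longrightarrow> count M k \<in> allowed_multiplicities w)}"

lemma obeys_filter_iff:
  "obeys y (filter P ps) \<longleftrightarrow> (\<forall>k. P k \<longrightarrow> count (mset ps) k \<in> allowed_multiplicities y)"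
proof (cases y)
  case Distinct
  have "distinct (filter P ps) \<longleftrightarrow> (\<forall>k. count (mset (filter P ps)) k \<le> 1)"
    unfolding distinct_count_atmost_1
    by (metis (no_types, lifting) One_nat_def Suc_leI antisym_conv count_greater_zero_iff le_zero_eq
        mset_filter not_in_iff order_le_less set_mset_mset zero_le_one)
  also have "\<dots> \<longleftrightarrow> (\<forall>k. P k \<longrightarrow> count (mset ps) k \<in> {0, 1})"
    by (auto simp: le_Suc_eq)
  finally show ?thesis using Distinct by simp
qed simp

lemma card_first_instances: "card (first_instances ps) = card (set ps)"
proof (rule bij_betw_same_card)
  show "bij_betw (\<lambda>i. ps ! i) (first_instances ps) (set ps)"
    unfolding bij_betw_def
  proof
    show "inj_on ((!) ps) (first_instances ps)"
      by (rule inj_onI, rule ccontr) (metis (mono_tags, lifting) first_instances_def linorder_neqE_nat mem_Collect_eq)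
    show "(!) ps ` first_instances ps = set ps"
    proof safe
      fix i assume "i \<in> first_instances ps"
      then show "ps ! i \<in> set ps" by (simp add: first_instances_def)
    next
      fix v assume "v \<in> set ps"
      then have ex: "\<exists>i. i < length ps \<and> ps ! i = v" by (simp add: in_set_conv_nth)
      define i where "i = (LEAST i. i < length ps \<and> ps ! i = v)"
      have i: "i < length ps \<and> ps ! i = v" unfolding i_def by (rule LeastI_ex[OF ex])
      have "ps ! j \<noteq> ps ! i" if "j < i" for j
        using not_less_Least[of j "\<lambda>i. i < length ps \<and> ps ! i = v"] that i by (auto simp: i_def)
      then have "i \<in> first_instances ps" using i by (simp add: first_instances_def)
      then show "v \<in> (!) ps ` first_instances ps" using i by blast
    qed
  qed
qed

lemma finite_partitions: "finite {ps. is_partition n ps}"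
proof (rule finite_subset)
  show "{ps. is_partition n ps} \<subseteq> {ps. set ps \<subseteq> {..n} \<and> length ps \<le> n}"
  proof (clarify, intro conjI subsetI)
    fix ps :: "nat list" assume p: "is_partition n ps"
    then have pos: "\<forall>p\<in>set ps. p > 0" and s: "sum_list ps = n" by (auto simp: is_partition_def)
    show "p \<in> {..n}" if "p \<in> set ps" for p using member_le_sum_list[OF that] s by simp
    have "length ps \<le> sum_list ps" using pos by (induction ps) auto
    then show "length ps \<le> n" using s by simp
  qed
  show "finite {ps. set ps \<subseteq> {..n} \<and> length ps \<le> n}"
    by (rule finite_lists_length_le) simp
qed

lemma decreasing_mset_unique:
  fixes ps qs :: "nat list"
  assumes "sorted_wrt (\<ge>) ps" "sorted_wrt (\<ge>) qs" "mset ps = mset qs"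
  shows "ps = qs"
proof -
  have "sorted (rev ps)" "sorted (rev qs)" using assms by (simp_all add: sorted_wrt_rev)
  then have "rev ps = rev qs"
    using assms(3) by (metis mset_rev properties_for_sort)
  then show ?thesis by simp
qed

text \<open>Overlined positions correspond to subsets of the first instances, and these are as many as the
  distinct part sizes; hence the power of two. Separation by parity is implied by the comparison
  of the two parities, since \<open>x\<close> and \<open>z\<close> are the two parities in some order.\<close>

lemma pbar_eq_sum:
  assumes "x \<noteq> z"
  shows "finite {M \<in> admissible x y z w. sum_mset M = n}"
    and "pbar x y z w n = (\<Sum>M\<in>{M \<in> admissible x y z w. sum_mset M = n}. 2 ^ card (set_mset M))"
proof -
  define P where "P = {ps. is_partition n ps \<and> separated_by_parity ps \<and> parts_larger z x ps
      \<and> obeys y (filter (has_parity x) ps) \<and> obeys w (filter (has_parity z) ps)}"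
  have fin: "finite P" by (rule finite_subset[OF _ finite_partitions[of n]]) (auto simp: P_def)
  have sep: "separated_by_parity ps" if "parts_larger z x ps" for ps
    using that assms by (cases x; cases z) (auto simp: separated_by_parity_def)
  have img: "mset ` P = {M \<in> admissible x y z w. sum_mset M = n}"
  proof safe
    fix ps assume "ps \<in> P"
    then show "mset ps \<in> admissible x y z w" "sum_mset (mset ps) = n"
      by (auto simp: P_def admissible_def is_partition_def parts_larger_def obeys_filter_iff sum_mset_sum_list)
  next
    fix M assume M: "M \<in> admissible x y z w" and n: "n = sum_mset M"
    define ps where "ps = rev (sorted_list_of_multiset M)"
    have m: "mset ps = M" by (simp add: ps_def)
    have "sorted_wrt (\<ge>) ps" by (simp add: ps_def sorted_wrt_rev)
    moreover have "\<forall>p\<in>set ps. p > 0"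
      using M by (auto simp: admissible_def m[symmetric] intro: gr0I)
    moreover have "sum_list ps = n" by (simp add: n m flip: sum_mset_sum_list)
    moreover have "parts_larger z x ps"
      using M by (auto simp: admissible_def parts_larger_def m[symmetric])
    ultimately have "ps \<in> P"
      using M sep by (auto simp: P_def is_partition_def obeys_filter_iff m admissible_def)
    then show "M \<in> mset ` P" using m by blast
  qed
  show "finite {M \<in> admissible x y z w. sum_mset M = n}" unfolding img[symmetric] using fin by simp
  have inj: "inj_on mset P"
    by (rule inj_onI) (auto simp: P_def is_partition_def intro: decreasing_mset_unique)
  have "{(ps, I). is_overpartition n (ps, I) \<and> separated_by_parity ps \<and> parts_larger z x ps
      \<and> obeys y (filter (has_parity x) ps) \<and> obeys w (filter (has_parity z) ps)}
      = Sigma P (\<lambda>ps. Pow (first_instances ps))"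
    by (auto simp: P_def is_overpartition_def)
  moreover have "finite (first_instances ps)" for ps by (simp add: first_instances_def)
  ultimately have "pbar x y z w n = (\<Sum>ps\<in>P. 2 ^ card (set ps))"
    using fin by (simp add: pbar_def card_Pow card_first_instances)
  also have "\<dots> = (\<Sum>M\<in>mset ` P. 2 ^ card (set_mset M))"
    by (simp add: sum.reindex[OF inj])
  finally show "pbar x y z w n = (\<Sum>M\<in>{M \<in> admissible x y z w. sum_mset M = n}. 2 ^ card (set_mset M))"
    by (simp only: img)
qed

lemma Fbar_eq_has_sum:
  assumes xz: "x \<noteq> z" and F: "(overpartition_weight q has_sum F) (admissible x y z w)"
  shows "Fbar x y z w q = F"
proof -
  let ?A = "\<lambda>n. {M \<in> admissible x y z w. sum_mset M = n}"
  have "bij_betw snd (Sigma UNIV ?A) (admissible x y z w)"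
    by (rule bij_betwI[where g = "\<lambda>M. (sum_mset M, M)"]) auto
  then have "((\<lambda>p. overpartition_weight q (snd p)) has_sum F) (Sigma UNIV ?A)"
    using F by (simp add: has_sum_reindex_bij_betw[where f = "overpartition_weight q"])
  moreover have "((\<lambda>M. overpartition_weight q (snd (n, M))) has_sum (of_nat (pbar x y z w n) * q ^ n)) (?A n)" for n
    using pbar_eq_sum[OF xz, where y = y and w = w and n = n]
    by (intro has_sum_finiteI) (simp_all add: overpartition_weight_def sum_distrib_right)
  ultimately have "((\<lambda>n. of_nat (pbar x y z w n) * q ^ n) has_sum F) UNIV"
    by (rule has_sum_SigmaD)
  then show ?thesis unfolding Fbar_def using has_sum_imp_sums sums_unique by fastforce
qed

text \<open>The multiplicities allowed for part size \<open>k\<close> when \<open>m\<close> is the largest part of parity \<open>x\<close>; the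
  value \<open>m = 0\<close> stands for the absence of such parts.\<close>

definition multiplicities_with_largest ::
  "part_parity \<Rightarrow> part_restriction \<Rightarrow> part_restriction \<Rightarrow> nat \<Rightarrow> nat \<Rightarrow> nat set" where
  "multiplicities_with_largest x y w m k =
     (if k = 0 then {0}
      else if has_parity x k
        then if k < m then allowed_multiplicities y
             else if k = m then allowed_multiplicities y - {0} else {0}
      else if m < k then allowed_multiplicities w else {0})"

lemma zero_allowed [simp]: "0 \<in> allowed_multiplicities y"
  by (cases y) auto

text \<open>Given the largest part \<open>m\<close> of parity \<open>x\<close>, the comparison between the two parities reduces to
  \<open>m < k\<close> for every part \<open>k\<close> of the other parity, which is a condition on single part sizes.
  So the admissible multisets split into classes to which the Euler product applies.\<close>

lemma admissible_by_largest_lower_part: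
  assumes xz: "x \<noteq> z"
  shows "bij_betw snd (Sigma {m. m = 0 \<or> has_parity x m} (\<lambda>m. with_multiplicities (multiplicities_with_largest x y w m)))
    (admissible x y z w)"
proof -
  have zx: "has_parity z k \<longleftrightarrow> \<not> has_parity x k" for k
    using xz by (cases x; cases z) auto
  define top where "top = (\<lambda>M. Max (insert 0 {k. k \<in># M \<and> has_parity x k}))"
  have 1: "M \<in> admissible x y z w \<and> top M = m"
    if m: "m = 0 \<or> has_parity x m" and M: "M \<in> with_multiplicities (multiplicities_with_largest x y w m)" for m M
  proof -
    have c: "count M k \<in> multiplicities_with_largest x y w m k" for k
      using M by (simp add: with_multiplicities_def)
    have sub: "multiplicities_with_largest x y w m k \<subseteq> (if has_parity x k then allowed_multiplicities y else allowed_multiplicities w)" for k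
      by (auto simp: multiplicities_with_largest_def)
    have nz: "0 \<notin># M" using c[of 0] by (simp add: multiplicities_with_largest_def not_in_iff)
    have low: "k \<le> m" if "k \<in># M" "has_parity x k" for k
    proof (rule ccontr)
      assume "\<not> k \<le> m"
      then have "count M k = 0" using c[of k] that(2) by (simp add: multiplicities_with_largest_def split: if_splits)
      with that(1) show False by (metis not_in_iff)
    qed
    have high: "m < k" if "k \<in># M" "\<not> has_parity x k" for k
    proof (rule ccontr)
      assume "\<not> m < k"
      then have "count M k = 0" using c[of k] that(2) by (simp add: multiplicities_with_largest_def split: if_splits)
      with that(1) show False by (metis not_in_iff)
    qed
    have "m \<in># M" if "m \<noteq> 0"
      using c[of m] m that by (simp add: multiplicities_with_largest_def)
    then have "top M = m" unfolding top_def
      using m low by (intro Max_eqI) (auto intro!: finite_subset[OF _ finite_set_mset[of M]])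
    moreover have "M \<in> admissible x y z w"
      unfolding admissible_def zx
    proof (intro CollectI conjI ballI allI impI nz)
      show "b < a" if "a \<in># M" "b \<in># M" "\<not> has_parity x a" "has_parity x b" for a b
        using low[of b] high[of a] that by simp
      show "count M k \<in> allowed_multiplicities y" if "has_parity x k" for k
        using subsetD[OF sub c, of k] that by simp
      show "count M k \<in> allowed_multiplicities w" if "\<not> has_parity x k" for k
        using subsetD[OF sub c, of k] that by simp
    qed
    ultimately show ?thesis by blast
  qed
  have 2: "(top M = 0 \<or> has_parity x (top M)) \<and> M \<in> with_multiplicities (multiplicities_with_largest x y w (top M))"
    if M: "M \<in> admissible x y z w" for M
  proof -
    have nz: "0 \<notin># M" and sep: "\<And>a b. a \<in># M \<Longrightarrow> b \<in># M \<Longrightarrow> \<not> has_parity x a \<Longrightarrow> has_parity x b \<Longrightarrow> b < a"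
      and cx: "\<And>k. has_parity x k \<Longrightarrow> count M k \<in> allowed_multiplicities y"
      and cz: "\<And>k. \<not> has_parity x k \<Longrightarrow> count M k \<in> allowed_multiplicities w"
      using M by (auto simp: admissible_def zx)
    have fin: "finite (insert 0 {k. k \<in># M \<and> has_parity x k})"
      by (auto intro!: finite_subset[OF _ finite_set_mset[of M]])
    have top: "top M = 0 \<or> (top M \<in># M \<and> has_parity x (top M))"
      unfolding top_def using Max_in[OF fin] by auto
    have le: "k \<le> top M" if "k \<in># M" "has_parity x k" for k
      unfolding top_def using that fin by (intro Max_ge) auto
    have "count M k \<in> multiplicities_with_largest x y w (top M) k" for k
    proof (cases "k \<in># M")
      case False
      then have "count M k = 0" by (simp add: not_in_iff)
      moreover have "k = top M \<longrightarrow> k = 0" using top False by auto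
      ultimately show ?thesis by (auto simp: multiplicities_with_largest_def)
    next
      case True
      then have "k \<noteq> 0" using nz by metis
      show ?thesis
      proof (cases "has_parity x k")
        case par: True
        then show ?thesis using le[OF True par] cx[OF par] True \<open>k \<noteq> 0\<close>
          by (auto simp: multiplicities_with_largest_def)
      next
        case par: False
        have "top M < k" using top sep[OF True _ par] \<open>k \<noteq> 0\<close> by auto
        then show ?thesis using cz[OF par] par \<open>k \<noteq> 0\<close> by (simp add: multiplicities_with_largest_def)
      qed
    qed
    then show ?thesis using top by (auto simp: with_multiplicities_def)
  qed
  show ?thesis
  proof (rule bij_betwI[where g = "\<lambda>M. (top M, M)"])
    show "snd \<in> Sigma {m. m = 0 \<or> has_parity x m} (\<lambda>m. with_multiplicities (multiplicities_with_largest x y w m)) \<rightarrow> admissible x y z w"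
      using conjunct1[OF 1] by (intro funcsetI) (elim SigmaE, simp)
    show "(\<lambda>M. (top M, M)) \<in> admissible x y z w \<rightarrow> Sigma {m. m = 0 \<or> has_parity x m} (\<lambda>m. with_multiplicities (multiplicities_with_largest x y w m))"
      using 2 by simp
    show "(\<lambda>M. (top M, M)) (snd p) = p"
      if "p \<in> Sigma {m. m = 0 \<or> has_parity x m} (\<lambda>m. with_multiplicities (multiplicities_with_largest x y w m))" for p
      using conjunct2[OF 1] that by (elim SigmaE) simp
  qed simp
qed

section \<open>Summation over the largest lower part\<close>

text \<open>With these coefficients both kinds of parts have the generating function
  \<open>(1 + a * q ^ k) / (1 - b * q ^ k)\<close>, and \<open>a + b = 2\<close> in both cases.\<close>

fun numerator_coeff denominator_coeff :: "part_restriction \<Rightarrow> complex" where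
  "numerator_coeff Unrestricted = 1"
| "numerator_coeff Distinct = 2"
| "denominator_coeff Unrestricted = 1"
| "denominator_coeff Distinct = 0"

fun least_part :: "part_parity \<Rightarrow> nat" where
  "least_part Odd = 1"
| "least_part Even = 2"

lemma part_gf_allowed:
  assumes "norm q < 1" "k > 0"
  shows "part_gf q k (allowed_multiplicities y) = (1 + numerator_coeff y * q ^ k) / (1 - denominator_coeff y * q ^ k)"
proof (cases y)
  case Distinct
  then show ?thesis by (simp add: part_gf_def)
qed (simp add: part_gf_UNIV[OF assms])

lemma denominator_nonzero:
  assumes "norm q < 1" "k > 0"
  shows "1 - denominator_coeff y * q ^ k \<noteq> 0"
  using one_minus_power_nonzero(1)[OF assms] by (cases y) auto

lemma part_gf_allowed_positive:
  assumes "norm q < 1" "k > 0"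
  shows "part_gf q k (allowed_multiplicities y - {0}) = 2 * q ^ k / (1 - denominator_coeff y * q ^ k)"
proof -
  have "part_gf q k (allowed_multiplicities y) = part_gf q k (insert 0 (allowed_multiplicities y - {0}))"
    by (simp add: insert_absorb)
  also have "\<dots> = 1 + part_gf q k (allowed_multiplicities y - {0})"
    unfolding part_gf_def by (subst infsum_insert) (auto intro: part_gf_summable assms)
  finally have "part_gf q k (allowed_multiplicities y - {0})
      = (1 + numerator_coeff y * q ^ k) / (1 - denominator_coeff y * q ^ k) - 1"
    by (simp add: part_gf_allowed[OF assms])
  also have "\<dots> = 2 * q ^ k / (1 - denominator_coeff y * q ^ k)"
    using denominator_nonzero[OF assms, of y] by (cases y) (simp_all add: field_simps)
  finally show ?thesis .
qed

lemma part_gf_none: "part_gf q k {0} = 1"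
  by (simp add: part_gf_def)

lemma prod_by_parity:
  fixes g :: "nat \<Rightarrow> complex"
  shows "(\<Prod>k=1..2*N. g k) = (\<Prod>j<N. g (2 * j + least_part x)) * (\<Prod>j<N. g (2 * j + (3 - least_part x)))"
proof -
  have "(\<Prod>k=1..2*N. g k) = (\<Prod>j<N. g (2 * j + 1)) * (\<Prod>j<N. g (2 * j + 2))"
    by (induction N) (simp_all add: mult_ac)
  then show ?thesis by (cases x) (simp_all add: mult.commute)
qed

lemma prod_part_gf_progression:
  assumes q: "norm q < 1" and s: "s > 0"
  shows "(\<Prod>j<N. part_gf q (2 * j + s) (allowed_multiplicities y))
    = qpoch (- (numerator_coeff y * q ^ s)) (q\<^sup>2) N / qpoch (denominator_coeff y * q ^ s) (q\<^sup>2) N"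
  unfolding qpoch_def prod_dividef[symmetric]
  using s by (intro prod.cong) (simp_all add: part_gf_allowed[OF q] power_add mult_ac flip: power_mult)

text \<open>The generating function of the parts \<open>s, s + 2, s + 4, \<dots>\<close> under the restriction \<open>w\<close>.\<close>

definition upper_gf :: "part_restriction \<Rightarrow> complex \<Rightarrow> nat \<Rightarrow> complex" where
  "upper_gf w q s = qpoch_inf (- (numerator_coeff w * q ^ s)) (q\<^sup>2) / qpoch_inf (denominator_coeff w * q ^ s) (q\<^sup>2)"

lemma upper_gf_LIMSEQ:
  assumes q: "norm q < 1" and s: "s > 0"
  shows "(\<lambda>N. \<Prod>j<N. part_gf q (2 * j + s) (allowed_multiplicities w)) \<longlonglongrightarrow> upper_gf w q s"
proof -
  have q2: "norm (q\<^sup>2) < 1" using q by (simp add: norm_power power_less_one_iff)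
  have "denominator_coeff w * q ^ s * (q\<^sup>2) ^ k \<noteq> 1" for k
    using denominator_nonzero[OF q, of "s + 2 * k" w] s by (simp add: power_add power_mult mult.assoc)
  then show ?thesis
    unfolding prod_part_gf_progression[OF assms] upper_gf_def
    by (intro tendsto_divide qpoch_LIMSEQ q2 qpoch_inf_nonzero)
qed

lemma has_parity_progression:
  shows "has_parity x (2 * j + least_part x)" "\<not> has_parity x (2 * j + (3 - least_part x))"
    "has_parity x m \<Longrightarrow> m > 0 \<Longrightarrow> \<exists>n. m = 2 * n + least_part x"
proof -
  show "has_parity x (2 * j + least_part x)" "\<not> has_parity x (2 * j + (3 - least_part x))"
    by (cases x; simp)+
  assume m: "has_parity x m" "m > 0"
  show "\<exists>n. m = 2 * n + least_part x"
  proof (cases x)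
    case Even
    then obtain l where l: "m = 2 * l" using m by (auto elim: evenE)
    then show ?thesis using m Even by (intro exI[of _ "l - 1"]) auto
  next
    case Odd
    then show ?thesis using m by (auto elim: oddE)
  qed
qed

lemma least_part_cases: "least_part x = 1 \<or> least_part x = 2"
  by (cases x) auto

lemma overpartition_weight_no_lower_part:
  assumes q: "norm q < 1"
  shows "(overpartition_weight q has_sum upper_gf w q (3 - least_part x)) (with_multiplicities (multiplicities_with_largest x y w 0))"
proof (rule overpartition_weight_with_multiplicities[OF q, where K = 0])
  let ?f = "multiplicities_with_largest x y w 0"
  let ?e = "least_part x"
  have "(\<Prod>k=1..2*N. part_gf q k (?f k)) = (\<Prod>j<N. part_gf q (2 * j + (3 - ?e)) (allowed_multiplicities w))" for N
  proof -
    have "(\<Prod>j<N. part_gf q (2 * j + ?e) (?f (2 * j + ?e))) = 1"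
      using has_parity_progression(1) least_part_cases[of x]
      by (intro prod.neutral) (auto simp: multiplicities_with_largest_def part_gf_none)
    moreover have "?f (2 * j + (3 - ?e)) = allowed_multiplicities w" for j
      using has_parity_progression(2)[of x j] least_part_cases[of x]
      by (auto simp: multiplicities_with_largest_def)
    ultimately show ?thesis unfolding prod_by_parity[where x = x] by simp
  qed
  then show "(\<lambda>N. \<Prod>k=1..2*N. part_gf q k (?f k)) \<longlonglongrightarrow> upper_gf w q (3 - ?e)"
    using upper_gf_LIMSEQ[OF q, of "3 - ?e" w] least_part_cases[of x] by auto
qed (auto simp: multiplicities_with_largest_def)

text \<open>The Euler product, cut off at \<open>2 * N\<close>, factors by parity. Lower part sizes beyond the largest
  one and upper part sizes below it contribute 1.\<close>

lemma overpartition_weight_largest_lower_part: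
  fixes x :: part_parity
  assumes q: "norm q < 1"
  defines "e \<equiv> least_part x"
  shows "(overpartition_weight q has_sum
      (2 * q ^ (2 * n + e) * qpoch (- (numerator_coeff y * q ^ e)) (q\<^sup>2) n
         / qpoch (denominator_coeff y * q ^ e) (q\<^sup>2) (Suc n) * upper_gf w q (2 * n + e + 1)))
    (with_multiplicities (multiplicities_with_largest x y w (2 * n + e)))"
proof (rule overpartition_weight_with_multiplicities[OF q, where K = "2 * n + e"])
  let ?f = "multiplicities_with_largest x y w (2 * n + e)"
  let ?A = "qpoch (- (numerator_coeff y * q ^ e)) (q\<^sup>2) n"
  let ?B = "qpoch (denominator_coeff y * q ^ e) (q\<^sup>2)"
  have e: "e = 1 \<or> e = 2" unfolding e_def by (rule least_part_cases)
  \<comment> \<open>the number of part sizes of the upper parity below \<open>2 * n + e\<close>\<close>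
  define n' where "n' = n + e - 1"
  have lower: "(\<Prod>j<N. part_gf q (2 * j + e) (?f (2 * j + e))) = 2 * q ^ (2 * n + e) * ?A / ?B (Suc n)"
    if N: "N > n" for N
  proof -
    obtain l where l: "N = Suc n + l" using N by (metis less_iff_Suc_add add_Suc)
    have fj: "?f (2 * j + e) = (if j < n then allowed_multiplicities y
        else if j = n then allowed_multiplicities y - {0} else {0})" for j
      using has_parity_progression(1)[of x j] e by (auto simp: multiplicities_with_largest_def e_def)
    have "(\<Prod>j<Suc n + l. part_gf q (2 * j + e) (?f (2 * j + e)))
        = (\<Prod>j<Suc n. part_gf q (2 * j + e) (?f (2 * j + e)))"
      by (induction l) (simp_all add: fj part_gf_none)
    also have "\<dots> = (\<Prod>j<n. part_gf q (2 * j + e) (allowed_multiplicities y))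
        * part_gf q (2 * n + e) (allowed_multiplicities y - {0})"
      by (simp add: fj)
    also have "\<dots> = ?A / ?B n * (2 * q ^ (2 * n + e) / (1 - denominator_coeff y * q ^ (2 * n + e)))"
      using e by (subst prod_part_gf_progression[OF q]) (auto simp: part_gf_allowed_positive[OF q])
    also have "\<dots> = 2 * q ^ (2 * n + e) * ?A / ?B (Suc n)"
      by (simp add: qpoch_Suc power_add mult_ac flip: power_mult)
    finally show ?thesis by (simp add: l)
  qed
  have upper: "(\<Prod>j<N. part_gf q (2 * j + (3 - e)) (?f (2 * j + (3 - e))))
      = (\<Prod>j<N - n'. part_gf q (2 * j + (2 * n + e + 1)) (allowed_multiplicities w))"
    if N: "N \<ge> n'" for N
  proof -
    obtain l where l: "N = n' + l" using N by (metis le_Suc_ex)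
    have fj: "?f (2 * j + (3 - e)) = (if n' \<le> j then allowed_multiplicities w else {0})" for j
      using has_parity_progression(2)[of x j] e by (auto simp: multiplicities_with_largest_def e_def n'_def)
    have "(\<Prod>j<n' + l. part_gf q (2 * j + (3 - e)) (?f (2 * j + (3 - e))))
        = (\<Prod>j<l. part_gf q (2 * (n' + j) + (3 - e)) (allowed_multiplicities w))"
    proof (induction l)
      case 0
      show ?case by (simp add: fj part_gf_none)
    qed (simp add: fj)
    also have "\<dots> = (\<Prod>j<l. part_gf q (2 * j + (2 * n + e + 1)) (allowed_multiplicities w))"
    proof (rule prod.cong[OF refl])
      fix j
      have "2 * (n' + j) + (3 - e) = 2 * j + (2 * n + e + 1)" using e by (auto simp: n'_def)
      then show "part_gf q (2 * (n' + j) + (3 - e)) (allowed_multiplicities w)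
          = part_gf q (2 * j + (2 * n + e + 1)) (allowed_multiplicities w)" by (simp only:)
    qed
    finally show ?thesis by (simp add: l)
  qed
  have "(\<lambda>N. 2 * q ^ (2 * n + e) * ?A / ?B (Suc n)
      * (\<Prod>j<N - n'. part_gf q (2 * j + (2 * n + e + 1)) (allowed_multiplicities w)))
    \<longlonglongrightarrow> 2 * q ^ (2 * n + e) * ?A / ?B (Suc n) * upper_gf w q (2 * n + e + 1)"
    by (intro tendsto_mult_left seq_offset_neg[OF upper_gf_LIMSEQ[OF q]]) simp
  then show "(\<lambda>N. \<Prod>k=1..2*N. part_gf q k (?f k))
      \<longlonglongrightarrow> 2 * q ^ (2 * n + e) * ?A / ?B (Suc n) * upper_gf w q (2 * n + e + 1)"
  proof (rule Lim_transform_eventually)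
    show "eventually (\<lambda>N. 2 * q ^ (2 * n + e) * ?A / ?B (Suc n)
        * (\<Prod>j<N - n'. part_gf q (2 * j + (2 * n + e + 1)) (allowed_multiplicities w))
        = (\<Prod>k=1..2*N. part_gf q k (?f k))) sequentially"
      using eventually_ge_at_top[of "Suc n + n'"]
    proof eventually_elim
      case (elim N)
      then show ?case
        using lower[of N] upper[of N] unfolding prod_by_parity[where x = x] e_def[symmetric] by simp
    qed
  qed
qed (auto simp: multiplicities_with_largest_def)

text \<open>The common source of all eight identities: the \<open>n\<close>-th term collects the overpartitions whose
  largest part of parity \<open>x\<close> is \<open>2 * n + e\<close>, and the subtracted term those without parts of
  parity \<open>x\<close>.\<close>

theorem Fbar_by_largest_lower_part:
  assumes q: "norm q < 1" and xz: "x \<noteq> z"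
  defines "e \<equiv> least_part x"
  shows "(\<lambda>n. 2 * q ^ (2 * n + e) * qpoch (- (numerator_coeff y * q ^ e)) (q\<^sup>2) n
         / qpoch (denominator_coeff y * q ^ e) (q\<^sup>2) (Suc n) * upper_gf w q (2 * n + e + 1))
    sums (Fbar x y z w q - upper_gf w q (3 - e))"
proof -
  define L where "L = (\<lambda>m. infsum (overpartition_weight q) (with_multiplicities (multiplicities_with_largest x y w m)))"
  define I where "I = {m. m = 0 \<or> has_parity x m}"
  define B where "B = (\<lambda>m. with_multiplicities (multiplicities_with_largest x y w m))"
  note summable = overpartition_weight_summable[OF q]
  have adm: "admissible x y z w \<subseteq> {M. 0 \<notin># M}" by (auto simp: admissible_def)
  have "(overpartition_weight q has_sum infsum (overpartition_weight q) (admissible x y z w)) (admissible x y z w)"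
    by (intro has_sum_infsum summable_on_subset_banach[OF summable adm])
  with Fbar_eq_has_sum[OF xz] have F: "(overpartition_weight q has_sum Fbar x y z w q) (admissible x y z w)"
    by metis
  have bij: "bij_betw snd (Sigma I B) (admissible x y z w)"
    unfolding I_def B_def by (rule admissible_by_largest_lower_part[OF xz])
  have "((\<lambda>p. overpartition_weight q (snd p)) has_sum Fbar x y z w q) (Sigma I B)"
    using F by (simp only: has_sum_reindex_bij_betw[OF bij, of "overpartition_weight q"])
  moreover have "((\<lambda>M. overpartition_weight q (snd (m, M))) has_sum L m) (B m)" if "m \<in> I" for m
  proof -
    have "B m \<subseteq> admissible x y z w"
      using bij_betw_imp_surj_on[OF bij] that by force
    then have "overpartition_weight q summable_on B m"
      by (intro summable_on_subset_banach[OF summable]) (use adm in auto)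
    then show ?thesis by (simp add: L_def B_def)
  qed
  ultimately have hs: "(L has_sum Fbar x y z w q) I" by (rule has_sum_SigmaD)
  have e: "e = 1 \<or> e = 2" unfolding e_def by (rule least_part_cases)
  define R where "R = range (\<lambda>n. 2 * n + e)"
  have I: "I = insert 0 R"
    using has_parity_progression(1,3) by (fastforce simp: I_def R_def e_def)
  have nR: "0 \<notin> R" using e by (auto simp: R_def)
  have "L summable_on R"
    using has_sum_imp_summable[OF hs] unfolding I by (rule summable_on_subset_banach) auto
  then have R: "(L has_sum infsum L R) R" by simp
  have "(L has_sum (L 0 + infsum L R)) I" unfolding I by (rule has_sum_insert[OF nR R])
  then have "Fbar x y z w q = L 0 + infsum L R" using hs has_sum_unique by blast
  moreover have "L 0 = upper_gf w q (3 - e)"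
    unfolding L_def e_def by (rule infsumI[OF overpartition_weight_no_lower_part[OF q]])
  ultimately have "(L has_sum (Fbar x y z w q - upper_gf w q (3 - e))) R" using R by simp
  moreover have "inj (\<lambda>n. 2 * n + e)" by (rule injI) simp
  ultimately have "((\<lambda>n. L (2 * n + e)) has_sum (Fbar x y z w q - upper_gf w q (3 - e))) UNIV"
    unfolding R_def by (simp add: has_sum_reindex o_def)
  then have "(\<lambda>n. L (2 * n + e)) sums (Fbar x y z w q - upper_gf w q (3 - e))"
    by (rule has_sum_imp_sums)
  moreover have "L (2 * n + e) = 2 * q ^ (2 * n + e) * qpoch (- (numerator_coeff y * q ^ e)) (q\<^sup>2) n
         / qpoch (denominator_coeff y * q ^ e) (q\<^sup>2) (Suc n) * upper_gf w q (2 * n + e + 1)" for n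
    unfolding L_def e_def by (rule infsumI[OF overpartition_weight_largest_lower_part[OF q]])
  ultimately show ?thesis by simp
qed

section \<open>A Heine transformation\<close>

text \<open>Write \<open>H x\<close> for the Heine series \<open>\<Sum>n. s n * Z (x * p ^ n)\<close>. The recurrence
  \<open>(1 - b * x) * H x + (1 - a * x) * H (x * p) = 2 * (- p)_\<infinity> / (p)_\<infinity>\<close> holds because the combined
  summand is the difference of consecutive values of \<open>(- 1)_n / (p)_(n-1) * Z (x * p ^ n)\<close>.\<close>

lemma heine_telescope:
  fixes a b x p :: complex
  assumes p: "norm p < 1" and bx: "norm (b * x) < 1"
  defines "s \<equiv> \<lambda>n. p ^ n * qpoch (- 1) p n / qpoch p p n"
  defines "Z \<equiv> \<lambda>y. qpoch_inf (- a * y) p / qpoch_inf (b * y) p"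
  shows "(\<lambda>n. s n * (Z (x * p ^ n) * (1 - b * x) + Z (x * p ^ Suc n) * (1 - a * x)))
           sums (2 * (qpoch_inf (- p) p / qpoch_inf p p))"
proof -
  \<comment> \<open>formally \<open>(- 1)_n / (p)_(n-1)\<close>, with the value 0 at \<open>n = 0\<close> so that no boundary term arises\<close>
  define w where "w = (\<lambda>n. case n of 0 \<Rightarrow> 0 | Suc m \<Rightarrow> qpoch (- 1) p n / qpoch p p m)"
  have w_Suc: "w (Suc n) = qpoch (- 1) p (Suc n) / qpoch p p n" for n by (simp add: w_def)
  have "(\<lambda>n. w (Suc n)) \<longlonglongrightarrow> qpoch_inf (- 1) p / qpoch_inf p p"
    unfolding w_Suc using qpoch_self_nonzero[OF p]
    by (intro tendsto_divide LIMSEQ_Suc qpoch_LIMSEQ p) auto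
  also have "qpoch_inf (- 1) p = 2 * qpoch_inf (- p) p"
    using qpoch_inf_Suc[OF p, of "- 1"] by simp
  finally have w_lim: "w \<longlonglongrightarrow> 2 * (qpoch_inf (- p) p / qpoch_inf p p)"
    by (simp add: filterlim_sequentially_Suc)
  have Z_lim: "(\<lambda>n. Z (x * p ^ n)) \<longlonglongrightarrow> 1 / 1"
    unfolding Z_def mult.assoc[symmetric] by (intro tendsto_divide qpoch_inf_tail_LIMSEQ p) auto
  have "(\<lambda>n. w n * Z (x * p ^ n)) \<longlonglongrightarrow> 2 * (qpoch_inf (- p) p / qpoch_inf p p) * 1"
    using tendsto_mult[OF w_lim Z_lim] by simp
  then have "(\<lambda>n. w (Suc n) * Z (x * p ^ Suc n) - w n * Z (x * p ^ n))
      sums (2 * (qpoch_inf (- p) p / qpoch_inf p p) * 1 - w 0 * Z (x * p ^ 0))"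
    by (rule telescope_sums)
  moreover have "w (Suc n) * Z (x * p ^ Suc n) - w n * Z (x * p ^ n)
      = s n * (Z (x * p ^ n) * (1 - b * x) + Z (x * p ^ Suc n) * (1 - a * x))" for n
  proof -
    define V where "V = qpoch_inf (- a * x * p ^ Suc n) p / qpoch_inf (b * x * p ^ n) p"
    have bn: "1 - b * x * p ^ n \<noteq> 0" using qpoch_nonzero_small[OF p bx, of n] by simp
    have Z1: "Z (x * p ^ n) = (1 + a * x * p ^ n) * V"
      using qpoch_inf_Suc[OF p, of "- a * x * p ^ n"] by (simp add: Z_def V_def mult_ac)
    have Z2: "Z (x * p ^ Suc n) = (1 - b * x * p ^ n) * V"
      using qpoch_inf_Suc[OF p, of "b * x * p ^ n"] bn by (simp add: Z_def V_def mult_ac)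
    have core: "w (Suc n) * (1 - b * x * p ^ n) - w n * (1 + a * x * p ^ n)
      = s n * ((1 + a * x * p ^ n) * (1 - b * x) + (1 - b * x * p ^ n) * (1 - a * x))"
    proof (cases n)
      case 0
      then show ?thesis by (simp add: w_def s_def qpoch_def algebra_simps)
    next
      case (Suc m)
      have nz: "1 - p ^ n \<noteq> 0" using one_minus_power_nonzero[OF p, of n] Suc by simp
      have nz': "qpoch p p m \<noteq> 0" by (rule qpoch_self_nonzero[OF p])
      have qn: "qpoch p p n = qpoch p p m * (1 - p ^ n)" by (simp add: Suc qpoch_Suc)
      define r where "r = w n / (1 - p ^ n)"
      have r1: "w n = r * (1 - p ^ n)" using nz by (simp add: r_def)
      have wn: "w n = qpoch (- 1) p n / qpoch p p m" by (simp add: w_def Suc)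
      have r2: "s n = r * p ^ n" by (simp add: s_def r_def wn qn)
      have r3: "w (Suc n) = r * (1 + p ^ n)"
        by (simp add: w_Suc r_def wn qn qpoch_Suc[of _ _ n])
      show ?thesis unfolding r1 r2 r3 by (simp add: algebra_simps power2_eq_square)
    qed
    have "w (Suc n) * Z (x * p ^ Suc n) - w n * Z (x * p ^ n)
       = (w (Suc n) * (1 - b * x * p ^ n) - w n * (1 + a * x * p ^ n)) * V"
      unfolding Z1 Z2 by (simp add: algebra_simps)
    then show ?thesis unfolding core Z1 Z2 by (simp add: algebra_simps)
  qed
  ultimately show ?thesis by (simp add: w_def)
qed

text \<open>Both sides satisfy the recurrence in \<open>x\<close> and \<open>x * p\<close> of the preceding lemma; for the power series
  on the right this is a comparison of coefficients. Their difference \<open>d\<close> satisfies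
  \<open>(1 - b * x) * d x = - (1 - a * x) * d (x * p)\<close>, so \<open>d x\<close> is a bounded multiple of
  \<open>d (x * p ^ N)\<close>, and this tends to \<open>d 0 = 0\<close>.\<close>

lemma heine_transformation:
  fixes a b x p :: complex
  assumes p: "norm p < 1" and bx: "norm (b * x) < 1"
  shows "(\<lambda>n. p ^ n * qpoch (- 1) p n / qpoch p p n
            * (qpoch_inf (- a * (x * p ^ n)) p / qpoch_inf (b * (x * p ^ n)) p))
         sums (qpoch_inf (- p) p / qpoch_inf p p
            * (\<Sum>n. x ^ n * (\<Prod>j<n. (b + a * p ^ j) / (1 + p ^ Suc j))))"
proof -
  define s where "s = (\<lambda>n. p ^ n * qpoch (- 1) p n / qpoch p p n)"
  define Z where "Z = (\<lambda>y. qpoch_inf (- a * y) p / qpoch_inf (b * y) p)"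
  define A where "A = qpoch_inf (- p) p / qpoch_inf p p"
  define k where "k = (\<lambda>n. \<Prod>j<n. (b + a * p ^ j) / (1 + p ^ Suc j))"
  define H where "H = (\<lambda>y. \<Sum>n. s n * Z (y * p ^ n))"
  define K where "K = (\<lambda>y. \<Sum>n. k n * y ^ n)"
  have shrink: "norm (b * (y * p ^ n)) < 1" if "norm (b * y) < 1" for y n
  proof -
    have "norm (b * y) * norm p ^ n \<le> norm (b * y) * 1"
      using p by (intro mult_left_mono power_le_one) auto
    then show ?thesis using that by (simp add: norm_mult norm_power mult.assoc)
  qed
  have Z_lim: "(\<lambda>n. Z (y * p ^ n)) \<longlonglongrightarrow> 1" for y
  proof -
    have "(\<lambda>n. Z (y * p ^ n)) \<longlonglongrightarrow> 1 / 1"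
      unfolding Z_def mult.assoc[symmetric] by (intro tendsto_divide qpoch_inf_tail_LIMSEQ p) auto
    then show ?thesis by simp
  qed
  have Z_bdd: "Bseq (\<lambda>n. Z (y * p ^ n))" for y
    using Z_lim convergentI convergent_imp_Bseq by blast
  define t where "t = (\<lambda>n. qpoch (- 1) p n / qpoch p p n)"
  have t_bdd: "Bseq t"
  proof -
    have "t \<longlonglongrightarrow> qpoch_inf (- 1) p / qpoch_inf p p"
      unfolding t_def using qpoch_self_nonzero[OF p] by (intro tendsto_divide qpoch_LIMSEQ p) auto
    then show ?thesis using convergentI convergent_imp_Bseq by blast
  qed
  have s_t: "s n = t n * p ^ n" for n by (simp add: s_def t_def)
  have s_summable: "summable (\<lambda>n. norm (s n))"
    unfolding s_t by (rule summable_bounded_geometric[OF t_bdd p])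
  have H_summable: "summable (\<lambda>n. s n * Z (y * p ^ n))" for y
  proof -
    obtain M where M: "M > 0" "\<And>n. norm (Z (y * p ^ n)) \<le> M" using Z_bdd by (auto simp: Bseq_def)
    show ?thesis
    proof (rule summable_comparison_test')
      show "summable (\<lambda>n. norm (s n) * M)" by (intro summable_mult2 s_summable)
      show "norm (s n * Z (y * p ^ n)) \<le> norm (s n) * M" if "n \<ge> 0" for n
        using M by (simp add: norm_mult mult_left_mono)
    qed
  qed
  have H_eq: "(1 - b * y) * H y + (1 - a * y) * H (y * p) = 2 * A" if "norm (b * y) < 1" for y
  proof -
    have e1: "(\<lambda>n. (1 - b * y) * (s n * Z (y * p ^ n)) + (1 - a * y) * (s n * Z (y * p * p ^ n)))
       sums ((1 - b * y) * H y + (1 - a * y) * H (y * p))"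
      unfolding H_def by (intro sums_add sums_mult summable_sums H_summable)
    have e2: "(\<lambda>n. s n * (Z (y * p ^ n) * (1 - b * y) + Z (y * p ^ Suc n) * (1 - a * y)))
        sums (2 * A)"
      unfolding s_def Z_def A_def by (rule heine_telescope[OF p that])
    have e3: "(\<lambda>n. (1 - b * y) * (s n * Z (y * p ^ n)) + (1 - a * y) * (s n * Z (y * p * p ^ n)))
      = (\<lambda>n. s n * (Z (y * p ^ n) * (1 - b * y) + Z (y * p ^ Suc n) * (1 - a * y)))"
    proof
      fix n
      have e0: "y * p * p ^ n = y * p ^ Suc n" by simp
      show "(1 - b * y) * (s n * Z (y * p ^ n)) + (1 - a * y) * (s n * Z (y * p * p ^ n))
        = s n * (Z (y * p ^ n) * (1 - b * y) + Z (y * p ^ Suc n) * (1 - a * y))"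
        unfolding e0 by (simp only: distrib_left mult_ac)
    qed
    show ?thesis by (rule sums_unique2[OF e1, unfolded e3, OF e2])
  qed
  have k_Suc: "k (Suc n) * (1 + p ^ Suc n) = k n * (b + a * p ^ n)" for n
    using one_minus_power_nonzero(3)[OF p, of "Suc n"] by (simp add: k_def)
  have K_summable: "summable (\<lambda>n. norm (k n * y ^ n))" if y: "norm (b * y) < 1" for y
  proof -
    have "(\<lambda>n. norm ((b + a * p ^ n) / (1 + p ^ Suc n) * y)) \<longlonglongrightarrow> norm ((b + a * 0) / (1 + 0) * y)"
      using p by (intro tendsto_intros LIMSEQ_power_zero LIMSEQ_Suc) auto
    then have lim: "(\<lambda>n. norm ((b + a * p ^ n) / (1 + p ^ Suc n) * y)) \<longlonglongrightarrow> norm (b * y)" by simp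
    obtain c where c: "norm (b * y) < c" "c < 1" using dense[OF y] by auto
    obtain N where N: "\<And>n. n \<ge> N \<Longrightarrow> norm ((b + a * p ^ n) / (1 + p ^ Suc n) * y) < c"
      using order_tendstoD(2)[OF lim c(1)] by (auto simp: eventually_sequentially)
    show ?thesis
    proof (rule summable_ratio_test[OF c(2)])
      fix n assume "n \<ge> N"
      have "k (Suc n) * y ^ Suc n = ((b + a * p ^ n) / (1 + p ^ Suc n) * y) * (k n * y ^ n)"
        by (simp add: k_def)
      then have "norm (k (Suc n) * y ^ Suc n)
          = norm ((b + a * p ^ n) / (1 + p ^ Suc n) * y) * norm (k n * y ^ n)"
        by (simp only: norm_mult)
      also have "\<dots> \<le> c * norm (k n * y ^ n)"
        using N[OF \<open>n \<ge> N\<close>] by (intro mult_right_mono) auto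
      finally show "norm (norm (k (Suc n) * y ^ Suc n)) \<le> c * norm (norm (k n * y ^ n))" by simp
    qed
  qed
  have K_eq: "(1 - b * y) * K y + (1 - a * y) * K (y * p) = 2" if y: "norm (b * y) < 1" for y
  proof -
    have s1: "summable (\<lambda>n. k n * y ^ n)" by (rule summable_norm_cancel[OF K_summable[OF y]])
    have s2: "summable (\<lambda>n. k n * (y * p) ^ n)"
      using shrink[OF y, of 1] by (intro summable_norm_cancel[OF K_summable]) simp
    have "(\<lambda>n. k n * y ^ n + k n * (y * p) ^ n) sums (K y + K (y * p))"
      unfolding K_def by (intro sums_add summable_sums s1 s2)
    then have 1: "(\<lambda>n. k (Suc n) * y ^ Suc n + k (Suc n) * (y * p) ^ Suc n) sums (K y + K (y * p) - 2)"
      by (subst sums_Suc_iff) (simp add: k_def)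
    have "(\<lambda>n. b * y * (k n * y ^ n) + a * y * (k n * (y * p) ^ n)) sums (b * y * K y + a * y * K (y * p))"
      unfolding K_def by (intro sums_add sums_mult summable_sums s1 s2)
    moreover have "b * y * (k n * y ^ n) + a * y * (k n * (y * p) ^ n)
        = k (Suc n) * y ^ Suc n + k (Suc n) * (y * p) ^ Suc n" for n
    proof -
      have "b * y * (k n * y ^ n) + a * y * (k n * (y * p) ^ n) = k n * (b + a * p ^ n) * y ^ Suc n"
        by (simp add: algebra_simps)
      also have "\<dots> = k (Suc n) * (1 + p ^ Suc n) * y ^ Suc n" by (simp only: k_Suc)
      finally show ?thesis by (simp only: algebra_simps power_mult_distrib mult_1_left)
    qed
    ultimately have "b * y * K y + a * y * K (y * p) = K y + K (y * p) - 2"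
      using 1 sums_unique2 by fastforce
    then show ?thesis by (simp add: algebra_simps)
  qed
  define d where "d = (\<lambda>y. H y - A * K y)"
  have d_eq: "(1 - b * y) * d y = - (1 - a * y) * d (y * p)" if "norm (b * y) < 1" for y
  proof -
    have "(1 - b * y) * H y + (1 - a * y) * H (y * p)
        = A * ((1 - b * y) * K y + (1 - a * y) * K (y * p))"
      using H_eq[OF that] K_eq[OF that] by simp
    then show ?thesis by (simp add: d_def algebra_simps)
  qed
  have d_iter: "qpoch (b * x) p N * d x = (- 1) ^ N * qpoch (a * x) p N * d (x * p ^ N)" for N
  proof (induction N)
    case (Suc N)
    have "qpoch (b * x) p (Suc N) * d x = (1 - b * (x * p ^ N)) * (qpoch (b * x) p N * d x)"
      by (simp add: qpoch_Suc mult_ac)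
    also have "\<dots> = (- 1) ^ N * qpoch (a * x) p N * ((1 - b * (x * p ^ N)) * d (x * p ^ N))"
      by (simp add: Suc)
    also have "\<dots> = (- 1) ^ N * qpoch (a * x) p N * (- (1 - a * (x * p ^ N)) * d (x * p ^ N * p))"
      by (simp only: d_eq[OF shrink[OF bx]])
    finally show ?case by (simp add: qpoch_Suc algebra_simps)
  qed auto
  have "H 0 = A" using H_eq[of 0] by simp
  have "(\<lambda>N. H (x * p ^ N)) \<longlonglongrightarrow> (\<Sum>n. s n * 1)"
  proof -
    obtain M where M: "M > 0" "\<And>n. norm (Z (x * p ^ n)) \<le> M" using Z_bdd by (auto simp: Bseq_def)
    show ?thesis unfolding H_def
    proof (rule tannery_sequence)
      show "summable (\<lambda>n. norm (s n) * M)" by (intro summable_mult2 s_summable)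
      show "norm (s n * Z (x * p ^ N * p ^ n)) \<le> norm (s n) * M" for n N
        using M(2)[of "N + n"] by (simp add: norm_mult mult_left_mono power_add mult.assoc)
      show "(\<lambda>N. s n * Z (x * p ^ N * p ^ n)) \<longlonglongrightarrow> s n * 1" for n
        using tendsto_mult_left[OF LIMSEQ_ignore_initial_segment[OF Z_lim[of x], of n], of "s n"]
        by (simp add: power_add mult.assoc)
    qed
  qed
  also have "(\<Sum>n. s n * 1) = H 0" using p by (simp add: H_def Z_def)
  finally have H_lim: "(\<lambda>N. H (x * p ^ N)) \<longlonglongrightarrow> A" using \<open>H 0 = A\<close> by simp
  have "(\<lambda>N. K (x * p ^ N)) \<longlonglongrightarrow> (\<Sum>n. if n = 0 then k 0 else 0)"
    unfolding K_def
  proof (rule tannery_sequence[OF _ _ K_summable[OF bx]])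
    fix n N
    have "norm (k n * x ^ n) * norm ((p ^ N) ^ n) \<le> norm (k n * x ^ n) * 1"
      using p by (intro mult_left_mono) (auto simp: norm_power power_le_one)
    then show "norm (k n * (x * p ^ N) ^ n) \<le> norm (k n * x ^ n)"
      by (simp add: norm_mult norm_power power_mult_distrib mult.assoc)
  next
    fix n
    show "(\<lambda>N. k n * (x * p ^ N) ^ n) \<longlonglongrightarrow> (if n = 0 then k 0 else 0)"
    proof (cases "n = 0")
      case False
      have "(\<lambda>N. k n * (x * p ^ N) ^ n) \<longlonglongrightarrow> k n * (x * 0) ^ n"
        using p by (intro tendsto_intros LIMSEQ_power_zero) auto
      with False show ?thesis by (simp add: zero_power)
    qed auto
  qed
  also have "(\<Sum>n. if n = 0 then k 0 else 0) = k 0"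
    using sums_single[of 0 "\<lambda>_. k 0"] by (simp add: sums_iff)
  also have "k 0 = 1" by (simp add: k_def)
  finally have K_lim: "(\<lambda>N. K (x * p ^ N)) \<longlonglongrightarrow> 1" .
  have "(\<lambda>N. d (x * p ^ N)) \<longlonglongrightarrow> A - A * 1"
    unfolding d_def by (intro tendsto_intros H_lim K_lim)
  then have d_lim: "(\<lambda>N. norm (d (x * p ^ N))) \<longlonglongrightarrow> 0" by (simp add: tendsto_norm_zero)
  have "(\<lambda>N. norm (qpoch (a * x) p N) * norm (d (x * p ^ N))) \<longlonglongrightarrow> norm (qpoch_inf (a * x) p) * 0"
    by (intro tendsto_intros qpoch_LIMSEQ p d_lim)
  moreover have "norm (qpoch (b * x) p N * d x) = norm (qpoch (a * x) p N) * norm (d (x * p ^ N))" for N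
    unfolding d_iter by (simp add: norm_mult norm_power)
  ultimately have "(\<lambda>N. norm (qpoch (b * x) p N * d x)) \<longlonglongrightarrow> 0" by simp
  moreover have "(\<lambda>N. norm (qpoch (b * x) p N * d x)) \<longlonglongrightarrow> norm (qpoch_inf (b * x) p * d x)"
    by (intro tendsto_intros qpoch_LIMSEQ p)
  ultimately have "norm (qpoch_inf (b * x) p * d x) = 0" using LIMSEQ_unique by blast
  moreover have "qpoch_inf (b * x) p \<noteq> 0"
    by (intro qpoch_inf_nonzero p qpoch_nonzero_small bx)
  ultimately have "d x = 0" by simp
  then have "H x = A * K x" by (simp add: d_def)
  with summable_sums[OF H_summable[of x]] have "(\<lambda>n. s n * Z (x * p ^ n)) sums (A * K x)"
    by (simp add: H_def)
  then show ?thesis by (simp add: s_def Z_def A_def K_def k_def mult.commute)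
qed

section \<open>A nonterminating three-term relation\<close>

text \<open>The recurrence of \<open>S = \<Sum>n. (a)_n (b)_n / (c)_n q^n\<close> under \<open>c \<mapsto> c / q\<close>, in the variable
  \<open>u = q / c\<close>. The summand on the left is the difference of consecutive values of
  \<open>(a)_n (b)_n / (q / u)_n * (u - q ^ n)\<close>.\<close>

lemma three_phi_two_step:
  fixes a b u q :: complex
  assumes q: "norm q < 1" and u0: "u \<noteq> 0" and un: "\<And>k. u \<noteq> q ^ k"
  defines "f \<equiv> \<lambda>v n. qpoch a q n * qpoch b q n / qpoch v q n * q ^ n"
  shows "(\<lambda>n. (1 - a * u) * (1 - b * u) * f (q / u) n + a * b * u * (1 - u) * f (1 / u) n)
     sums ((1 - u) + u * (qpoch_inf a q * qpoch_inf b q / qpoch_inf (q / u) q))"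
proof -
  have cn: "q / u * q ^ k \<noteq> 1" for k using un[of "Suc k"] u0 by (simp add: field_simps)
  have u1: "u \<noteq> 1" using un[of 0] by simp
  define t where "t = (\<lambda>n. qpoch a q n * qpoch b q n / qpoch (q / u) q n)"
  define W where "W = (\<lambda>n. t n * (u - q ^ n))"
  have "W \<longlonglongrightarrow> qpoch_inf a q * qpoch_inf b q / qpoch_inf (q / u) q * (u - 0)"
    unfolding W_def t_def
    by (intro tendsto_intros qpoch_LIMSEQ q LIMSEQ_power_zero qpoch_inf_nonzero cn)
  then have tel: "(\<lambda>n. W (Suc n) - W n)
      sums (qpoch_inf a q * qpoch_inf b q / qpoch_inf (q / u) q * (u - 0) - W 0)"
    by (rule telescope_sums)
  have eq: "W (Suc n) - W n = (1 - a * u) * (1 - b * u) * f (q / u) n + a * b * u * (1 - u) * f (1 / u) n" for n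
  proof -
    have nz: "1 - q / u * q ^ n \<noteq> 0" using cn[of n] by simp
    have ne: "u - q * q ^ n \<noteq> 0" using un[of "Suc n"] by simp
    have nzq: "qpoch (q / u) q n \<noteq> 0" by (intro qpoch_nonzero cn)
    have tS: "t (Suc n) * (u - q ^ Suc n) = t n * u * (1 - a * q ^ n) * (1 - b * q ^ n)"
      using nz nzq u0 ne by (simp add: t_def qpoch_Suc field_simps)
    have f1: "f (q / u) n = t n * q ^ n" by (simp add: f_def t_def)
    have "qpoch (1 / u) q n * (1 - 1 / u * q ^ n) = (1 - 1 / u) * qpoch (q / u) q n"
      using qpoch_Suc[of "1 / u" q n] qpoch_Suc_left[of "1 / u" q n] by simp
    then have r: "qpoch (1 / u) q n * (u - q ^ n) = (u - 1) * qpoch (q / u) q n"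
      using u0 by (simp add: field_simps)
    have "qpoch (1 / u) q n \<noteq> 0"
    proof (intro qpoch_nonzero)
      show "1 / u * q ^ k \<noteq> 1" for k using un[of k] u0 by (simp add: field_simps)
    qed
    with r have "(u - 1) / qpoch (1 / u) q n = (u - q ^ n) / qpoch (q / u) q n"
      using nzq by (simp add: frac_eq_eq mult.commute)
    then have f2: "f (1 / u) n * (u - 1) = t n * q ^ n * (u - q ^ n)"
    proof -
      have "f (1 / u) n * (u - 1) = qpoch a q n * qpoch b q n * q ^ n * ((u - 1) / qpoch (1 / u) q n)"
        by (simp add: f_def)
      also have "\<dots> = t n * q ^ n * (u - q ^ n)"
        unfolding \<open>(u - 1) / qpoch (1 / u) q n = _\<close> by (simp add: t_def)
      finally show ?thesis .
    qed
    have "a * b * u * (1 - u) * f (1 / u) n = - (a * b * u) * (f (1 / u) n * (u - 1))"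
      by (simp add: algebra_simps)
    then show ?thesis unfolding W_def tS f1 f2 by (simp add: algebra_simps)
  qed
  have val: "qpoch_inf a q * qpoch_inf b q / qpoch_inf (q / u) q * (u - 0) - W 0
      = (1 - u) + u * (qpoch_inf a q * qpoch_inf b q / qpoch_inf (q / u) q)"
    by (simp add: W_def t_def)
  show ?thesis using tel unfolding eq val .
qed

text \<open>The recurrence under \<open>u \<mapsto> u * q\<close> of the series that accounts for the infinite product in the
  inhomogeneous term of the recurrence above.\<close>

lemma partial_theta_step:
  fixes a b u q :: complex
  assumes q: "norm q < 1" and bu: "norm (b * u) < 1" and au: "\<And>k. a * u * q ^ k \<noteq> 1"
  defines "g \<equiv> \<lambda>v n. (b * v) ^ n / qpoch (a * v) q (Suc n)"
  assumes s: "summable (g u)" "summable (g (u * q))"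
  shows "(1 - a * u) * (1 - b * u) * suminf (g u) = 1 + a * b * u\<^sup>2 * q * suminf (g (u * q))"
proof -
  have a1: "1 - a * u \<noteq> 0" using au[of 0] by simp
  have g0: "g u 0 = 1 / (1 - a * u)" by (simp add: g_def qpoch_def)
  have step: "(1 - a * u) * g u (Suc n)
      = (1 - a * u) * (b * u) * g u n + a * b * u\<^sup>2 * q * g (u * q) n" for n
  proof -
    define h where "h = (b * u) ^ n / qpoch (a * u) q (Suc (Suc n))"
    have nz: "qpoch (a * u) q m \<noteq> 0" for m by (intro qpoch_nonzero au)
    have nz': "1 - a * u * (q * q ^ n) \<noteq> 0" using au[of "Suc n"] by simp
    have nz2: "qpoch (a * (u * q)) q (Suc n) \<noteq> 0"
      using nz[of "Suc (Suc n)"] qpoch_Suc_left[of "a * u" q "Suc n"] by (simp add: mult.assoc)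
    have e1: "g u (Suc n) = b * u * h" by (simp add: g_def h_def)
    have e2: "g u n = h * (1 - a * u * q ^ Suc n)"
      using nz' by (simp add: g_def h_def qpoch_Suc[of _ _ "Suc n"])
    have e3: "g (u * q) n = (1 - a * u) * q ^ n * h"
      using nz2 a1 qpoch_Suc_left[of "a * u" q "Suc n"]
      by (simp add: g_def h_def mult.assoc power_mult_distrib)
    show ?thesis unfolding e1 e2 e3 by (simp add: algebra_simps power2_eq_square)
  qed
  have "(\<lambda>n. (1 - a * u) * g u (Suc n)) sums ((1 - a * u) * (suminf (g u) - g u 0))"
    using summable_sums[OF s(1)] by (intro sums_mult) (simp add: sums_Suc_iff)
  moreover have "(\<lambda>n. (1 - a * u) * (b * u) * g u n + a * b * u\<^sup>2 * q * g (u * q) n)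
      sums ((1 - a * u) * (b * u) * suminf (g u) + a * b * u\<^sup>2 * q * suminf (g (u * q)))"
    by (intro sums_add sums_mult summable_sums s)
  ultimately have "(1 - a * u) * (suminf (g u) - g u 0)
      = (1 - a * u) * (b * u) * suminf (g u) + a * b * u\<^sup>2 * q * suminf (g (u * q))"
    unfolding step by (rule sums_unique2)
  then show ?thesis using a1 by (simp add: g0 algebra_simps)
qed

text \<open>As \<open>N\<close> grows, the factors \<open>1 - q ^ i / u\<close> with negative \<open>i\<close> become large, but
  the bound has to be uniform in \<open>N\<close> and \<open>n\<close>. Reflecting these factors, as
  \<open>1 - 1 / (u * q ^ i) = - (1 - u * q ^ i) / (u * q ^ i)\<close>, turns their product into a quotient of
  ordinary Pochhammer symbols of \<open>u\<close> over a product that is bounded above.\<close>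

lemma qpoch_backward_bounded_below:
  fixes u q :: complex
  assumes q: "norm q < 1" "q \<noteq> 0" and u0: "u \<noteq> 0" and un: "\<And>j k. u * q ^ j \<noteq> q ^ k"
  obtains d where "d > 0" "\<And>N n. d \<le> norm (qpoch (q / (u * q ^ N)) q n)"
proof -
  have "u * q ^ k \<noteq> 1" for k using un[of k 0] by simp
  then obtain d1 where d1: "d1 > 0" "\<And>n. d1 \<le> norm (qpoch u q n)"
    using qpoch_bounded_below[OF q(1)] by blast
  have "q / u * q ^ k \<noteq> 1" for k using un[of 0 "Suc k"] u0 by (auto simp: field_simps)
  then obtain d2 where d2: "d2 > 0" "\<And>n. d2 \<le> norm (qpoch (q / u) q n)"
    using qpoch_bounded_below[OF q(1)] by blast
  define E where "E = exp (norm u / (1 - norm q))"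
  have E: "E > 0" by (simp add: E_def)
  have reflect: "norm (qpoch (q / (u * q ^ N)) q n) * norm (qpoch u q (N - n))
      * (\<Prod>i\<in>{N - n..<N}. norm (u * q ^ i)) = norm (qpoch u q N)" if "n \<le> N" for N n
    using that
  proof (induction n)
    case (Suc n)
    define m where "m = N - Suc n"
    have m: "N - n = Suc m" "N = m + Suc n" using Suc.prems by (auto simp: m_def)
    have e: "q / (u * q ^ N) * q ^ n = 1 / (u * q ^ m)"
      using q by (simp add: m(2) power_add)
    have f: "norm (1 - 1 / (u * q ^ m)) * norm (u * q ^ m) = norm (1 - u * q ^ m)"
    proof -
      have "(1 - 1 / (u * q ^ m)) * (u * q ^ m) = - (1 - u * q ^ m)"
        using q u0 by (simp add: field_simps)
      then show ?thesis by (metis norm_mult norm_minus_cancel)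
    qed
    have p: "(\<Prod>i\<in>{m..<N}. norm (u * q ^ i)) = norm (u * q ^ m) * (\<Prod>i\<in>{Suc m..<N}. norm (u * q ^ i))"
      using m(2) by (intro prod.atLeast_Suc_lessThan) simp
    have "norm (qpoch (q / (u * q ^ N)) q (Suc n)) * norm (qpoch u q m) * (\<Prod>i\<in>{m..<N}. norm (u * q ^ i))
      = norm (qpoch (q / (u * q ^ N)) q n) * (norm (qpoch u q m)
         * (norm (1 - 1 / (u * q ^ m)) * norm (u * q ^ m))) * (\<Prod>i\<in>{Suc m..<N}. norm (u * q ^ i))"
      unfolding p qpoch_Suc e norm_mult[of "qpoch (q / (u * q ^ N)) q n"] by (simp only: mult_ac)
    also have "norm (qpoch u q m) * (norm (1 - 1 / (u * q ^ m)) * norm (u * q ^ m)) = norm (qpoch u q (Suc m))"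
      unfolding f by (simp add: qpoch_Suc norm_mult)
    also have "norm (qpoch (q / (u * q ^ N)) q n) * norm (qpoch u q (Suc m))
       * (\<Prod>i\<in>{Suc m..<N}. norm (u * q ^ i)) = norm (qpoch u q N)"
      using Suc by (simp add: m(1))
    finally show ?case by (simp add: m_def)
  qed simp
  have low: "d1 / (E * E) \<le> norm (qpoch (q / (u * q ^ N)) q n)" if "n \<le> N" for N n
  proof -
    have "(\<Prod>i\<in>{N - n..<N}. norm (u * q ^ i)) \<le> (\<Prod>i\<in>{N - n..<N}. 1 + norm u * norm q ^ i)"
      by (intro prod_mono) (auto simp: norm_mult norm_power)
    also have "\<dots> \<le> exp (\<Sum>i\<in>{N - n..<N}. norm u * norm q ^ i)"
      by (intro prod_le_exp_sum) auto
    also have "\<dots> \<le> E"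
    proof -
      have "(\<Sum>i\<in>{N - n..<N}. norm u * norm q ^ i) \<le> (\<Sum>i. norm u * norm q ^ i)"
        using q by (intro sum_le_suminf summable_mult summable_geometric) auto
      also have "\<dots> = norm u * (\<Sum>i. norm q ^ i)" using q by (intro suminf_mult summable_geometric) auto
      also have "\<dots> = norm u / (1 - norm q)" using q by (simp add: suminf_geometric)
      finally show ?thesis by (simp add: E_def)
    qed
    finally have 1: "(\<Prod>i\<in>{N - n..<N}. norm (u * q ^ i)) \<le> E" .
    have 2: "norm (qpoch u q (N - n)) \<le> E" unfolding E_def by (rule qpoch_norm_le[OF q(1)])
    have "d1 \<le> norm (qpoch u q N)" by (rule d1)
    also have "\<dots> = norm (qpoch (q / (u * q ^ N)) q n) * (norm (qpoch u q (N - n))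
      * (\<Prod>i\<in>{N - n..<N}. norm (u * q ^ i)))" using reflect[OF that] by (simp add: mult.assoc)
    also have "\<dots> \<le> norm (qpoch (q / (u * q ^ N)) q n) * (E * E)"
      using E by (intro mult_left_mono mult_mono 1 2) (auto intro: prod_nonneg)
    finally show ?thesis using E by (simp add: field_simps)
  qed
  show ?thesis
  proof
    show "min (d1 / (E * E)) (d1 / (E * E) * d2) > 0" using d1 d2 E by simp
    fix N n
    show "min (d1 / (E * E)) (d1 / (E * E) * d2) \<le> norm (qpoch (q / (u * q ^ N)) q n)"
    proof (cases "n \<le> N")
      case True
      then show ?thesis using low[of n N] by linarith
    next
      case False
      then have "n = N + (n - N)" by simp
      moreover have "q / (u * q ^ N) * q ^ N = q / u" using q by simp
      ultimately have "qpoch (q / (u * q ^ N)) q n = qpoch (q / (u * q ^ N)) q N * qpoch (q / u) q (n - N)"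
        using qpoch_add[of "q / (u * q ^ N)" q N "n - N"] by simp
      then have "norm (qpoch (q / (u * q ^ N)) q n)
          = norm (qpoch (q / (u * q ^ N)) q N) * norm (qpoch (q / u) q (n - N))" by (simp add: norm_mult)
      also have "\<dots> \<ge> d1 / (E * E) * d2"
        using low[of N N] d1 d2 E by (intro mult_mono) auto
      finally show ?thesis by linarith
    qed
  qed
qed

lemma theta_power_tendsto_zero:
  fixes x q :: complex
  assumes "norm q < 1"
  shows "(\<lambda>n. x ^ n * q ^ (n choose 2)) \<longlonglongrightarrow> 0"
proof (rule summable_LIMSEQ_zero)
  have "(\<lambda>n. norm (x * q ^ n)) \<longlonglongrightarrow> norm (x * 0)"
    using assms by (intro tendsto_intros LIMSEQ_power_zero) auto
  then have "eventually (\<lambda>n. norm (x * q ^ n) < 1 / 2) sequentially"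
    by (rule order_tendstoD) simp
  then obtain N where N: "\<And>n. n \<ge> N \<Longrightarrow> norm (x * q ^ n) < 1 / 2"
    by (auto simp: eventually_sequentially)
  show "summable (\<lambda>n. x ^ n * q ^ (n choose 2))"
  proof (rule summable_ratio_test)
    show "(1 / 2 :: real) < 1" by simp
    fix n assume "n \<ge> N"
    have "Suc n choose 2 = n + (n choose 2)" by (simp add: numeral_2_eq_2)
    then have "x ^ Suc n * q ^ (Suc n choose 2) = (x * q ^ n) * (x ^ n * q ^ (n choose 2))"
      by (simp add: power_add mult_ac)
    then have "norm (x ^ Suc n * q ^ (Suc n choose 2)) = norm (x * q ^ n) * norm (x ^ n * q ^ (n choose 2))"
      by (simp only: norm_mult)
    also have "\<dots> \<le> 1 / 2 * norm (x ^ n * q ^ (n choose 2))"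
      using N[OF \<open>n \<ge> N\<close>] by (intro mult_right_mono) auto
    finally show "norm (x ^ Suc n * q ^ (Suc n choose 2)) \<le> 1 / 2 * norm (x ^ n * q ^ (n choose 2))" .
  qed
qed

text \<open>Let \<open>D u\<close> be the right-hand side. The two recurrences combine to
  \<open>(1 - a * u) * (1 - b * u) * D u = (1 - u) * (1 - a * b * u * D (u * q))\<close>. Iterating it \<open>N\<close> times
  produces the first \<open>N\<close> terms of the series on the left, with a remainder that contains
  \<open>q ^ (N choose 2)\<close> and a bounded factor.\<close>

lemma three_phi_two_partial_theta:
  fixes a b u q :: complex
  assumes q: "norm q < 1" and q0: "q \<noteq> 0" and u0: "u \<noteq> 0" and un: "\<And>j k. u * q ^ j \<noteq> q ^ k"
    and bu: "norm (b * u) < 1" and au: "\<And>k. a * u * q ^ k \<noteq> 1"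
  shows "(\<lambda>n. (- a * b * u) ^ n * q ^ (n choose 2) * qpoch u q (Suc n)
            / (qpoch (a * u) q (Suc n) * qpoch (b * u) q (Suc n)))
     sums ((\<Sum>n. qpoch a q n * qpoch b q n / qpoch (q / u) q n * q ^ n)
        - u * (qpoch_inf a q * qpoch_inf b q / qpoch_inf (q / u) q)
          * (\<Sum>n. (b * u) ^ n / qpoch (a * u) q (Suc n)))"
proof -
  define f where "f = (\<lambda>v n. qpoch a q n * qpoch b q n / qpoch v q n * q ^ n)"
  define S where "S = (\<lambda>v. suminf (f (q / v)))"
  define g where "g = (\<lambda>v n. (b * v) ^ n / qpoch (a * v) q (Suc n))"
  define G where "G = (\<lambda>v. suminf (g v))"
  define P where "P = (\<lambda>v. v * (qpoch_inf a q * qpoch_inf b q / qpoch_inf (q / v) q))"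
  define D where "D = (\<lambda>v. S v - P v * G v)"
  \<comment> \<open>all bounds are uniform in the number \<open>N\<close> of iterations\<close>
  obtain d where d: "d > 0" "\<And>N n. d \<le> norm (qpoch (q / (u * q ^ N)) q n)"
    using qpoch_backward_bounded_below[OF q q0 u0 un] by blast
  obtain e where e: "e > 0" "\<And>n. e \<le> norm (qpoch (a * u) q n)"
    using qpoch_bounded_below[OF q au] by blast
  have bun: "b * u * q ^ k \<noteq> 1" for k by (rule qpoch_nonzero_small[OF q bu])
  obtain e' where e': "e' > 0" "\<And>n. e' \<le> norm (qpoch (b * u) q n)"
    using qpoch_bounded_below[OF q bun] by blast
  define X where "X = (\<lambda>x :: complex. exp (norm x / (1 - norm q)))"
  have X: "norm (qpoch x q n) \<le> X x" "X x > 0" "X x \<ge> 0" "norm (qpoch_inf x q) \<le> X x" for x n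
    using qpoch_norm_le[OF q] qpoch_inf_norm_le[OF q] by (auto simp: X_def)
  have f_le: "norm (f (q / (u * q ^ N)) n) \<le> X a * X b / d * norm q ^ n" for N n
    unfolding f_def norm_mult norm_divide norm_power
    using X d by (intro mult_right_mono frac_le mult_mono) auto
  have f_sum: "summable (\<lambda>n. X a * X b / d * norm q ^ n)"
    using q by (intro summable_mult summable_geometric) auto
  have f_summable: "summable (f (q / (u * q ^ N)))" for N
    by (rule summable_comparison_test'[OF f_sum]) (use f_le in auto)
  have g_le: "norm (g (u * q ^ N) n) \<le> X (a * u) / e * norm (b * u) ^ n" for N n
  proof -
    have "qpoch (a * u) q (N + Suc n) = qpoch (a * u) q N * qpoch (a * (u * q ^ N)) q (Suc n)"
      using qpoch_add[of "a * u" q N "Suc n"] by (simp add: mult.assoc)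
    moreover have "qpoch (a * u) q N \<noteq> 0" by (intro qpoch_nonzero au)
    ultimately have "g (u * q ^ N) n = (b * u) ^ n * (q ^ N) ^ n * (qpoch (a * u) q N / qpoch (a * u) q (N + Suc n))"
      by (simp add: g_def power_mult_distrib mult_ac)
    then have "norm (g (u * q ^ N) n) = norm (b * u) ^ n * (norm q ^ N) ^ n
        * (norm (qpoch (a * u) q N) / norm (qpoch (a * u) q (N + Suc n)))"
      by (simp only: norm_mult norm_divide norm_power)
    also have "\<dots> \<le> norm (b * u) ^ n * 1 * (X (a * u) / e)"
      using q X e by (intro mult_mono frac_le) (auto intro!: power_le_one)
    finally show ?thesis by (simp add: mult_ac)
  qed
  have g_sum: "summable (\<lambda>n. X (a * u) / e * norm (b * u) ^ n)"
    using bu by (intro summable_mult summable_geometric) auto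
  have g_summable: "summable (g (u * q ^ N))" for N
    by (rule summable_comparison_test'[OF g_sum]) (use g_le in auto)
  \<comment> \<open>the infinite products cancel, since \<open>P (v * q) * (v - 1) = P v * (q * v)\<close>\<close>
  have D_step: "(1 - a * v) * (1 - b * v) * D v = (1 - v) * (1 - a * b * v * D (v * q))"
    if v: "v = u * q ^ N" for v N
  proof -
    have v0: "v \<noteq> 0" using v u0 q0 by simp
    have vn: "v \<noteq> q ^ k" for k using v un by simp
    have vq: "v * q = u * q ^ Suc N" by (simp add: v)
    have e1: "q / (v * q) = 1 / v" using q0 by simp
    have "(\<lambda>n. (1 - a * v) * (1 - b * v) * f (q / v) n + a * b * v * (1 - v) * f (1 / v) n)
      sums ((1 - a * v) * (1 - b * v) * S v + a * b * v * (1 - v) * S (v * q))"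
      unfolding S_def e1 using f_summable[of N] f_summable[of "Suc N"] e1
      by (intro sums_add sums_mult summable_sums) (simp_all add: v flip: vq)
    moreover have "(\<lambda>n. (1 - a * v) * (1 - b * v) * f (q / v) n + a * b * v * (1 - v) * f (1 / v) n)
      sums (1 - v + P v)"
      unfolding f_def P_def by (rule three_phi_two_step[OF q v0 vn])
    ultimately have Seq: "(1 - a * v) * (1 - b * v) * S v + a * b * v * (1 - v) * S (v * q) = 1 - v + P v"
      by (rule sums_unique2)
    have gs: "summable (g v)" "summable (g (v * q))"
      unfolding vq unfolding v by (rule g_summable)+
    have Geq: "(1 - a * v) * (1 - b * v) * G v = 1 + a * b * v\<^sup>2 * q * G (v * q)"
      unfolding G_def g_def
    proof (rule partial_theta_step[OF q])
      have "norm (b * u) * norm q ^ N \<le> norm (b * u) * 1"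
        using q by (intro mult_left_mono power_le_one) auto
      then show "norm (b * v) < 1" using bu by (simp add: v norm_mult norm_power mult.assoc)
      show "a * v * q ^ k \<noteq> 1" for k using au[of "N + k"] by (simp add: v power_add mult.assoc)
    qed (use gs in \<open>simp_all add: g_def\<close>)
    have "qpoch_inf (1 / v) q = (1 - 1 / v) * qpoch_inf (q / v) q"
      using qpoch_inf_Suc[OF q, of "1 / v"] by simp
    then have Peq: "P (v * q) * (v - 1) = P v * (q * v)"
    proof -
      have "q / v * q ^ k \<noteq> 1" for k using vn[of "Suc k"] v0 by (auto simp: field_simps)
      then have n1: "qpoch_inf (q / v) q \<noteq> 0" by (intro qpoch_inf_nonzero q)
      have n2: "v - 1 \<noteq> 0" using vn[of 0] by simp
      have e4: "qpoch_inf (1 / v) q = (v - 1) / v * qpoch_inf (q / v) q"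
        unfolding \<open>qpoch_inf (1 / v) q = _\<close> using v0 by (simp add: diff_divide_distrib)
      show ?thesis unfolding P_def e1 e4 using v0 n1 n2 by simp
    qed
    have "(1 - a * v) * (1 - b * v) * D v
       = (1 - v + P v - a * b * v * (1 - v) * S (v * q)) - P v * (1 + a * b * v\<^sup>2 * q * G (v * q))"
      unfolding D_def Seq[symmetric] Geq[symmetric] by (simp add: algebra_simps)
    also have "\<dots> = 1 - v - a * b * v * (1 - v) * S (v * q) - a * b * v * (P v * (q * v)) * G (v * q)"
      by (simp add: algebra_simps power2_eq_square)
    also have "\<dots> = (1 - v) * (1 - a * b * v * D (v * q))"
      unfolding Peq[symmetric] D_def by (simp add: algebra_simps)
    finally show ?thesis .
  qed
  define C where "C = (\<lambda>n. (- a * b * u) ^ n * q ^ (n choose 2) * qpoch u q n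
      / (qpoch (a * u) q n * qpoch (b * u) q n))"
  define T where "T = (\<lambda>n. (- a * b * u) ^ n * q ^ (n choose 2) * qpoch u q (Suc n)
      / (qpoch (a * u) q (Suc n) * qpoch (b * u) q (Suc n)))"
  have partial: "D u = (\<Sum>n<N. T n) + C N * D (u * q ^ N)" for N
  proof (induction N)
    case (Suc N)
    define v where "v = u * q ^ N"
    define x where "x = (1 - v) / ((1 - a * v) * (1 - b * v))"
    have nz: "1 - a * v \<noteq> 0" "1 - b * v \<noteq> 0" using au[of N] bun[of N] by (auto simp: v_def mult.assoc)
    have "D v = ((1 - a * v) * (1 - b * v) * D v) / ((1 - a * v) * (1 - b * v))" using nz by simp
    then have Dv: "D v = x * (1 - a * b * v * D (v * q))"
      unfolding D_step[OF v_def] by (simp add: x_def)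
    have TN: "T N = C N * x"
      by (simp add: T_def C_def qpoch_Suc x_def v_def mult_ac)
    have ch: "Suc N choose 2 = N + (N choose 2)" by (simp add: numeral_2_eq_2)
    have CN: "C (Suc N) = C N * x * (- a * b * v)"
      by (simp add: C_def qpoch_Suc x_def v_def mult_ac ch power_add)
    have "C N * D v = T N + C (Suc N) * D (v * q)"
      unfolding Dv TN CN by (simp add: algebra_simps)
    then show ?case using Suc by (simp add: v_def mult_ac)
  qed (simp add: C_def numeral_2_eq_2)
  define B where "B = (\<Sum>n. X a * X b / d * norm q ^ n)
      + norm u * (X a * X b / d) * (\<Sum>n. X (a * u) / e * norm (b * u) ^ n)"
  have D_le: "norm (D (u * q ^ N)) \<le> B" for N
  proof -
    have 1: "norm (S (u * q ^ N)) \<le> (\<Sum>n. X a * X b / d * norm q ^ n)"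
      unfolding S_def by (rule norm_suminf_le[OF f_le f_sum])
    have 2: "norm (G (u * q ^ N)) \<le> (\<Sum>n. X (a * u) / e * norm (b * u) ^ n)"
      unfolding G_def by (rule norm_suminf_le[OF g_le g_sum])
    have dd: "d \<le> norm (qpoch_inf (q / (u * q ^ N)) q)"
      by (rule LIMSEQ_le_const[OF tendsto_norm[OF qpoch_LIMSEQ[OF q]]]) (use d in auto)
    have "norm (P (u * q ^ N)) = norm u * norm q ^ N
        * (norm (qpoch_inf a q) * norm (qpoch_inf b q) / norm (qpoch_inf (q / (u * q ^ N)) q))"
      by (simp only: P_def norm_mult norm_divide norm_power)
    also have "\<dots> \<le> norm u * 1 * (X a * X b / d)"
      using q X d dd by (intro mult_mono frac_le) (auto intro: power_le_one)
    finally have 3: "norm (P (u * q ^ N)) \<le> norm u * (X a * X b / d)" by simp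
    have "norm (D (u * q ^ N)) \<le> norm (S (u * q ^ N)) + norm (P (u * q ^ N)) * norm (G (u * q ^ N))"
      unfolding D_def norm_mult[symmetric] by (rule norm_triangle_ineq4)
    also have "\<dots> \<le> B" unfolding B_def
      using X d by (intro add_mono mult_mono 1 2 3) auto
    finally show ?thesis .
  qed
  have C_lim: "C \<longlonglongrightarrow> 0"
  proof -
    have "C \<longlonglongrightarrow> 0 * qpoch_inf u q / (qpoch_inf (a * u) q * qpoch_inf (b * u) q)"
      unfolding C_def using qpoch_inf_nonzero[OF q au] qpoch_inf_nonzero[OF q bun]
      by (intro tendsto_intros qpoch_LIMSEQ q theta_power_tendsto_zero) auto
    then show ?thesis by simp
  qed
  have "(\<lambda>N. C N * D (u * q ^ N)) \<longlonglongrightarrow> 0"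
  proof (rule Lim_null_comparison[where g = "\<lambda>N. norm (C N) * B"])
    show "eventually (\<lambda>N. norm (C N * D (u * q ^ N)) \<le> norm (C N) * B) sequentially"
      using D_le by (intro always_eventually) (simp add: norm_mult mult_left_mono)
    show "(\<lambda>N. norm (C N) * B) \<longlonglongrightarrow> 0"
      using tendsto_mult_left_zero[OF tendsto_norm_zero[OF C_lim]] by simp
  qed
  then have "(\<lambda>N. D u - C N * D (u * q ^ N)) \<longlonglongrightarrow> D u - 0" by (intro tendsto_intros)
  moreover have "D u - C N * D (u * q ^ N) = (\<Sum>n<N. T n)" for N using partial[of N] by simp
  ultimately have "T sums D u" by (simp add: sums_def)
  then show ?thesis by (simp add: T_def D_def S_def f_def P_def G_def g_def)
qed

section \<open>The theorem of Jacobi on sums of two squares\<close>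

text \<open>An identity of Shanks for the partial sums of \<open>\<Sum>s. (- 1) ^ s * q ^ s^2\<close> over all integers. In the
  limit only the term \<open>s = 0\<close> on the left survives, which yields Gauss's product. The step from \<open>n\<close> to
  \<open>n + 1\<close> is a telescoping sum over \<open>s\<close>.\<close>

lemma gauss_square_partial_sums:
  fixes q :: complex
  assumes q: "norm q < 1"
  shows "(\<Sum>s\<le>n. (- 1) ^ s * qpoch (- 1) q s / qpoch q q s * q ^ (s * Suc n)) * (qpoch q q n / qpoch (- q) q n)
       = 1 + 2 * (\<Sum>s<n. (- 1) ^ Suc s * q ^ (Suc s)\<^sup>2)"
proof (induction n)
  case (Suc n)
  define e where "e = (\<lambda>s. (- 1) ^ s * qpoch (- 1) q s / qpoch q q s)"
  define m where "m = Suc n"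
  define E where "E = (\<lambda>n. \<Sum>s\<le>n. e s * q ^ (s * Suc n))"
  \<comment> \<open>the antidifference; it vanishes at \<open>s = 0\<close>\<close>
  define v where "v = (\<lambda>s. e s * q ^ (s * m) * (1 - q ^ s))"
  have nz: "qpoch q q s \<noteq> 0" "qpoch (- q) q s \<noteq> 0" for s by (rule qpoch_self_nonzero[OF q])+
  have nzs: "1 - q ^ Suc s \<noteq> 0" "1 + q ^ Suc s \<noteq> 0" for s
    using one_minus_power_nonzero[OF q, of "Suc s"] by auto
  have e_Suc: "e (Suc s) * (1 - q ^ Suc s) = - e s * (1 + q ^ s)" for s
    using nz nzs[of s] by (simp add: e_def qpoch_Suc)
  have telescoping: "(1 - q ^ m) * (e s * q ^ (s * Suc m)) - (1 + q ^ m) * (e s * q ^ (s * m)) = v (Suc s) - v s" for s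
  proof -
    have "v (Suc s) = (e (Suc s) * (1 - q ^ Suc s)) * (q ^ m * q ^ (s * m))"
      by (simp add: v_def power_add mult_ac)
    also have "\<dots> = - e s * (1 + q ^ s) * (q ^ m * q ^ (s * m))" by (simp only: e_Suc)
    finally have v1: "v (Suc s) = - e s * (1 + q ^ s) * (q ^ m * q ^ (s * m))" .
    have p: "q ^ (s * Suc m) = q ^ s * q ^ (s * m)" by (simp add: power_add)
    show ?thesis unfolding v1 p unfolding v_def by (simp add: algebra_simps)
  qed
  have "(1 - q ^ m) * E m - (1 + q ^ m) * E n
      = (\<Sum>s\<le>n. (1 - q ^ m) * (e s * q ^ (s * Suc m)) - (1 + q ^ m) * (e s * q ^ (s * m)))
        + (1 - q ^ m) * (e m * q ^ (m * Suc m))"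
    by (simp add: E_def m_def sum_subtractf sum_distrib_left distrib_left)
  also have "(\<Sum>s\<le>n. (1 - q ^ m) * (e s * q ^ (s * Suc m)) - (1 + q ^ m) * (e s * q ^ (s * m))) = v m - v 0"
    unfolding telescoping using sum_lessThan_telescope[of v m] by (simp add: m_def lessThan_Suc_atMost)
  also have "v m - v 0 + (1 - q ^ m) * (e m * q ^ (m * Suc m)) = (1 + q ^ m) * ((e m * (1 - q ^ m)) * q ^ m\<^sup>2)"
    by (simp add: v_def power_add power2_eq_square algebra_simps)
  finally have main: "(1 - q ^ m) * E m = (1 + q ^ m) * (E n + (e m * (1 - q ^ m)) * q ^ m\<^sup>2)"
    by (simp add: algebra_simps)
  have qn: "qpoch q q m = qpoch q q n * (1 - q ^ m)" by (simp add: m_def qpoch_Suc)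
  have lft: "qpoch (- 1) q m = 2 * qpoch (- q) q n" using qpoch_Suc_left[of "- 1" q n] by (simp add: m_def)
  have nzm: "1 - q ^ m \<noteq> 0" unfolding m_def by (rule nzs)
  have em: "e m * (1 - q ^ m) * (qpoch q q n / qpoch (- q) q n) = 2 * (- 1) ^ m"
    unfolding e_def qn lft using nz[of n] nzm by simp
  have "E m * (qpoch q q m / qpoch (- q) q m)
      = ((1 - q ^ m) * E m) / (1 + q ^ m) * (qpoch q q n / qpoch (- q) q n)"
    by (simp add: m_def qpoch_Suc mult_ac)
  also have "\<dots> = (E n + (e m * (1 - q ^ m)) * q ^ m\<^sup>2) * (qpoch q q n / qpoch (- q) q n)"
    unfolding main using nzs(2)[of n] by (simp add: m_def)
  also have "\<dots> = E n * (qpoch q q n / qpoch (- q) q n)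
      + (e m * (1 - q ^ m) * (qpoch q q n / qpoch (- q) q n)) * q ^ m\<^sup>2"
    by (simp only: ring_distribs mult_ac)
  also have "\<dots> = 1 + 2 * (\<Sum>s<n. (- 1) ^ Suc s * q ^ (Suc s)\<^sup>2) + 2 * (- 1) ^ m * q ^ m\<^sup>2"
    unfolding em using Suc by (simp add: E_def e_def)
  finally show ?case by (simp add: E_def e_def m_def)
qed auto

lemma gauss_square_sums:
  fixes q :: complex
  assumes q: "norm q < 1"
  shows "(\<lambda>s. 2 * ((- 1) ^ Suc s * q ^ (Suc s)\<^sup>2)) sums (qpoch_inf q q / qpoch_inf (- q) q - 1)"
proof -
  define e where "e = (\<lambda>s. (- 1) ^ s * (qpoch (- 1) q s / qpoch q q s))"
  define f where "f = (\<lambda>s n. if s \<le> n then e s * q ^ (s * Suc n) else 0)"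
  have "(\<lambda>s. qpoch (- 1) q s / qpoch q q s) \<longlonglongrightarrow> qpoch_inf (- 1) q / qpoch_inf q q"
    using qpoch_self_nonzero[OF q] by (intro tendsto_divide qpoch_LIMSEQ q) auto
  then have "Bseq (\<lambda>s. qpoch (- 1) q s / qpoch q q s)" using convergentI convergent_imp_Bseq by blast
  then have e_bdd: "Bseq e" by (simp add: Bseq_def e_def norm_mult norm_power del: times_divide_eq_right)
  have "(\<lambda>n. \<Sum>s. f s n) \<longlonglongrightarrow> (\<Sum>s. if s = 0 then e 0 else 0)"
  proof (rule tannery_sequence)
    show "summable (\<lambda>s. norm (e s * q ^ s))" by (rule summable_bounded_geometric[OF e_bdd q])
    fix s n
    have "norm q ^ (s * Suc n) \<le> norm q ^ s" using q by (intro power_decreasing) auto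
    then show "norm (f s n) \<le> norm (e s * q ^ s)"
      by (auto simp: f_def norm_mult norm_power intro!: mult_left_mono)
  next
    fix s
    show "f s \<longlonglongrightarrow> (if s = 0 then e 0 else 0)"
    proof (cases "s = 0")
      case False
      then have "norm (q ^ s) < 1" using q by (simp add: norm_power power_less_one_iff)
      then have "(\<lambda>n. e s * (q ^ s) ^ Suc n) \<longlonglongrightarrow> e s * 0"
        by (intro tendsto_mult_left LIMSEQ_Suc LIMSEQ_power_zero)
      moreover have "eventually (\<lambda>n. f s n = e s * (q ^ s) ^ Suc n) sequentially"
        using eventually_ge_at_top[of s]
        by eventually_elim (simp add: f_def power_mult[symmetric] power_add del: power_Suc)
      ultimately show ?thesis using False tendsto_cong by fastforce
    qed (simp add: f_def)
  qed
  moreover have "(\<Sum>s. f s n) = (\<Sum>s\<le>n. e s * q ^ (s * Suc n))" for n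
    by (subst suminf_finite[of "{..n}"]) (auto simp: f_def)
  moreover have "(\<Sum>s. if s = 0 then e 0 else 0) = 1"
    using sums_single[of 0 "\<lambda>_. e 0"] by (simp add: sums_iff e_def)
  ultimately have E: "(\<lambda>n. \<Sum>s\<le>n. e s * q ^ (s * Suc n)) \<longlonglongrightarrow> 1" by simp
  have "(\<lambda>n. (\<Sum>s\<le>n. e s * q ^ (s * Suc n)) * (qpoch q q n / qpoch (- q) q n) - 1)
      \<longlonglongrightarrow> 1 * (qpoch_inf q q / qpoch_inf (- q) q) - 1"
    using qpoch_self_nonzero[OF q] by (intro tendsto_intros E qpoch_LIMSEQ q) auto
  moreover have "(\<Sum>s\<le>n. e s * q ^ (s * Suc n)) * (qpoch q q n / qpoch (- q) q n) - 1
      = (\<Sum>s<n. 2 * ((- 1) ^ Suc s * q ^ (Suc s)\<^sup>2))" for n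
    using gauss_square_partial_sums[OF q, of n] by (simp add: e_def sum_distrib_left)
  ultimately show ?thesis by (simp add: sums_def)
qed

text \<open>A finite form of an expansion of the square of Gauss's product \<open>(q)_\<infinity> / (- q)_\<infinity>\<close>, in the style
  of Andrews, Ekhad and Zeilberger. Replacing \<open>n\<close> by \<open>m = n + 1\<close> multiplies the right-hand side by
  \<open>1 / (1 + q ^ m)^2\<close>; correspondingly \<open>(1 + q ^ m)^2 * T m k - T n k\<close> is a difference \<open>H (k + 1) - H k\<close>
  up to a factor that does not depend on \<open>k\<close>.\<close>

lemma reciprocal_qpoch_square_expansion:
  fixes q :: complex
  assumes q: "norm q < 1"
  defines "T \<equiv> \<lambda>n k. if k \<le> n then (- 1) ^ k * q ^ (Suc k choose 2) / (1 + q ^ k)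
                 / (qpoch q q (n - k) * qpoch q q (n + k)) else 0"
  shows "1 / (qpoch q q n)\<^sup>2 + 4 * (\<Sum>k<n. T n (Suc k)) = 1 / (qpoch (- q) q n)\<^sup>2"
proof (induction n)
  case (Suc n)
  define m where "m = Suc n"
  define H where "H = (\<lambda>k. if k \<le> m then (- 1) ^ k * q ^ (k choose 2)
      / (qpoch q q (m - k) * qpoch q q (n + k)) else 0)"
  have nz: "qpoch q q s \<noteq> 0" "qpoch (- q) q s \<noteq> 0" for s by (rule qpoch_self_nonzero[OF q])+
  have nzs: "1 - q ^ Suc s \<noteq> 0" "1 + q ^ Suc s \<noteq> 0" for s
    using one_minus_power_nonzero[OF q, of "Suc s"] by auto
  have ch: "Suc j choose 2 = j + (j choose 2)" for j by (simp add: numeral_2_eq_2)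
  have qq: "qpoch q q (Suc j) = qpoch q q j * (1 - q ^ Suc j)" for j by (simp add: qpoch_Suc)
  have step: "(1 - q ^ m) * ((1 + q ^ m)\<^sup>2 * T m (Suc j) - T n (Suc j)) = - (q ^ m) * (H (Suc (Suc j)) - H (Suc j))"
    if "j < m" for j
  proof (cases "j = n")
    case True
    define Y where "Y = (- 1) ^ m * q ^ (m choose 2) / qpoch q q (n + m)"
    have e1: "qpoch q q (m + m) = qpoch q q (n + m) * ((1 - q ^ m) * (1 + q ^ m))"
      using qq[of "n + m"] by (simp add: m_def power_add algebra_simps)
    have 1: "(1 + q ^ m)\<^sup>2 * T m m * (1 - q ^ m) = q ^ m * Y"
      using nzs[of n] nz(1)[of "n + m"] unfolding T_def e1 ch Y_def
      by (simp add: m_def power_add power2_eq_square divide_simps)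
    have 2: "T n m = 0" "H (Suc m) = 0" "H m = Y"
      by (simp_all add: T_def H_def m_def Y_def)
    show ?thesis unfolding True m_def[symmetric] 2 using 1 by (simp add: mult_ac)
  next
    case False
    define k where "k = Suc j"
    have "k \<le> n" using False that by (simp add: k_def m_def)
    then obtain l where l: "n = k + l" by (metis le_Suc_ex)
    define x where "x = (- 1) ^ k * q ^ (k choose 2) / (qpoch q q (Suc l) * qpoch q q (m + k))"
    have q1: "qpoch q q (Suc l) = qpoch q q l * (1 - q ^ Suc l)" by (rule qq)
    have q2: "qpoch q q (m + k) = qpoch q q (n + k) * (1 - q ^ (m + k))" using qq[of "n + k"] by (simp add: m_def)
    have nzk: "1 - q ^ (m + k) \<noteq> 0" "1 + q ^ k \<noteq> 0" using nzs[of "n + k"] nzs[of j] by (simp_all add: m_def k_def)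
    have d: "m - k = Suc l" "m - Suc k = l" "n - k = l" "k \<le> n" "k \<le> m" "Suc k \<le> m" "n + Suc k = m + k"
      using l by (simp_all add: m_def)
    have d8: "Suc (n + k) = m + k" by (simp add: m_def)
    have T1: "T m k = x * q ^ k / (1 + q ^ k)" by (simp add: T_def d x_def ch power_add mult_ac)
    have T2: "T n k = x * q ^ k / (1 + q ^ k) * ((1 - q ^ Suc l) * (1 - q ^ (m + k)))"
      using nz nzs[of l] nzk by (simp add: T_def d x_def ch power_add q1 q2 mult_ac del: power_Suc)
    have H1: "H k = x * (1 - q ^ (m + k))"
      using nz nzk by (simp add: H_def d x_def q2)
    have H2: "H (Suc k) = - x * q ^ k * (1 - q ^ Suc l)"
      using nz nzs[of l] by (simp add: H_def d d8 x_def q1 ch power_add power_Suc[of "- 1"] mult_ac del: power_Suc)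
    have qm: "q ^ m = q ^ k * q ^ Suc l" by (simp add: m_def l power_add)
    have "(1 + q ^ m)\<^sup>2 * T m k - T n k = x * q ^ k / (1 + q ^ k)
        * ((1 + q ^ m)\<^sup>2 - (1 - q ^ Suc l) * (1 - q ^ (m + k)))"
      unfolding T1 T2 by (simp only: right_diff_distrib mult_ac)
    also have "(1 + q ^ m)\<^sup>2 - (1 - q ^ Suc l) * (1 - q ^ (m + k)) = q ^ Suc l * (1 + q ^ k)\<^sup>2"
      unfolding power_add qm by (simp add: algebra_simps power2_eq_square)
    also have "x * q ^ k / (1 + q ^ k) * (q ^ Suc l * (1 + q ^ k)\<^sup>2) = x * q ^ m * (1 + q ^ k)"
      using nzk by (simp add: qm power2_eq_square)
    finally have f1: "(1 + q ^ m)\<^sup>2 * T m k - T n k = x * q ^ m * (1 + q ^ k)" .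
    have f2: "H (Suc k) - H k = - x * (1 + q ^ k) * (1 - q ^ m)"
      unfolding H1 H2 power_add qm by (simp add: algebra_simps)
    show ?thesis unfolding k_def[symmetric] f1 f2 by (simp add: algebra_simps)
  qed
  have "(\<Sum>k<m. T n (Suc k)) = (\<Sum>k<n. T n (Suc k))" by (simp add: m_def T_def)
  then have "(1 - q ^ m) * ((1 + q ^ m)\<^sup>2 * (\<Sum>k<m. T m (Suc k)) - (\<Sum>k<n. T n (Suc k)))
      = (1 - q ^ m) * ((1 + q ^ m)\<^sup>2 * (\<Sum>k<m. T m (Suc k)) - (\<Sum>k<m. T n (Suc k)))"
    by simp
  also have "\<dots> = (\<Sum>k<m. (1 - q ^ m) * ((1 + q ^ m)\<^sup>2 * T m (Suc k) - T n (Suc k)))"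
    by (simp add: sum_distrib_left sum_subtractf right_diff_distrib)
  also have "\<dots> = (\<Sum>k<m. - (q ^ m) * (H (Suc (Suc k)) - H (Suc k)))"
    by (intro sum.cong refl step) auto
  also have "\<dots> = - (q ^ m) * (H (Suc m) - H (Suc 0))"
    unfolding sum_distrib_left[symmetric] using sum_lessThan_telescope[of "\<lambda>k. H (Suc k)" m] by simp
  also have "\<dots> = - (q ^ m) / (qpoch q q n * qpoch q q m)"
    by (simp add: H_def m_def numeral_2_eq_2)
  finally have s1: "(1 + q ^ m)\<^sup>2 * (\<Sum>k<m. T m (Suc k)) - (\<Sum>k<n. T n (Suc k)) = - (q ^ m) / (qpoch q q m)\<^sup>2"
    using nz nzs[of n] by (simp add: m_def qq divide_simps power2_eq_square del: power_Suc)
       (simp add: mult_ac del: power_Suc)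
  have s2: "(1 + q ^ m)\<^sup>2 * (1 / (qpoch q q m)\<^sup>2) - 1 / (qpoch q q n)\<^sup>2 = 4 * q ^ m / (qpoch q q m)\<^sup>2"
    using nz nzs[of n] by (simp add: m_def qq divide_simps del: power_Suc)
       (simp add: algebra_simps power2_eq_square del: power_Suc)
  have "(1 + q ^ m)\<^sup>2 * (1 / (qpoch q q m)\<^sup>2 + 4 * (\<Sum>k<m. T m (Suc k)))
      = ((1 + q ^ m)\<^sup>2 * (1 / (qpoch q q m)\<^sup>2) - 1 / (qpoch q q n)\<^sup>2)
        + 4 * ((1 + q ^ m)\<^sup>2 * (\<Sum>k<m. T m (Suc k)) - (\<Sum>k<n. T n (Suc k)))
        + (1 / (qpoch q q n)\<^sup>2 + 4 * (\<Sum>k<n. T n (Suc k)))"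
    by (simp add: algebra_simps)
  also have "\<dots> = 1 / (qpoch (- q) q n)\<^sup>2" unfolding s1 s2 Suc by simp
  finally have s3: "(1 + q ^ m)\<^sup>2 * (1 / (qpoch q q m)\<^sup>2 + 4 * (\<Sum>k<m. T m (Suc k))) = 1 / (qpoch (- q) q n)\<^sup>2" .
  have "1 + q ^ m \<noteq> 0" unfolding m_def by (rule nzs)
  moreover have "qpoch (- q) q m = qpoch (- q) q n * (1 + q ^ m)" by (simp add: m_def qpoch_Suc)
  moreover note s3
  ultimately show ?case using nz
    by (simp add: m_def[symmetric] power_mult_distrib eq_divide_eq mult_ac)
qed (simp add: T_def)

lemma qpoch_quotient_square_sums:
  fixes q :: complex
  assumes q: "norm q < 1"
  shows "(\<lambda>k. 4 * ((- 1) ^ Suc k * q ^ (Suc (Suc k) choose 2) / (1 + q ^ Suc k)))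
     sums ((qpoch_inf q q / qpoch_inf (- q) q)\<^sup>2 - 1)"
proof -
  define c where "c = (\<lambda>k. (- 1) ^ Suc k * q ^ (Suc (Suc k) choose 2) / (1 + q ^ Suc k))"
  define f where "f = (\<lambda>k n. if Suc k \<le> n
     then c k * ((qpoch q q n)\<^sup>2 / (qpoch q q (n - Suc k) * qpoch q q (n + Suc k))) else 0)"
  have nz: "qpoch q q s \<noteq> 0" "qpoch (- q) q s \<noteq> 0" "qpoch_inf q q \<noteq> 0" "qpoch_inf (- q) q \<noteq> 0" for s
    by (rule qpoch_self_nonzero[OF q])+
  have "q * q ^ k \<noteq> 1" for k using one_minus_power_nonzero[OF q, of "Suc k"] by simp
  then obtain d where d: "d > 0" "\<And>n. d \<le> norm (qpoch q q n)" using qpoch_bounded_below[OF q] by blast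
  define X where "X = exp (norm q / (1 - norm q))"
  have X: "norm (qpoch q q n) \<le> X" for n unfolding X_def by (rule qpoch_norm_le[OF q])
  have c_le: "norm (c k) \<le> norm q ^ k * (1 / (1 - norm q))" for k
  proof -
    have "1 - norm q \<le> norm (1 + q ^ Suc k)"
    proof -
      have "norm q ^ Suc k \<le> norm q ^ 1" using q by (intro power_decreasing) auto
      then show ?thesis using norm_diff_ineq[of 1 "q ^ Suc k"] by (simp add: norm_power norm_mult)
    qed
    moreover have "norm q ^ (Suc (Suc k) choose 2) \<le> norm q ^ k"
      using q by (intro power_decreasing) (auto simp: numeral_2_eq_2)
    ultimately have "norm q ^ (Suc (Suc k) choose 2) / norm (1 + q ^ Suc k) \<le> norm q ^ k / (1 - norm q)"
      using q by (intro frac_le) auto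
    then show ?thesis by (simp add: c_def norm_mult norm_divide norm_power)
  qed
  have c_sum: "summable (\<lambda>k. norm (c k))"
  proof (rule summable_comparison_test')
    show "summable (\<lambda>k. norm q ^ k * (1 / (1 - norm q)))"
      using q by (intro summable_mult2 summable_geometric) auto
    show "norm (norm (c k)) \<le> norm q ^ k * (1 / (1 - norm q))" if "k \<ge> 0" for k using c_le by simp
  qed
  have "(\<lambda>n. \<Sum>k. f k n) \<longlonglongrightarrow> (\<Sum>k. c k)"
  proof (rule tannery_sequence)
    show "summable (\<lambda>k. norm (c k) * (X\<^sup>2 / (d * d)))" by (intro summable_mult2 c_sum)
    fix k n
    have "norm (c k) * ((norm (qpoch q q n))\<^sup>2 / (norm (qpoch q q (n - Suc k)) * norm (qpoch q q (n + Suc k))))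
       \<le> norm (c k) * (X\<^sup>2 / (d * d))"
      using X d by (intro mult_left_mono frac_le mult_mono power_mono) auto
    then show "norm (f k n) \<le> norm (c k) * (X\<^sup>2 / (d * d))"
      by (auto simp: f_def norm_mult norm_divide norm_power)
  next
    fix k
    have "(\<lambda>n. c k * ((qpoch q q n)\<^sup>2 / (qpoch q q (n - Suc k) * qpoch q q (n + Suc k))))
       \<longlonglongrightarrow> c k * ((qpoch_inf q q)\<^sup>2 / (qpoch_inf q q * qpoch_inf q q))"
      using nz by (intro tendsto_intros qpoch_LIMSEQ q seq_offset_neg LIMSEQ_ignore_initial_segment) auto
    also have "c k * ((qpoch_inf q q)\<^sup>2 / (qpoch_inf q q * qpoch_inf q q)) = c k"
      using nz by (simp add: power2_eq_square)
    finally show "f k \<longlonglongrightarrow> c k"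
    proof (rule Lim_transform_eventually)
      show "eventually (\<lambda>n. c k * ((qpoch q q n)\<^sup>2 / (qpoch q q (n - Suc k) * qpoch q q (n + Suc k))) = f k n) sequentially"
        using eventually_ge_at_top[of "Suc k"] by eventually_elim (simp add: f_def)
    qed
  qed
  then have "(\<lambda>n. 1 + 4 * (\<Sum>k. f k n)) \<longlonglongrightarrow> 1 + 4 * (\<Sum>k. c k)" by (intro tendsto_intros)
  moreover have "1 + 4 * (\<Sum>k. f k n) = (qpoch q q n / qpoch (- q) q n)\<^sup>2" for n
  proof -
    have "(\<Sum>k. f k n) = (\<Sum>k<n. f k n)"
      by (intro suminf_finite) (auto simp: f_def)
    also have "\<dots> = (qpoch q q n)\<^sup>2 * (\<Sum>k<n. if Suc k \<le> n then (- 1) ^ Suc k * q ^ (Suc (Suc k) choose 2)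
        / (1 + q ^ Suc k) / (qpoch q q (n - Suc k) * qpoch q q (n + Suc k)) else 0)"
      unfolding sum_distrib_left by (intro sum.cong) (auto simp: f_def c_def)
    finally have "1 + 4 * (\<Sum>k. f k n) = (qpoch q q n)\<^sup>2 * (1 / (qpoch q q n)\<^sup>2
        + 4 * (\<Sum>k<n. if Suc k \<le> n then (- 1) ^ Suc k * q ^ (Suc (Suc k) choose 2)
        / (1 + q ^ Suc k) / (qpoch q q (n - Suc k) * qpoch q q (n + Suc k)) else 0))"
      using nz by (simp add: distrib_left)
    also have "\<dots> = (qpoch q q n)\<^sup>2 * (1 / (qpoch (- q) q n)\<^sup>2)"
      using reciprocal_qpoch_square_expansion[OF q, of n] by simp
    finally show ?thesis by (simp add: power_divide)
  qed
  moreover have "(\<lambda>n. (qpoch q q n / qpoch (- q) q n)\<^sup>2) \<longlonglongrightarrow> (qpoch_inf q q / qpoch_inf (- q) q)\<^sup>2"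
    using nz by (intro tendsto_intros qpoch_LIMSEQ q) auto
  ultimately have "1 + 4 * (\<Sum>k. c k) = (qpoch_inf q q / qpoch_inf (- q) q)\<^sup>2"
    using LIMSEQ_unique by auto
  then have "4 * (\<Sum>k. c k) = (qpoch_inf q q / qpoch_inf (- q) q)\<^sup>2 - 1" by (simp add: algebra_simps)
  moreover have "(\<lambda>k. 4 * c k) sums (4 * (\<Sum>k. c k))"
    by (intro sums_mult summable_sums summable_norm_cancel[OF c_sum])
  ultimately show ?thesis by (simp add: c_def)
qed

lemma geometric_has_sum:
  fixes x :: "'a :: {real_normed_field, banach}"
  assumes "norm x < 1"
  shows "((\<lambda>n. x ^ n) has_sum (1 / (1 - x))) UNIV"
  using assms by (intro norm_summable_imp_has_sum geometric_sums) (simp_all add: norm_power summable_geometric)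

text \<open>Expanding the geometric series makes both series double series of signed powers of \<open>q\<close>.
  Numbering from 1, the second one has the exponents \<open>n * d\<close> for odd \<open>d\<close>, and the first one runs
  over pairs \<open>k < m\<close> of opposite parity with exponent \<open>k * m / 2\<close>. These correspond by
  \<open>{k, m} = {2 * n, d}\<close>; whether \<open>d\<close> or \<open>2 * n\<close> is the smaller one decides the case of the bijection,
  and the signs agree.\<close>

lemma lambert_rearrangement:
  fixes q :: complex
  assumes q: "norm q < 1"
    and S: "(\<lambda>k. (- 1) ^ Suc k * q ^ (Suc (Suc k) choose 2) / (1 + q ^ Suc k)) sums S"
  shows "(\<lambda>n. (- 1) ^ Suc n * q ^ Suc n / (1 + q ^ (2 * Suc n))) sums S"
proof -
  define g where "g = (\<lambda>(n, i). (- 1) ^ (Suc n + i) * q ^ (Suc n * (2 * i + 1)))"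
  define f where "f = (\<lambda>(k, j). (- 1) ^ (Suc k + j) * q ^ ((Suc (Suc k) choose 2) + Suc k * j))"
  have "(\<lambda>(n, i). norm q ^ n * norm q ^ i) summable_on UNIV \<times> UNIV"
  proof (rule summable_on_SigmaI)
    have G: "((\<lambda>i. norm q ^ i) has_sum (1 / (1 - norm q))) UNIV"
      using q by (intro geometric_has_sum) simp
    show "((\<lambda>i. case (n, i) of (n, i) \<Rightarrow> norm q ^ n * norm q ^ i) has_sum (norm q ^ n * (1 / (1 - norm q)))) UNIV" for n
      using has_sum_cmult_right[OF G, of "norm q ^ n"] by simp
    show "(\<lambda>n. norm q ^ n * (1 / (1 - norm q))) summable_on UNIV"
      by (intro summable_on_cmult_left has_sum_imp_summable[OF G])
  qed auto
  moreover have "norm (g x) \<le> (case x of (n, i) \<Rightarrow> norm q ^ n * norm q ^ i)" for x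
  proof -
    obtain n i where x: "x = (n, i)" by (cases x)
    have "norm q ^ (Suc n * (2 * i + 1)) \<le> norm q ^ (n + i)"
      using q by (intro power_decreasing) auto
    then show ?thesis by (simp add: x g_def norm_mult norm_power power_add)
  qed
  ultimately have "(\<lambda>x. norm (g x)) summable_on UNIV \<times> UNIV" by (rule Infinite_Sum.abs_summable_on_comparison_test')
  then have "g summable_on UNIV \<times> UNIV" by (rule abs_summable_summable)
  then obtain s where s: "(g has_sum s) (UNIV \<times> UNIV)" by (auto simp: summable_on_def)
  have g_row: "((\<lambda>i. g (n, i)) has_sum ((- 1) ^ Suc n * q ^ Suc n / (1 + q ^ (2 * Suc n)))) UNIV" for n
  proof -
    have "norm (- (q ^ (2 * Suc n))) < 1"
      using q power_less_one_iff[of "norm q" "2 * Suc n"] by (simp add: norm_power norm_mult)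
    from has_sum_cmult_right[OF geometric_has_sum[OF this], of "(- 1) ^ Suc n * q ^ Suc n"]
    moreover have "(- 1) ^ Suc n * q ^ Suc n * (- (q ^ (2 * Suc n))) ^ i = g (n, i)" for i
    proof -
      have x: "Suc n * (2 * i + 1) = Suc n + 2 * Suc n * i" by (simp add: algebra_simps)
      show ?thesis
        unfolding g_def prod.case x power_add power_minus[of "q ^ (2 * Suc n)"] power_mult[symmetric]
        by (simp only: mult_ac)
    qed
    ultimately show ?thesis by (simp only: minus_minus diff_minus_eq_add times_divide_eq_right mult_1_right)
  qed
  have "((\<lambda>n. (- 1) ^ Suc n * q ^ Suc n / (1 + q ^ (2 * Suc n))) has_sum s) UNIV"
    by (rule has_sum_SigmaD[OF s g_row])
  moreover have f_row: "((\<lambda>j. f (k, j)) has_sum ((- 1) ^ Suc k * q ^ (Suc (Suc k) choose 2) / (1 + q ^ Suc k))) UNIV" for k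
  proof -
    have "norm (- (q ^ Suc k)) < 1"
      using q power_less_one_iff[of "norm q" "Suc k"] by (simp add: norm_power norm_mult)
    from has_sum_cmult_right[OF geometric_has_sum[OF this], of "(- 1) ^ Suc k * q ^ (Suc (Suc k) choose 2)"]
    moreover have "(- 1) ^ Suc k * q ^ (Suc (Suc k) choose 2) * (- (q ^ Suc k)) ^ j = f (k, j)" for j
      unfolding f_def prod.case power_add power_minus[of "q ^ Suc k"] power_mult[symmetric]
      by (simp only: mult_ac)
    ultimately show ?thesis by (simp only: minus_minus diff_minus_eq_add times_divide_eq_right mult_1_right)
  qed
  have "(g has_sum s) (UNIV \<times> UNIV) \<longleftrightarrow> (f has_sum s) (UNIV \<times> UNIV)"
  proof (rule has_sum_reindex_bij_witness[where
        j = "\<lambda>(n, i). if i \<le> n then (2 * i, n - i) else (2 * n + 1, i - n - 1)"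
        and i = "\<lambda>(k, j). if even k then (k div 2 + j, k div 2) else (k div 2, k div 2 + j + 1)"])
    fix a :: "nat \<times> nat"
    obtain n i where a: "a = (n, i)" by (cases a)
    show "f (case a of (n, i) \<Rightarrow> if i \<le> n then (2 * i, n - i) else (2 * n + 1, i - n - 1)) = g a"
    proof (cases "i \<le> n")
      case True
      then obtain j where n: "n = i + j" by (metis le_Suc_ex)
      have "(Suc (Suc (2 * i)) choose 2) = (i + 1) * (2 * i + 1)"
        by (simp add: choose_two algebra_simps)
      then have "(Suc (Suc (2 * i)) choose 2) + Suc (2 * i) * j = Suc n * (2 * i + 1)"
        by (simp add: n algebra_simps)
      moreover have "Suc (2 * i) + j = Suc n + i" by (simp add: n)
      moreover have "n - i = j" by (simp add: n)
      ultimately show ?thesis using True unfolding a f_def g_def by (simp only: prod.case if_True)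
    next
      case False
      then obtain j where i: "i = n + 1 + j" by (metis add.commute add_Suc less_iff_Suc_add not_le plus_1_eq_Suc)
      have "(Suc (Suc (2 * n + 1)) choose 2) = (2 * n + 3) * (n + 1)"
        by (simp add: choose_two algebra_simps)
      then have "(Suc (Suc (2 * n + 1)) choose 2) + Suc (2 * n + 1) * j = Suc n * (2 * i + 1)"
        by (simp add: i algebra_simps)
      moreover have "Suc (2 * n + 1) + j = Suc n + i" by (simp add: i)
      moreover have "i - n - 1 = j" by (simp add: i)
      ultimately show ?thesis using False unfolding a f_def g_def by (simp only: prod.case if_False)
    qed
  qed (auto elim!: oddE evenE)
  then have "(f has_sum s) (UNIV \<times> UNIV)" using s by simp
  then have "((\<lambda>k. (- 1) ^ Suc k * q ^ (Suc (Suc k) choose 2) / (1 + q ^ Suc k)) has_sum s) UNIV"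
    by (rule has_sum_SigmaD[OF _ f_row])
  then have "s = S" using S has_sum_imp_sums sums_unique2 by blast
  ultimately show ?thesis using has_sum_imp_sums by blast
qed

lemma jacobi_Theta_sums:
  assumes q: "norm q < 1" and \<tau>: "q = exp (2 * of_real pi * \<i> * \<tau>)"
  shows "(\<lambda>s. 2 * q ^ (Suc s)\<^sup>2) sums (jacobi_Theta \<tau> - 1)"
proof -
  define h where "h = (\<lambda>n::int. q powi (n\<^sup>2))"
  have s: "summable (\<lambda>s. norm (q ^ (Suc s)\<^sup>2))"
  proof (rule summable_comparison_test')
    show "summable (\<lambda>s. norm q ^ s)" using q by (intro summable_geometric) auto
    fix s :: nat
    have "s \<le> (Suc s)\<^sup>2" by (simp add: power2_eq_square)
    then have "norm q ^ (Suc s)\<^sup>2 \<le> norm q ^ s" using q by (intro power_decreasing) auto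
    then show "norm (norm (q ^ (Suc s)\<^sup>2)) \<le> norm q ^ s" by (simp add: norm_power)
  qed
  define a where "a = (\<Sum>s. q ^ (Suc s)\<^sup>2)"
  have sums: "(\<lambda>s. q ^ (Suc s)\<^sup>2) sums a"
    unfolding a_def by (intro summable_sums summable_norm_cancel[OF s])
  have hs: "((\<lambda>s. q ^ (Suc s)\<^sup>2) has_sum a) UNIV"
    by (rule norm_summable_imp_has_sum[OF s sums])
  have h_nat: "h (int s) = q ^ s\<^sup>2" "h (- int s) = q ^ s\<^sup>2" for s
    by (simp_all add: h_def flip: power_int_of_nat)
  have pos: "(h has_sum a) {0<..}"
  proof -
    have "bij_betw (\<lambda>s. int (Suc s)) UNIV {0<..}"
      by (rule bij_betwI[where g = "\<lambda>n. nat n - 1"]) auto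
    from has_sum_reindex_bij_betw[OF this, of h a] show ?thesis using hs by (simp only: h_nat)
  qed
  have neg: "(h has_sum a) {..<0}"
  proof -
    have "bij_betw (\<lambda>s. - int (Suc s)) UNIV {..<0}"
      by (rule bij_betwI[where g = "\<lambda>n. nat (- n) - 1"]) auto
    from has_sum_reindex_bij_betw[OF this, of h a] show ?thesis using hs by (simp only: h_nat)
  qed
  have zero: "(h has_sum 1) {0}" by (rule has_sum_finiteI) (simp_all add: h_def)
  have "(h has_sum (a + (1 + a))) ({..<0} \<union> ({0} \<union> {0<..}))"
    by (intro has_sum_Un_disjoint neg zero pos) auto
  also have "{..<0} \<union> ({0} \<union> {0<..}) = (UNIV :: int set)" by auto
  finally have "jacobi_Theta \<tau> = a + (1 + a)"
    unfolding jacobi_Theta_def \<tau>[symmetric] h_def by (rule infsumI)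
  then show ?thesis using sums_mult[OF sums, of 2] by simp
qed

text \<open>Both auxiliary expansions are used at \<open>- q\<close>, where \<open>(- 1) ^ s * (- q) ^ s^2 = q ^ s^2\<close>.\<close>

theorem jacobi_two_squares:
  assumes q: "norm q < 1" and \<tau>: "q = exp (2 * of_real pi * \<i> * \<tau>)"
  shows "(\<lambda>n. 4 * (q ^ Suc n / (1 + q ^ (2 * Suc n)))) sums ((jacobi_Theta \<tau>)\<^sup>2 - 1)"
proof -
  have q': "norm (- q) < 1" using q by simp
  define P where "P = qpoch_inf (- q) (- q) / qpoch_inf (- (- q)) (- q)"
  have sgn: "(- 1) ^ (m\<^sup>2) = (- 1 :: complex) ^ m" for m :: nat
    by (cases "even m") simp_all
  have "2 * ((- 1) ^ Suc s * (- q) ^ (Suc s)\<^sup>2) = 2 * q ^ (Suc s)\<^sup>2" for s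
  proof -
    have "(- q) ^ (Suc s)\<^sup>2 = (- 1) ^ Suc s * q ^ (Suc s)\<^sup>2"
      unfolding power_minus[of q] sgn ..
    moreover have "(- 1) ^ Suc s * (- 1 :: complex) ^ Suc s = 1"
      by (simp add: power_mult_distrib[symmetric])
    ultimately show ?thesis by (metis mult.assoc mult_1)
  qed
  then have "(\<lambda>s. 2 * q ^ (Suc s)\<^sup>2) sums (P - 1)"
    using gauss_square_sums[OF q'] by (simp only: P_def)
  then have "P = jacobi_Theta \<tau>" using jacobi_Theta_sums[OF assms] sums_unique2 by fastforce
  have "(\<lambda>k. 1 / 4 * (4 * ((- 1) ^ Suc k * (- q) ^ (Suc (Suc k) choose 2) / (1 + (- q) ^ Suc k)))) sums (1 / 4 * (P\<^sup>2 - 1))"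
    unfolding P_def by (intro sums_mult qpoch_quotient_square_sums[OF q'])
  then have lim: "(\<lambda>k. (- 1) ^ Suc k * (- q) ^ (Suc (Suc k) choose 2) / (1 + (- q) ^ Suc k)) sums (1 / 4 * (P\<^sup>2 - 1))"
    by simp
  have "4 * (1 / 4 * (P\<^sup>2 - 1)) = P\<^sup>2 - 1" by simp
  with sums_mult[OF lambert_rearrangement[OF q' lim], of 4]
  have "(\<lambda>n. 4 * ((- 1) ^ Suc n * (- q) ^ Suc n / (1 + (- q) ^ (2 * Suc n)))) sums (P\<^sup>2 - 1)"
    by (simp only:)
  moreover have "(- 1) ^ Suc n * (- q) ^ Suc n = q ^ Suc n" "(- q) ^ (2 * Suc n) = q ^ (2 * Suc n)" for n
    by (simp_all add: power_mult_distrib[symmetric] power_mult)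
  ultimately show ?thesis unfolding \<open>P = jacobi_Theta \<tau>\<close> by (simp only:)
qed

section \<open>The eight generating functions\<close>

text \<open>For \<open>c \<noteq> 0\<close> the series of \<open>f\<close> converges along with that of its multiple, and for \<open>c = 0\<close> both sides
  vanish. The constant factors in the claims vanish at \<open>q = 0\<close>.\<close>

lemma sums_mult_suminf:
  fixes f :: "nat \<Rightarrow> complex"
  assumes "(\<lambda>n. c * f n) sums s"
  shows "s = c * suminf f"
proof (cases "c = 0")
  case True
  then show ?thesis using assms sums_unique2[of "\<lambda>_. 0" s 0] by simp
next
  case False
  then have "summable f" using assms sums_summable summable_mult_D by blast
  then have "(\<lambda>n. c * f n) sums (c * suminf f)" by (intro sums_mult summable_sums)
  with assms show ?thesis by (rule sums_unique2)
qed

lemma square_eq_twice_choose: "n + 2 * (n choose 2) = n\<^sup>2"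
proof (induction n)
  case (Suc n)
  then show ?case by (simp add: numeral_2_eq_2 power2_eq_square)
qed simp

lemma power_even_shift: "q ^ (2 * n + 2) = q\<^sup>2 * (q\<^sup>2 :: complex) ^ n"
  by (subst power_add) (simp only: power_mult mult.commute[of "q\<^sup>2" "(q\<^sup>2) ^ n"])

lemma norm_square_less_one: "norm q < 1 \<Longrightarrow> norm (q\<^sup>2 :: complex) < 1"
  by (simp add: norm_power power_less_one_iff)

lemma progression_not_one:
  fixes q :: complex
  assumes q: "norm q < 1" and s: "s > 0"
  shows "q ^ s * (q\<^sup>2) ^ k \<noteq> 1" "- (q ^ s) * (q\<^sup>2) ^ k \<noteq> 1"
proof -
  have e: "q ^ s * (q\<^sup>2) ^ k = q ^ (s + 2 * k)" by (simp add: power_add power_mult)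
  have "s + 2 * k > 0" using s by simp
  from one_minus_power_nonzero[OF q this] e
  show "q ^ s * (q\<^sup>2) ^ k \<noteq> 1" "- (q ^ s) * (q\<^sup>2) ^ k \<noteq> 1"
    by (simp_all add: minus_equation_iff[of _ 1])
qed

lemma upper_gf_Distinct: "norm q < 1 \<Longrightarrow> upper_gf Distinct q s = qpoch_inf (- 2 * q ^ s) (q\<^sup>2)"
  by (simp add: upper_gf_def norm_square_less_one)

lemma upper_gf_Unrestricted: "upper_gf Unrestricted q s = qpoch_inf (- (q ^ s)) (q\<^sup>2) / qpoch_inf (q ^ s) (q\<^sup>2)"
  by (simp add: upper_gf_def)

lemma upper_gf_Unrestricted_shift:
  assumes q: "norm q < 1" and s: "s > 0"
  shows "upper_gf Unrestricted q (2 * n + s)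
    = upper_gf Unrestricted q s * qpoch (q ^ s) (q\<^sup>2) n / qpoch (- (q ^ s)) (q\<^sup>2) n"
proof -
  note q2 = norm_square_less_one[OF q]
  have e: "q ^ (2 * n + s) = q ^ s * (q\<^sup>2) ^ n" by (simp add: power_add power_mult)
  have nz: "qpoch (q ^ s) (q\<^sup>2) n \<noteq> 0" "qpoch (- (q ^ s)) (q\<^sup>2) n \<noteq> 0"
    using progression_not_one[OF q s] by (auto intro!: qpoch_nonzero)
  show ?thesis
    unfolding upper_gf_Unrestricted e mult_minus_left[symmetric]
    using nz qpoch_inf_split[OF q2, of "q ^ s" n] qpoch_inf_split[OF q2, of "- (q ^ s)" n] by simp
qed

text \<open>The terms of the series over the largest even part are those of the Heine series with index at
  least 1, because \<open>(- 1)_(n+1) = 2 * (- Q)_n\<close>; its term of index 0 is the contribution of the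
  overpartitions without even parts.\<close>

lemma Fbar_even_unrestricted_below_odd:
  assumes q: "norm q < 1"
  shows "Fbar Even Unrestricted Odd w q = qpoch_inf (- (q\<^sup>2)) (q\<^sup>2) / qpoch_inf (q\<^sup>2) (q\<^sup>2)
    * (\<Sum>n. q ^ n * (\<Prod>j<n. (denominator_coeff w + numerator_coeff w * (q\<^sup>2) ^ j) / (1 + (q\<^sup>2) ^ Suc j)))"
proof -
  note q2 = norm_square_less_one[OF q]
  let ?t = "\<lambda>n. (q\<^sup>2) ^ n * qpoch (- 1) (q\<^sup>2) n / qpoch (q\<^sup>2) (q\<^sup>2) n * upper_gf w q (2 * n + 1)"
  have "norm (denominator_coeff w * q) < 1" using q by (cases w) auto
  from heine_transformation[OF q2 this, of "numerator_coeff w"]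
  have H: "?t sums (qpoch_inf (- (q\<^sup>2)) (q\<^sup>2) / qpoch_inf (q\<^sup>2) (q\<^sup>2)
    * (\<Sum>n. q ^ n * (\<Prod>j<n. (denominator_coeff w + numerator_coeff w * (q\<^sup>2) ^ j) / (1 + (q\<^sup>2) ^ Suc j))))"
    by (simp add: upper_gf_def power_add mult_ac flip: power_mult)
  have "(\<lambda>n. ?t (Suc n)) sums (Fbar Even Unrestricted Odd w q - upper_gf w q 1)"
  proof -
    have M: "(\<lambda>n. 2 * q ^ (2 * n + 2) * qpoch (- (q\<^sup>2)) (q\<^sup>2) n / qpoch (q\<^sup>2) (q\<^sup>2) (Suc n) * upper_gf w q (2 * n + 2 + 1))
        sums (Fbar Even Unrestricted Odd w q - upper_gf w q 1)"
      using Fbar_by_largest_lower_part[OF q, of Even Odd Unrestricted w] by simp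
    have eq: "?t (Suc n) = 2 * q ^ (2 * n + 2) * qpoch (- (q\<^sup>2)) (q\<^sup>2) n / qpoch (q\<^sup>2) (q\<^sup>2) (Suc n) * upper_gf w q (2 * n + 2 + 1)" for n
    proof -
      have "qpoch (- 1) (q\<^sup>2) (Suc n) = 2 * qpoch (- (q\<^sup>2)) (q\<^sup>2) n"
        using qpoch_Suc_left[of "- 1" "q\<^sup>2" n] by simp
      moreover have "(q\<^sup>2) ^ Suc n = q ^ (2 * n + 2)" by (simp only: power_mult[symmetric] mult_Suc_right add.commute)
      moreover have "2 * Suc n + 1 = 2 * n + 2 + 1" by simp
      ultimately show ?thesis by (simp only: mult_ac)
    qed
    show ?thesis unfolding eq by (rule M)
  qed
  then have "?t sums (Fbar Even Unrestricted Odd w q)"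
    by (subst (asm) sums_Suc_iff) simp
  then show ?thesis using H by (rule sums_unique2)
qed

text \<open>The summand is \<open>q / (1 - q)\<close> times the decrease of
  \<open>(- 2 * v * q)_n * (- 2 * v * Q ^ n)_\<infinity>\<close>, whose limit is \<open>(- 2 * v * q)_\<infinity>\<close>. The parameter \<open>v\<close> is
  \<open>q\<close> for even lower parts and 1 for odd lower parts.\<close>

lemma distinct_parts_telescope:
  assumes q: "norm q < 1"
  shows "(\<lambda>n. 2 * v * q * (q\<^sup>2) ^ n * qpoch (- 2 * v * q) (q\<^sup>2) n * qpoch_inf (- 2 * v * q\<^sup>2 * (q\<^sup>2) ^ n) (q\<^sup>2))
    sums (q / (1 - q) * (qpoch_inf (- 2 * v) (q\<^sup>2) - qpoch_inf (- 2 * v * q) (q\<^sup>2)))"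
proof -
  note q2 = norm_square_less_one[OF q]
  have q1: "1 - q \<noteq> 0" using q by auto
  define T where "T = (\<lambda>n. qpoch (- 2 * v * q) (q\<^sup>2) n * qpoch_inf (- 2 * v * (q\<^sup>2) ^ n) (q\<^sup>2))"
  have "T \<longlonglongrightarrow> qpoch_inf (- 2 * v * q) (q\<^sup>2) * 1"
    unfolding T_def by (intro tendsto_mult qpoch_LIMSEQ q2 qpoch_inf_tail_LIMSEQ)
  then have "(\<lambda>n. T (Suc n) - T n) sums (qpoch_inf (- 2 * v * q) (q\<^sup>2) * 1 - T 0)"
    by (rule telescope_sums)
  then have tel: "(\<lambda>n. - q / (1 - q) * (T (Suc n) - T n))
      sums (- q / (1 - q) * (qpoch_inf (- 2 * v * q) (q\<^sup>2) * 1 - T 0))"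
    by (rule sums_mult)
  have val: "- q / (1 - q) * (qpoch_inf (- 2 * v * q) (q\<^sup>2) * 1 - T 0)
      = q / (1 - q) * (qpoch_inf (- 2 * v) (q\<^sup>2) - qpoch_inf (- 2 * v * q) (q\<^sup>2))"
    using q1 by (simp add: T_def field_simps)
  have summand: "- q / (1 - q) * (T (Suc n) - T n)
      = 2 * v * q * (q\<^sup>2) ^ n * qpoch (- 2 * v * q) (q\<^sup>2) n * qpoch_inf (- 2 * v * q\<^sup>2 * (q\<^sup>2) ^ n) (q\<^sup>2)" for n
  proof -
    define P where "P = qpoch (- 2 * v * q) (q\<^sup>2) n * qpoch_inf (- 2 * v * q\<^sup>2 * (q\<^sup>2) ^ n) (q\<^sup>2)"
    have 1: "T (Suc n) = P * (1 + 2 * v * q * (q\<^sup>2) ^ n)"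
      by (simp add: T_def P_def qpoch_Suc mult_ac)
    have 2: "T n = P * (1 + 2 * v * (q\<^sup>2) ^ n)"
      using qpoch_inf_Suc[OF q2, of "- 2 * v * (q\<^sup>2) ^ n"] by (simp add: T_def P_def mult_ac)
    have 3: "T (Suc n) - T n = (1 - q) * - (2 * v * (q\<^sup>2) ^ n * P)"
      unfolding 1 2 by (simp add: algebra_simps)
    have "- q / d * (d * - Y) = q * Y" if "d \<noteq> 0" for d Y :: complex
      using that by simp
    note cancel = this[OF q1]
    show ?thesis unfolding 3 cancel by (simp add: P_def mult_ac)
  qed
  show ?thesis using tel unfolding val summand .
qed

text \<open>In the names of the eight results, the first two letters give the parity and the restriction of the
  lower parts, the last two those of the upper parts. Here the product in the Heine series collapses
  to \<open>2 / (1 + Q ^ n)\<close>, and the resulting series is half of \<open>1 + \<Theta>^2\<close> by Jacobi's theorem.\<close>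

lemma Fbar_eu_ou:
  assumes q: "norm q < 1" and \<tau>: "q = exp (2 * of_real pi * \<i> * \<tau>)"
  shows "Fbar Even Unrestricted Odd Unrestricted q =
         qpoch_inf (- (q^2)) (q^2) / (2 * qpoch_inf (q^2) (q^2)) * (1 + (jacobi_Theta \<tau>)^2)"
proof -
  note q2 = norm_square_less_one[OF q]
  have prod: "(\<Prod>j<n. (1 + (q\<^sup>2) ^ j) / (1 + (q\<^sup>2) ^ Suc j)) = 2 / (1 + (q\<^sup>2) ^ n)" for n
  proof (induction n)
    case (Suc n)
    have nz: "1 + (q\<^sup>2) ^ n \<noteq> 0"
      by (cases n) (use one_minus_power_nonzero(3)[OF q2, of n] in auto)
    have "(\<Prod>j<Suc n. (1 + (q\<^sup>2) ^ j) / (1 + (q\<^sup>2) ^ Suc j)) = 2 / (1 + (q\<^sup>2) ^ n) * ((1 + (q\<^sup>2) ^ n) / (1 + (q\<^sup>2) ^ Suc n))"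
      using Suc by simp
    also have "\<dots> = 2 / (1 + (q\<^sup>2) ^ Suc n)"
      by (simp only: times_divide_times_eq mult.commute[of 2] mult_divide_mult_cancel_left[OF nz])
    finally show ?case .
  qed simp
  have "(\<lambda>n. 1 / 2 * (4 * (q ^ Suc n / (1 + q ^ (2 * Suc n))))) sums (1 / 2 * ((jacobi_Theta \<tau>)\<^sup>2 - 1))"
    by (intro sums_mult jacobi_two_squares[OF q \<tau>])
  moreover have "1 / 2 * (4 * (q ^ Suc n / (1 + q ^ (2 * Suc n)))) = q ^ Suc n * (2 / (1 + (q\<^sup>2) ^ Suc n))" for n
    unfolding power_mult by (simp add: mult_ac)
  ultimately have "(\<lambda>n. q ^ Suc n * (2 / (1 + (q\<^sup>2) ^ Suc n))) sums (1 / 2 * ((jacobi_Theta \<tau>)\<^sup>2 - 1))"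
    by (simp only:)
  then have "(\<lambda>n. q ^ n * (2 / (1 + (q\<^sup>2) ^ n))) sums (1 / 2 * ((jacobi_Theta \<tau>)\<^sup>2 - 1) + q ^ 0 * (2 / (1 + (q\<^sup>2) ^ 0)))"
    by (subst (asm) sums_Suc_iff) simp
  then have S: "(\<Sum>n. q ^ n * (2 / (1 + (q\<^sup>2) ^ n))) = (1 + (jacobi_Theta \<tau>)\<^sup>2) / 2"
    by (simp add: sums_iff field_simps)
  show ?thesis
    using Fbar_even_unrestricted_below_odd[OF q, of Unrestricted]
    unfolding numerator_coeff.simps denominator_coeff.simps mult_1 prod S by simp
qed

lemma Fbar_ou_eu:
  assumes q: "norm q < 1"
  shows "Fbar Odd Unrestricted Even Unrestricted q =
       qpoch_inf (- (q^2)) (q^2) / qpoch_inf (q^2) (q^2)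
       + 2 * q / (1 - q) * (qpoch_inf (- (q^2)) (q^2) / qpoch_inf (q^2) (q^2))
         * (\<Sum>n. qpoch (- q) (q^2) n * qpoch (q^2) (q^2) n
                 / (qpoch (q^3) (q^2) n * qpoch (- (q^2)) (q^2) n) * q^(2*n))"
proof -
  let ?A = "upper_gf Unrestricted q 2"
  have "2 * q ^ (2 * n + 1) * qpoch (- q) (q\<^sup>2) n / qpoch q (q\<^sup>2) (Suc n) * upper_gf Unrestricted q (2 * n + 2)
     = 2 * q / (1 - q) * ?A * (qpoch (- q) (q^2) n * qpoch (q^2) (q^2) n
                 / (qpoch (q^3) (q^2) n * qpoch (- (q^2)) (q^2) n) * q^(2*n))" for n
  proof -
    have "q * q\<^sup>2 = q ^ 3" by (simp add: eval_nat_numeral)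
    then have "qpoch q (q\<^sup>2) (Suc n) = (1 - q) * qpoch (q ^ 3) (q\<^sup>2) n" by (simp add: qpoch_Suc_left)
    then show ?thesis using upper_gf_Unrestricted_shift[OF q, of 2 n] by (simp add: mult_ac)
  qed
  with Fbar_by_largest_lower_part[OF q, of Odd Even Unrestricted Unrestricted]
  have "(\<lambda>n. 2 * q / (1 - q) * ?A * (qpoch (- q) (q^2) n * qpoch (q^2) (q^2) n
                 / (qpoch (q^3) (q^2) n * qpoch (- (q^2)) (q^2) n) * q^(2*n)))
      sums (Fbar Odd Unrestricted Even Unrestricted q - ?A)"
    by (simp add: numeral_2_eq_2[symmetric] del: power_Suc)
  from sums_mult_suminf[OF this] show ?thesis
    by (simp add: upper_gf_Unrestricted algebra_simps)
qed

lemma Fbar_ed_od: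
  assumes q: "norm q < 1"
  shows "Fbar Even Distinct Odd Distinct q =
       qpoch_inf (- 2 * q) (q^2) - q / (1 - q) * qpoch_inf (- 2 * q^2) (q^2)
       + q / (1 - q) * qpoch_inf (- 2 * q) (q^2)"
proof -
  let ?t = "\<lambda>n. 2 * q ^ (2 * n + 2) * qpoch (- (2 * q\<^sup>2)) (q\<^sup>2) n * qpoch_inf (- 2 * q ^ (2 * n + 3)) (q\<^sup>2)"
  have "?t sums (Fbar Even Distinct Odd Distinct q - qpoch_inf (- 2 * q) (q\<^sup>2))"
    using Fbar_by_largest_lower_part[OF q, of Even Odd Distinct Distinct]
    by (simp add: upper_gf_Distinct[OF q] eval_nat_numeral del: power_Suc)
  moreover have "2 * q * q * (q\<^sup>2) ^ n * qpoch (- 2 * q * q) (q\<^sup>2) n * qpoch_inf (- 2 * q * q\<^sup>2 * (q\<^sup>2) ^ n) (q\<^sup>2) = ?t n" for n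
  proof -
    have pq: "(q\<^sup>2) ^ n = q ^ (2 * n)" by (simp add: power_mult)
    have e: "2 * q * q * (q\<^sup>2) ^ n = 2 * q ^ (2 * n + 2)"
      "- 2 * q * q\<^sup>2 * (q\<^sup>2) ^ n = - 2 * q ^ (2 * n + 3)" "- 2 * q * q = - (2 * q\<^sup>2)"
      unfolding pq by (simp_all add: power_add power2_eq_square power3_eq_cube)
    show ?thesis by (simp only: e)
  qed
  ultimately have eq: "q / (1 - q) * (qpoch_inf (- 2 * q) (q\<^sup>2) - qpoch_inf (- 2 * q * q) (q\<^sup>2))
     = Fbar Even Distinct Odd Distinct q - qpoch_inf (- 2 * q) (q\<^sup>2)"
    using distinct_parts_telescope[OF q, of q] by (simp only: sums_unique2)
  have "- 2 * q * q = - 2 * q\<^sup>2" by (simp add: power2_eq_square)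
  then show ?thesis using eq unfolding \<open>- 2 * q * q = - 2 * q\<^sup>2\<close> by (simp add: algebra_simps)
qed

lemma Fbar_od_ed:
  assumes q: "norm q < 1"
  shows "Fbar Odd Distinct Even Distinct q =
       qpoch_inf (- 2 * q^2) (q^2)
       + q / (1 - q) * (3 * qpoch_inf (- 2 * q^2) (q^2) - qpoch_inf (- 2 * q) (q^2))"
proof -
  let ?t = "\<lambda>n. 2 * q ^ (2 * n + 1) * qpoch (- (2 * q)) (q\<^sup>2) n * qpoch_inf (- 2 * q ^ (2 * n + 2)) (q\<^sup>2)"
  have "?t sums (Fbar Odd Distinct Even Distinct q - qpoch_inf (- 2 * q\<^sup>2) (q\<^sup>2))"
    using Fbar_by_largest_lower_part[OF q, of Odd Even Distinct Distinct]
    by (simp add: upper_gf_Distinct[OF q] numeral_2_eq_2[symmetric] del: power_Suc)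
  moreover have "2 * 1 * q * (q\<^sup>2) ^ n * qpoch (- 2 * 1 * q) (q\<^sup>2) n * qpoch_inf (- 2 * 1 * q\<^sup>2 * (q\<^sup>2) ^ n) (q\<^sup>2) = ?t n" for n
  proof -
    have pq: "(q\<^sup>2) ^ n = q ^ (2 * n)" by (simp add: power_mult)
    have e: "2 * 1 * q * (q\<^sup>2) ^ n = 2 * q ^ (2 * n + 1)" "- 2 * 1 * q = - (2 * q)"
      "- 2 * 1 * q\<^sup>2 * (q\<^sup>2) ^ n = - 2 * q ^ (2 * n + 2)"
      unfolding pq by (simp_all add: power_add power2_eq_square)
    show ?thesis by (simp only: e)
  qed
  ultimately have "q / (1 - q) * (qpoch_inf (- 2 * 1) (q\<^sup>2) - qpoch_inf (- 2 * 1 * q) (q\<^sup>2))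
     = Fbar Odd Distinct Even Distinct q - qpoch_inf (- 2 * q\<^sup>2) (q\<^sup>2)"
    using distinct_parts_telescope[OF q, of 1] by (simp only: sums_unique2)
  moreover have "qpoch_inf (- 2 * 1) (q\<^sup>2) = 3 * qpoch_inf (- 2 * q\<^sup>2) (q\<^sup>2)"
    using qpoch_inf_Suc[OF norm_square_less_one[OF q], of "- 2"] by simp
  ultimately show ?thesis by (simp add: algebra_simps)
qed

lemma Fbar_eu_od:
  assumes q: "norm q < 1"
  shows "Fbar Even Unrestricted Odd Distinct q =
       qpoch_inf (- (q^2)) (q^2) / qpoch_inf (q^2) (q^2)
       * (\<Sum>n. 2^n * q^(n^2) / qpoch (- (q^2)) (q^2) n)"
proof -
  have "q ^ n * (\<Prod>j<n. (0 + 2 * (q\<^sup>2) ^ j) / (1 + (q\<^sup>2) ^ Suc j)) = 2^n * q^(n^2) / qpoch (- (q^2)) (q^2) n" for n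
  proof -
    have "(\<Prod>j<n. 2 * (q\<^sup>2) ^ j) = 2 ^ n * q ^ (2 * (n choose 2))"
    proof (induction n)
      case (Suc n)
      have "2 * (Suc n choose 2) = 2 * n + 2 * (n choose 2)" by (simp add: numeral_2_eq_2)
      then show ?case using Suc by (simp add: power_add mult_ac flip: power_mult)
    qed (simp add: numeral_2_eq_2)
    moreover have "(\<Prod>j<n. 1 + (q\<^sup>2) ^ Suc j) = qpoch (- (q\<^sup>2)) (q\<^sup>2) n" by (simp add: qpoch_def)
    ultimately show ?thesis
      unfolding square_eq_twice_choose[of n, symmetric] by (simp add: prod_dividef power_add mult_ac del: power_Suc)
  qed
  then show ?thesis using Fbar_even_unrestricted_below_odd[OF q, of Distinct] by simp
qed

lemma Fbar_ou_ed:
  assumes q: "norm q < 1"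
  shows "Fbar Odd Unrestricted Even Distinct q =
       qpoch_inf (- 2 * q^2) (q^2)
       + 2 * (\<Sum>n. qpoch (- q) (q^2) n * qpoch_inf (- 2 * q^(2*n + 2)) (q^2)
                 / qpoch q (q^2) (n+1) * q^(2*n + 1))"
proof -
  have "(\<lambda>n. 2 * (qpoch (- q) (q^2) n * qpoch_inf (- 2 * q^(2*n + 2)) (q^2)
                 / qpoch q (q^2) (n+1) * q^(2*n + 1)))
      sums (Fbar Odd Unrestricted Even Distinct q - qpoch_inf (- 2 * q^2) (q^2))"
    using Fbar_by_largest_lower_part[OF q, of Odd Even Unrestricted Distinct]
    by (simp add: upper_gf_Distinct[OF q] numeral_2_eq_2[symmetric] mult_ac del: power_Suc)
  from sums_mult_suminf[OF this] show ?thesis by (simp add: algebra_simps)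
qed

text \<open>The transformation is used with base \<open>q^2\<close> and \<open>a = - 2 * q\<close>, \<open>b = q^2\<close>, \<open>u = - 1\<close>. At \<open>q = 0\<close>, where
  it does not apply, both series have the factor 0.\<close>

lemma Fbar_od_eu:
  assumes q: "norm q < 1" and nz: "\<forall>n. qpoch (2 * q) (q^2) n \<noteq> 0"
  shows "Fbar Odd Distinct Even Unrestricted q =
       qpoch_inf (- (q^2)) (q^2) / qpoch_inf (q^2) (q^2)
       + 2 * q * (qpoch_inf (- (q^2)) (q^2) / qpoch_inf (q^2) (q^2))
         * (- (qpoch_inf (- 2 * q) (q^2) * qpoch_inf (q^2) (q^2) / qpoch_inf (- (q^2)) (q^2))
              * (\<Sum>n. (-1)^n * q^(2*n) / qpoch (2 * q) (q^2) (n+1))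
            + 2 * (\<Sum>n. (-1)^n * 2^n * q^(n^2 + 2*n)
                     / ((1 + q^(2*n + 2)) * qpoch (2 * q) (q^2) (n+1))))"
proof -
  note q2 = norm_square_less_one[OF q]
  define A where "A = upper_gf Unrestricted q 2"
  have A: "A = qpoch_inf (- (q^2)) (q^2) / qpoch_inf (q^2) (q^2)" by (simp add: A_def upper_gf_Unrestricted)
  define S where "S = (\<Sum>n. qpoch (- 2 * q) (q\<^sup>2) n * qpoch (q\<^sup>2) (q\<^sup>2) n / qpoch (- (q\<^sup>2)) (q\<^sup>2) n * (q\<^sup>2) ^ n)"
  have "2 * q ^ (2 * n + 1) * qpoch (- (2 * q)) (q\<^sup>2) n * upper_gf Unrestricted q (2 * n + 2)
      = 2 * q * A * (qpoch (- 2 * q) (q\<^sup>2) n * qpoch (q\<^sup>2) (q\<^sup>2) n / qpoch (- (q\<^sup>2)) (q\<^sup>2) n * (q\<^sup>2) ^ n)" for n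
    using upper_gf_Unrestricted_shift[OF q, of 2 n] by (simp add: A_def mult_ac flip: power_mult)
  with Fbar_by_largest_lower_part[OF q, of Odd Even Distinct Unrestricted]
  have "(\<lambda>n. 2 * q * A * (qpoch (- 2 * q) (q\<^sup>2) n * qpoch (q\<^sup>2) (q\<^sup>2) n / qpoch (- (q\<^sup>2)) (q\<^sup>2) n * (q\<^sup>2) ^ n))
      sums (Fbar Odd Distinct Even Unrestricted q - A)"
    by (simp add: numeral_2_eq_2[symmetric] A_def del: power_Suc)
  from sums_mult_suminf[OF this] have F: "Fbar Odd Distinct Even Unrestricted q = A + 2 * q * A * S"
    by (simp add: S_def algebra_simps)
  have "2 * q * A * S = 2 * q * A * (- (qpoch_inf (- 2 * q) (q^2) * qpoch_inf (q^2) (q^2) / qpoch_inf (- (q^2)) (q^2))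
              * (\<Sum>n. (-1)^n * q^(2*n) / qpoch (2 * q) (q^2) (n+1))
            + 2 * (\<Sum>n. (-1)^n * 2^n * q^(n^2 + 2*n)
                     / ((1 + q^(2*n + 2)) * qpoch (2 * q) (q^2) (n+1))))"
  proof (cases "q = 0")
    case False
    have "(- 1) * (q\<^sup>2) ^ j \<noteq> (q\<^sup>2) ^ k" for j k
    proof
      assume eq: "(- 1) * (q\<^sup>2) ^ j = (q\<^sup>2) ^ k"
      then have "norm ((q\<^sup>2) ^ j) = norm ((q\<^sup>2) ^ k)" by (metis mult_minus1 norm_minus_cancel)
      then have "norm (q\<^sup>2) ^ j = norm (q\<^sup>2) ^ k" by (simp only: norm_power)
      moreover have "norm (q\<^sup>2) > 0" using False by simp
      ultimately have "j = k" using q2 power_inject_exp'[of "norm (q\<^sup>2)" j k] by simp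
      then show False using eq False by simp
    qed
    moreover have "2 * q * (q\<^sup>2) ^ k \<noteq> 1" for k
      using nz[rule_format, of "Suc k"] by (simp add: qpoch_Suc)
    ultimately have *: "(\<lambda>n. (- (- 2 * q) * q\<^sup>2 * - 1) ^ n * (q\<^sup>2) ^ (n choose 2) * qpoch (- 1) (q\<^sup>2) (Suc n)
            / (qpoch (2 * q) (q\<^sup>2) (Suc n) * qpoch (- (q\<^sup>2)) (q\<^sup>2) (Suc n)))
      sums (S - (- 1) * (qpoch_inf (- 2 * q) (q\<^sup>2) * qpoch_inf (q\<^sup>2) (q\<^sup>2) / qpoch_inf (- (q\<^sup>2)) (q\<^sup>2))
          * (\<Sum>n. (- (q\<^sup>2)) ^ n / qpoch (2 * q) (q\<^sup>2) (Suc n)))"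
      using three_phi_two_partial_theta[OF q2, of "- 1" "q\<^sup>2" "- 2 * q"] False q2 by (simp add: S_def)
    have "(- (- 2 * q) * q\<^sup>2 * - 1) ^ n * (q\<^sup>2) ^ (n choose 2) * qpoch (- 1) (q\<^sup>2) (Suc n)
            / (qpoch (2 * q) (q\<^sup>2) (Suc n) * qpoch (- (q\<^sup>2)) (q\<^sup>2) (Suc n))
        = 2 * ((-1)^n * 2^n * q^(n^2 + 2*n) / ((1 + q^(2*n + 2)) * qpoch (2 * q) (q^2) (n+1)))" for n
    proof -
      have "- (- 2 * q) * q\<^sup>2 * - 1 = (- 1) * 2 * q ^ 3" by (simp add: eval_nat_numeral)
      then have "(- (- 2 * q) * q\<^sup>2 * - 1) ^ n * (q\<^sup>2) ^ (n choose 2) = (- 1) ^ n * 2 ^ n * q ^ (3 * n + 2 * (n choose 2))"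
        by (simp only: power_mult_distrib power_mult power_add mult.assoc)
      also have "3 * n + 2 * (n choose 2) = n\<^sup>2 + 2 * n"
        using square_eq_twice_choose[of n] by linarith
      finally have e1: "(- (- 2 * q) * q\<^sup>2 * - 1) ^ n * (q\<^sup>2) ^ (n choose 2) = (- 1) ^ n * 2 ^ n * q ^ (n\<^sup>2 + 2 * n)" .
      have e2: "qpoch (- 1) (q\<^sup>2) (Suc n) = 2 * qpoch (- (q\<^sup>2)) (q\<^sup>2) n"
        using qpoch_Suc_left[of "- 1" "q\<^sup>2" n] by simp
      have e3: "qpoch (- (q\<^sup>2)) (q\<^sup>2) (Suc n) = qpoch (- (q\<^sup>2)) (q\<^sup>2) n * (1 + q ^ (2 * n + 2))"
        unfolding power_even_shift by (simp add: qpoch_Suc)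
      have "qpoch (- (q\<^sup>2)) (q\<^sup>2) n \<noteq> 0" by (rule qpoch_self_nonzero[OF q2])
      then show ?thesis unfolding e1 e2 e3 by (simp add: mult_ac)
    qed
    with * have eqS: "S - (- 1) * (qpoch_inf (- 2 * q) (q\<^sup>2) * qpoch_inf (q\<^sup>2) (q\<^sup>2) / qpoch_inf (- (q\<^sup>2)) (q\<^sup>2))
          * (\<Sum>n. (- (q\<^sup>2)) ^ n / qpoch (2 * q) (q\<^sup>2) (Suc n))
        = 2 * (\<Sum>n. (-1)^n * 2^n * q^(n^2 + 2*n) / ((1 + q^(2*n + 2)) * qpoch (2 * q) (q^2) (n+1)))"
      by (intro sums_mult_suminf) (simp only:)
    have r: "(- (q\<^sup>2)) ^ n / qpoch (2 * q) (q\<^sup>2) (Suc n) = (-1)^n * q^(2*n) / qpoch (2 * q) (q^2) (n+1)" for n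
      by (simp add: power_minus[of "q\<^sup>2"] power_mult)
    have "S = 2 * (\<Sum>n. (-1)^n * 2^n * q^(n^2 + 2*n) / ((1 + q^(2*n + 2)) * qpoch (2 * q) (q^2) (n+1)))
        + (- 1) * (qpoch_inf (- 2 * q) (q\<^sup>2) * qpoch_inf (q\<^sup>2) (q\<^sup>2) / qpoch_inf (- (q\<^sup>2)) (q\<^sup>2))
          * (\<Sum>n. (-1)^n * q^(2*n) / qpoch (2 * q) (q^2) (n+1))"
      using eqS unfolding r by (simp only: diff_eq_eq)
    then show ?thesis by (simp only: mult_minus_left mult_1_left add.commute)
  qed simp
  then show ?thesis unfolding F A by simp
qed

text \<open>The transformation is used with base \<open>q^2\<close> and \<open>a = - 2 * q^2\<close>, \<open>b = q^3\<close>, \<open>u = - 1 / q\<close>. At \<open>q = 0\<close>,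
  where it does not apply, both series have the factor 0.\<close>

lemma Fbar_ed_ou:
  assumes q: "norm q < 1" and nz: "\<forall>n. qpoch (2 * q) (q^2) n \<noteq> 0"
  shows "Fbar Even Distinct Odd Unrestricted q =
       qpoch_inf (- q) (q^2) / qpoch_inf q (q^2)
       - 2 * q * qpoch_inf (- 2 * q^2) (q^2)
         * (\<Sum>n. (-1)^n * q^(2*n) / qpoch (2 * q) (q^2) (n+1))
       + 2 * q * qpoch_inf (- q) (q^2) / qpoch_inf (q^3) (q^2)
         * (\<Sum>n. (-1)^n * 2^n * qpoch (- q) (q^2) n * q^(n^2 + 3*n)
                 / (qpoch (2 * q) (q^2) (n+1) * qpoch (- (q^2)) (q^2) (n+1)))"
proof -
  note q2 = norm_square_less_one[OF q]
  define B where "B = upper_gf Unrestricted q 3"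
  have B: "B = qpoch_inf (- (q^3)) (q^2) / qpoch_inf (q^3) (q^2)" by (simp add: B_def upper_gf_Unrestricted)
  have qq: "q * q\<^sup>2 = q ^ 3" by (simp add: eval_nat_numeral)
  define S where "S = (\<Sum>n. qpoch (- 2 * q\<^sup>2) (q\<^sup>2) n * qpoch (q ^ 3) (q\<^sup>2) n / qpoch (- (q ^ 3)) (q\<^sup>2) n * (q\<^sup>2) ^ n)"
  define X where "X = qpoch_inf (- q) (q^2) / qpoch_inf q (q^2)"
  have eq: "2 * q ^ (2 * n + 2) * qpoch (- (2 * q\<^sup>2)) (q\<^sup>2) n * upper_gf Unrestricted q (2 * n + 3)
      = 2 * q\<^sup>2 * B * (qpoch (- 2 * q\<^sup>2) (q\<^sup>2) n * qpoch (q ^ 3) (q\<^sup>2) n / qpoch (- (q ^ 3)) (q\<^sup>2) n * (q\<^sup>2) ^ n)" for n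
  proof -
    show ?thesis unfolding power_even_shift
      using upper_gf_Unrestricted_shift[OF q, of 3 n] by (simp add: B_def mult_ac)
  qed
  have "(\<lambda>n. 2 * q ^ (2 * n + 2) * qpoch (- (2 * q\<^sup>2)) (q\<^sup>2) n * upper_gf Unrestricted q (2 * n + 3))
      sums (Fbar Even Distinct Odd Unrestricted q - X)"
    using Fbar_by_largest_lower_part[OF q, of Even Odd Distinct Unrestricted]
    by (simp add: upper_gf_Unrestricted[of q "Suc 0"] X_def eval_nat_numeral del: power_Suc)
  then have "(\<lambda>n. 2 * q\<^sup>2 * B * (qpoch (- 2 * q\<^sup>2) (q\<^sup>2) n * qpoch (q ^ 3) (q\<^sup>2) n / qpoch (- (q ^ 3)) (q\<^sup>2) n * (q\<^sup>2) ^ n))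
      sums (Fbar Even Distinct Odd Unrestricted q - X)"
    unfolding eq .
  from sums_mult_suminf[OF this] have F: "Fbar Even Distinct Odd Unrestricted q = X + 2 * q\<^sup>2 * B * S"
    by (simp add: S_def algebra_simps)
  define \<Sigma>1 where "\<Sigma>1 = (\<Sum>n. (-1)^n * q^(2*n) / qpoch (2 * q) (q^2) (n+1))"
  define \<Sigma>2 where "\<Sigma>2 = (\<Sum>n. (-1)^n * 2^n * qpoch (- q) (q^2) n * q^(n^2 + 3*n)
                 / (qpoch (2 * q) (q^2) (n+1) * qpoch (- (q^2)) (q^2) (n+1)))"
  have "2 * q\<^sup>2 * B * S = - (2 * q * qpoch_inf (- 2 * q^2) (q^2) * \<Sigma>1)
       + 2 * q * qpoch_inf (- q) (q^2) / qpoch_inf (q^3) (q^2) * \<Sigma>2"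
  proof (cases "q = 0")
    case False
    have "(- 1 / q) * (q\<^sup>2) ^ j \<noteq> (q\<^sup>2) ^ k" for j k
    proof
      assume "(- 1 / q) * (q\<^sup>2) ^ j = (q\<^sup>2) ^ k"
      then have "- (q ^ (2 * j)) = q ^ (2 * k + 1)" using False by (simp add: field_simps flip: power_mult)
      then have "norm (q ^ (2 * j)) = norm (q ^ (2 * k + 1))" by (metis norm_minus_cancel)
      then have "norm q ^ (2 * j) = norm q ^ (2 * k + 1)" by (simp only: norm_power)
      moreover have "norm q > 0" using False by simp
      ultimately have "2 * j = 2 * k + 1" using q power_inject_exp'[of "norm q" "2 * j" "2 * k + 1"] by simp
      then show False by presburger
    qed
    moreover have "2 * q * (q\<^sup>2) ^ k \<noteq> 1" for k
      using nz[rule_format, of "Suc k"] by (simp add: qpoch_Suc)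
    moreover have e: "- 2 * q\<^sup>2 * (- 1 / q) = 2 * q" "q ^ 3 * (- 1 / q) = - (q\<^sup>2)" "q\<^sup>2 / (- 1 / q) = - (q ^ 3)"
      using False by (simp_all add: eval_nat_numeral)
    ultimately have *: "(\<lambda>n. (- (- 2 * q\<^sup>2) * q ^ 3 * (- 1 / q)) ^ n * (q\<^sup>2) ^ (n choose 2) * qpoch (- 1 / q) (q\<^sup>2) (Suc n)
            / (qpoch (2 * q) (q\<^sup>2) (Suc n) * qpoch (- (q\<^sup>2)) (q\<^sup>2) (Suc n)))
      sums (S - (- 1 / q) * (qpoch_inf (- 2 * q\<^sup>2) (q\<^sup>2) * qpoch_inf (q ^ 3) (q\<^sup>2) / qpoch_inf (- (q ^ 3)) (q\<^sup>2))
          * (\<Sum>n. (- (q\<^sup>2)) ^ n / qpoch (2 * q) (q\<^sup>2) (Suc n)))"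
      using three_phi_two_partial_theta[OF q2, of "- 1 / q" "q ^ 3" "- 2 * q\<^sup>2"] False q2
      unfolding S_def e by simp
    have "(- (- 2 * q\<^sup>2) * q ^ 3 * (- 1 / q)) ^ n * (q\<^sup>2) ^ (n choose 2) * qpoch (- 1 / q) (q\<^sup>2) (Suc n)
            / (qpoch (2 * q) (q\<^sup>2) (Suc n) * qpoch (- (q\<^sup>2)) (q\<^sup>2) (Suc n))
        = (1 + 1 / q) * ((-1)^n * 2^n * qpoch (- q) (q^2) n * q^(n^2 + 3*n)
                 / (qpoch (2 * q) (q^2) (n+1) * qpoch (- (q^2)) (q^2) (n+1)))" for n
    proof -
      have "- (- 2 * q\<^sup>2) * q ^ 3 * (- 1 / q) = (- 1) * 2 * q ^ 4" using False by (simp add: eval_nat_numeral)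
      then have "(- (- 2 * q\<^sup>2) * q ^ 3 * (- 1 / q)) ^ n * (q\<^sup>2) ^ (n choose 2) = (- 1) ^ n * 2 ^ n * q ^ (4 * n + 2 * (n choose 2))"
        by (simp only: power_mult_distrib power_mult power_add mult.assoc)
      moreover have "4 * n + 2 * (n choose 2) = n\<^sup>2 + 3 * n"
        using square_eq_twice_choose[of n] by linarith
      moreover have "qpoch (- 1 / q) (q\<^sup>2) (Suc n) = (1 + 1 / q) * qpoch (- q) (q\<^sup>2) n"
      proof -
        have "- 1 / q * q\<^sup>2 = - q" using False by (simp add: power2_eq_square)
        then show ?thesis using qpoch_Suc_left[of "- 1 / q" "q\<^sup>2" n] by simp
      qed
      ultimately show ?thesis by simp
    qed
    with * have eqS: "S - (- 1 / q) * (qpoch_inf (- 2 * q\<^sup>2) (q\<^sup>2) * qpoch_inf (q ^ 3) (q\<^sup>2) / qpoch_inf (- (q ^ 3)) (q\<^sup>2))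
          * (\<Sum>n. (- (q\<^sup>2)) ^ n / qpoch (2 * q) (q\<^sup>2) (Suc n)) = (1 + 1 / q) * \<Sigma>2"
      unfolding \<Sigma>2_def by (intro sums_mult_suminf) (simp only:)
    have r: "(- (q\<^sup>2)) ^ n / qpoch (2 * q) (q\<^sup>2) (Suc n) = (-1)^n * q^(2*n) / qpoch (2 * q) (q^2) (n+1)" for n
      by (simp add: power_minus[of "q\<^sup>2"] power_mult)
    have "S = (1 + 1 / q) * \<Sigma>2
        + (- 1 / q) * (qpoch_inf (- 2 * q\<^sup>2) (q\<^sup>2) * qpoch_inf (q ^ 3) (q\<^sup>2) / qpoch_inf (- (q ^ 3)) (q\<^sup>2)) * \<Sigma>1"
      using eqS unfolding r \<Sigma>1_def by (simp only: diff_eq_eq)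
    then have S: "S = (- 1 / q) * (qpoch_inf (- 2 * q\<^sup>2) (q\<^sup>2) / B) * \<Sigma>1 + (1 + 1 / q) * \<Sigma>2"
      unfolding B by (simp only: divide_divide_eq_right add.commute)
    have "qpoch_inf (- (q ^ 3)) (q\<^sup>2) \<noteq> 0" "qpoch_inf (q ^ 3) (q\<^sup>2) \<noteq> 0"
      using qpoch_inf_nonzero[OF q2 progression_not_one(1)[OF q, of 3]]
        qpoch_inf_nonzero[OF q2 progression_not_one(2)[OF q, of 3]] by simp_all
    then have B0: "B \<noteq> 0" by (simp add: B)
    have "qpoch_inf (- q) (q\<^sup>2) = (1 + q) * qpoch_inf (- (q ^ 3)) (q\<^sup>2)"
      using qpoch_inf_Suc[OF q2, of "- q"] qq by simp
    then have "2 * q * qpoch_inf (- q) (q^2) / qpoch_inf (q^3) (q^2) = 2 * q * (1 + q) * B" by (simp add: B)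
    moreover have "2 * q\<^sup>2 * B * S = - (2 * q * qpoch_inf (- 2 * q^2) (q^2) * \<Sigma>1) + 2 * q * (1 + q) * B * \<Sigma>2"
      unfolding S using False B0 by (simp add: field_simps power2_eq_square)
    ultimately show ?thesis by simp
  qed simp
  then show ?thesis unfolding F X_def \<Sigma>1_def \<Sigma>2_def by simp
qed

theorem theorem1p1:
  fixes q :: complex
  assumes "norm q < 1"
  shows
    "(\<forall>\<tau>. q = exp (2 * of_real pi * \<i> * \<tau>) \<longrightarrow>
       Fbar Even Unrestricted Odd Unrestricted q =
         qpoch_inf (- (q^2)) (q^2) / (2 * qpoch_inf (q^2) (q^2)) * (1 + (jacobi_Theta \<tau>)^2))
     \<and> (Fbar Odd Unrestricted Even Unrestricted q =
       qpoch_inf (- (q^2)) (q^2) / qpoch_inf (q^2) (q^2)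
       + 2 * q / (1 - q) * (qpoch_inf (- (q^2)) (q^2) / qpoch_inf (q^2) (q^2))
         * (\<Sum>n. qpoch (- q) (q^2) n * qpoch (q^2) (q^2) n
                 / (qpoch (q^3) (q^2) n * qpoch (- (q^2)) (q^2) n) * q^(2*n)))
     \<and> (Fbar Even Distinct Odd Distinct q =
       qpoch_inf (- 2 * q) (q^2) - q / (1 - q) * qpoch_inf (- 2 * q^2) (q^2)
       + q / (1 - q) * qpoch_inf (- 2 * q) (q^2))
     \<and> (Fbar Odd Distinct Even Distinct q =
       qpoch_inf (- 2 * q^2) (q^2)
       + q / (1 - q) * (3 * qpoch_inf (- 2 * q^2) (q^2) - qpoch_inf (- 2 * q) (q^2)))
     \<and> (Fbar Even Unrestricted Odd Distinct q =
       qpoch_inf (- (q^2)) (q^2) / qpoch_inf (q^2) (q^2)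
       * (\<Sum>n. 2^n * q^(n^2) / qpoch (- (q^2)) (q^2) n))
     \<and> ((\<forall>n. qpoch (2 * q) (q^2) n \<noteq> 0) \<longrightarrow>
     Fbar Odd Distinct Even Unrestricted q =
       qpoch_inf (- (q^2)) (q^2) / qpoch_inf (q^2) (q^2)
       + 2 * q * (qpoch_inf (- (q^2)) (q^2) / qpoch_inf (q^2) (q^2))
         * (- (qpoch_inf (- 2 * q) (q^2) * qpoch_inf (q^2) (q^2) / qpoch_inf (- (q^2)) (q^2))
              * (\<Sum>n. (-1)^n * q^(2*n) / qpoch (2 * q) (q^2) (n+1))
            + 2 * (\<Sum>n. (-1)^n * 2^n * q^(n^2 + 2*n)
                     / ((1 + q^(2*n + 2)) * qpoch (2 * q) (q^2) (n+1)))))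
     \<and> ((\<forall>n. qpoch (2 * q) (q^2) n \<noteq> 0) \<longrightarrow>
     Fbar Even Distinct Odd Unrestricted q =
       qpoch_inf (- q) (q^2) / qpoch_inf q (q^2)
       - 2 * q * qpoch_inf (- 2 * q^2) (q^2)
         * (\<Sum>n. (-1)^n * q^(2*n) / qpoch (2 * q) (q^2) (n+1))
       + 2 * q * qpoch_inf (- q) (q^2) / qpoch_inf (q^3) (q^2)
         * (\<Sum>n. (-1)^n * 2^n * qpoch (- q) (q^2) n * q^(n^2 + 3*n)
                 / (qpoch (2 * q) (q^2) (n+1) * qpoch (- (q^2)) (q^2) (n+1))))
     \<and> (Fbar Odd Unrestricted Even Distinct q =
       qpoch_inf (- 2 * q^2) (q^2)
       + 2 * (\<Sum>n. qpoch (- q) (q^2) n * qpoch_inf (- 2 * q^(2*n + 2)) (q^2)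
                 / qpoch q (q^2) (n+1) * q^(2*n + 1)))"
  using Fbar_eu_ou[OF assms] Fbar_ou_eu[OF assms] Fbar_ed_od[OF assms] Fbar_od_ed[OF assms]
    Fbar_eu_od[OF assms] Fbar_od_eu[OF assms] Fbar_ed_ou[OF assms] Fbar_ou_ed[OF assms]
  by (intro conjI allI impI)

end
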